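(* As $n\to\infty$, $$n^{-1/3}\bigl(X_n^*-X_{n,\lceil n/2\rceil}\bigr)\overset{\mathrm d}{\longrightarrow}\tfrac12 V,$$ where $V=\max_{t\in\mathbb R}\bigl(B(t)-t^2/2\bigr)$, and $$\mathbb E X_n^*=\mathbb E X_{n,\lceil n/2\rceil}+\tfrac12\,\mathbb E V\,n^{1/3}+o(n^{1/3})=\tfrac14 n+\tfrac12\,\mathbb E V\,n^{1/3}+o(n^{1/3}).$$
   Context: For $n\ge 2$ let $\sigma$ be a uniformly random permutation of $\{1,\dots,n\}$. For $0\le m\le n$ and $1\le k\le n$ let $I_{n,m}(k)=1$ if $\sigma^{-1}(k)\le m$ and $I_{n,m}(k)=0$ otherwise. Let $X_{n,m}$ be the number of runs (maximal blocks of consecutive ones) in the string $I_{n,m}(1),\dots,I_{n,m}(n)$, i.e. $$X_{n,m}=I_{n,m}(1)+\sum_{k=1}^{n-1}(1-I_{n,m}(k))I_{n,m}(k+1),$$ and let $X_n^*=\max_{0\le m\le n}X_{n,m}$. $B(t)$, $-\infty<t<\infty$, is a standard two-sided Brownian motion: $B(0)=0$ and $(B(t))_{t\ge0}$, $(B(-t))_{t\ge0}$ are two independent standard Brownian motions. $\overset{\mathrm d}{\longrightarrow}$ denotes convergence in distribution. *)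

theory Defs
  imports "HOL-Probability.Probability" "HOL-Library.Landau_Symbols"
begin

text \<open>
  The indicator \<open>run_indicator m \<sigma> k\<close> is $I_{n,m}(k)$; it does not depend on \<open>n\<close>, because a
  permutation of \<open>{1..n}\<close> is represented by a bijection of \<open>nat\<close> fixing everything outside \<open>{1..n}\<close>.
\<close>

definition run_indicator :: "nat \<Rightarrow> (nat \<Rightarrow> nat) \<Rightarrow> nat \<Rightarrow> real" where
  "run_indicator m \<sigma> k = of_bool (inv \<sigma> k \<le> m)"

definition num_runs :: "nat \<Rightarrow> nat \<Rightarrow> (nat \<Rightarrow> nat) \<Rightarrow> real" where
  "num_runs n m \<sigma> = run_indicator m \<sigma> 1
     + (\<Sum>k = 1..n - 1. (1 - run_indicator m \<sigma> k) * run_indicator m \<sigma> (k + 1))"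

definition max_num_runs :: "nat \<Rightarrow> (nat \<Rightarrow> nat) \<Rightarrow> real" where
  "max_num_runs n \<sigma> = Max ((\<lambda>m. num_runs n m \<sigma>) ` {0..n})"

definition random_perm :: "nat \<Rightarrow> (nat \<Rightarrow> nat) pmf" where
  "random_perm n = pmf_of_set {\<sigma>. \<sigma> permutes {1..n}}"

text \<open>
  Only the values \<open>W t\<close> with \<open>t \<ge> 0\<close> are constrained, so that both halves of a
  two-sided process can be treated as processes with time parameter of type \<open>real\<close>.
\<close>

locale standard_brownian_motion = prob_space M
  for M :: "'a measure" and W :: "real \<Rightarrow> 'a \<Rightarrow> real" +
  assumes measurable_W: "\<And>t. 0 \<le> t \<Longrightarrow> W t \<in> borel_measurable M"
    and starts_at_0: "\<And>\<omega>. \<omega> \<in> space M \<Longrightarrow> W 0 \<omega> = 0"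
    and continuous_paths: "\<And>\<omega>. \<omega> \<in> space M \<Longrightarrow> continuous_on {0..} (\<lambda>t. W t \<omega>)"
    and gaussian_increments: "\<And>s t. 0 \<le> s \<Longrightarrow> s < t \<Longrightarrow>
      distributed M lborel (\<lambda>\<omega>. W t \<omega> - W s \<omega>) (\<lambda>x. ennreal (normal_density 0 (sqrt (t - s)) x))"
    and independent_increments: "\<And>(N::nat) t. 0 \<le> t 0 \<Longrightarrow> (\<And>i. i < N \<Longrightarrow> t i \<le> t (Suc i)) \<Longrightarrow>
      indep_vars (\<lambda>_. borel) (\<lambda>i \<omega>. W (t (Suc i)) \<omega> - W (t i) \<omega>) {..<N}"

locale two_sided_brownian_motion = prob_space M
  for M :: "'a measure" and B :: "real \<Rightarrow> 'a \<Rightarrow> real" +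
  assumes forward: "standard_brownian_motion M B"
    and backward: "standard_brownian_motion M (\<lambda>t. B (- t))"
    and independent_halves:
      "indep_var (PiM {0..} (\<lambda>_. borel)) (\<lambda>\<omega>. \<lambda>t\<in>{0..}. B t \<omega>)
                 (PiM {0..} (\<lambda>_. borel)) (\<lambda>\<omega>. \<lambda>t\<in>{0..}. B (- t) \<omega>)"

text \<open>
  On \<open>real\<close>, \<open>SUP\<close> is the least upper bound only for sets that are bounded above (otherwise it is
  an unspecified constant). This and attainment of the maximum hold almost surely, but not for
  every path.
\<close>

definition parabolic_max :: "(real \<Rightarrow> 'a \<Rightarrow> real) \<Rightarrow> 'a \<Rightarrow> real" where
  "parabolic_max B \<omega> = (SUP t. B t \<omega> - t\<^sup>2 / 2)"

end

theory Submission
  imports Defs "HOL-Real_Asymp.Real_Asymp"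
begin

text \<open>
  Runs are counted on the cycle instead of the line, which changes \<open>X\<close> by at most \<open>1\<close>. When a uniformly
  random one of \<open>N\<close> free positions is filled, the number \<open>C\<close> of cyclic runs has mean increment \<open>1 - 2 C / N\<close>;
  hence \<open>(C - \<mu>\<^sub>m) / (N (N - 1))\<close> is a martingale, where \<open>\<mu>\<^sub>m = m (n - m) / (n - 1)\<close>. Near \<open>m = n / 2\<close> the
  increments of \<open>C\<close> have conditional variance close to \<open>1 / 2\<close>, and \<open>\<mu>\<^sub>m\<close> is a parabola.

  Given the set of positions occupied at time \<open>\<lceil>n / 2\<rceil>\<close>, the future and the reversed past are independent, and
  complementation turns the reversed past into a filling process as well. For one such process,
  a supermartingale built from \<open>cosh\<close> bounds the probability of crossing a line, which confines the maximum
  to a window of order \<open>n\<close> to the power \<open>2/3\<close> and gives exponential tails; and characteristic functions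
  show that increments over blocks of that order are asymptotically Gaussian, uniformly over all
  typical starting configurations. The maximum over the block end points is compared with the maximum
  of a Gaussian random walk by backward induction over the blocks, with Lipschitz test functions, and then the
  blocks are refined. The exponential tails also give uniform integrability, hence convergence of the means.
\<close>

subsection \<open>Averages over random permutations\<close>

text \<open>The scaling explains the constants. Brownian time \<open>t\<close> stands for about
  \<open>n^(2/3) t / 2\<close> steps. With \<open>n / 2\<close> free positions, \<open>n / 4\<close>
  runs and \<open>n / 8\<close> isolated free positions, a step has mean about 0 and variance about
  \<open>2 (n / 8) / (n / 2) = 1 / 2\<close>; so those steps have standard deviation
  \<open>n^(1/3) sqrt t / 2\<close>, while the mean loses \<open>j^2 / n = n^(1/3) t^2 / 4\<close>
  in \<open>j\<close> steps, and \<open>B(t) / 2 - t^2 / 4\<close> is half of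
  \<open>B(t) - t^2 / 2\<close>. The obstacle is that the law of a block depends on the
  configuration at its start. Typicality is therefore checked only at half filling, with a tolerance
  \<open>\<tau> n\<close> so coarse that bounded changes per step cannot destroy it during the whole
  window. A functional limit theorem is avoided: only finitely many block ends are compared, and the
  rest of the path is controlled by the crossing bound. Test functions are Lipschitz with constant 1
  because averaging over later blocks must not lose anything.\<close>

definition avg :: "'a set \<Rightarrow> ('a \<Rightarrow> 'b::real_vector) \<Rightarrow> 'b" where
  "avg A f = (\<Sum>x\<in>A. f x) /\<^sub>R real (card A)"

lemma avg_cong: "A = B \<Longrightarrow> (\<And>x. x \<in> B \<Longrightarrow> f x = g x) \<Longrightarrow> avg A f = avg B g"
  by (simp add: avg_def)

lemma avg_const: "finite A \<Longrightarrow> A \<noteq> {} \<Longrightarrow> avg A (\<lambda>_. c) = c"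
  by (simp add: avg_def sum_constant_scaleR)

lemma avg_add: "avg A (\<lambda>x. f x + g x) = avg A f + avg A g"
  by (simp add: avg_def sum.distrib scaleR_right_distrib)

lemma avg_diff: "avg A (\<lambda>x. f x - g x) = avg A f - avg A g"
  by (simp add: avg_def sum_subtractf scaleR_right_diff_distrib)

lemma avg_mult_left: fixes c :: "'b::real_algebra" shows "avg A (\<lambda>x. c * f x) = c * avg A f"
  by (simp add: avg_def sum_distrib_left)

lemma avg_mult_right: fixes c :: "'b::real_algebra" shows "avg A (\<lambda>x. f x * c) = avg A f * c"
  by (simp add: avg_def sum_distrib_right)

lemma avg_sum: "avg A (\<lambda>x. \<Sum>i\<in>I. f i x) = (\<Sum>i\<in>I. avg A (f i))"
  unfolding avg_def by (subst sum.swap) (simp add: scaleR_sum_right)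

lemma avg_mono: fixes f g :: "'a \<Rightarrow> real"
  shows "(\<And>x. x \<in> A \<Longrightarrow> f x \<le> g x) \<Longrightarrow> avg A f \<le> avg A g"
  by (auto simp: avg_def intro!: mult_left_mono sum_mono)

lemma avg_nonneg: fixes f :: "'a \<Rightarrow> real"
  shows "(\<And>x. x \<in> A \<Longrightarrow> 0 \<le> f x) \<Longrightarrow> 0 \<le> avg A f"
  by (auto simp: avg_def intro!: mult_nonneg_nonneg sum_nonneg)

lemma avg_le_const: fixes f :: "'a \<Rightarrow> real"
  assumes "finite A" "A \<noteq> {}" "\<And>x. x \<in> A \<Longrightarrow> f x \<le> c" shows "avg A f \<le> c"
  using avg_mono[of A f "\<lambda>_. c"] avg_const[OF assms(1,2), of c] assms(3) by simp

lemma norm_avg_le: fixes f :: "'a \<Rightarrow> 'b::real_normed_vector"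
  shows "norm (avg A f) \<le> avg A (\<lambda>x. norm (f x))"
  by (auto simp: avg_def intro!: mult_left_mono norm_sum)

lemma avg_complex_of_real: "avg A (\<lambda>x. complex_of_real (f x)) = complex_of_real (avg A f)"
  by (simp add: avg_def scaleR_conv_of_real)

lemma norm_avg_diff_le:
  fixes f g :: "'a \<Rightarrow> 'b::real_normed_vector"
  assumes "finite A" "A \<noteq> {}" "\<And>x. x \<in> A \<Longrightarrow> norm (f x - g x) \<le> e"
  shows "norm (avg A f - avg A g) \<le> e"
proof -
  have "norm (avg A f - avg A g) = norm (avg A (\<lambda>x. f x - g x))" by (simp add: avg_diff)
  also have "\<dots> \<le> avg A (\<lambda>x. norm (f x - g x))" by (rule norm_avg_le)
  also have "\<dots> \<le> e" by (rule avg_le_const) (use assms in auto)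
  finally show ?thesis .
qed

lemma abs_avg_le:
  fixes f :: "'a \<Rightarrow> real"
  assumes "finite X" "X \<noteq> {}" "\<And>x. x \<in> X \<Longrightarrow> \<bar>f x\<bar> \<le> c" shows "\<bar>avg X f\<bar> \<le> c"
  using norm_avg_diff_le[of X f "\<lambda>_. 0" c] assms by (simp add: avg_const)

lemma avg_reindex:
  assumes "bij_betw h A B" shows "avg A (\<lambda>x. f (h x)) = avg B f"
  unfolding avg_def using sum.reindex_bij_betw[OF assms, of f] bij_betw_same_card[OF assms] by simp

text \<open>Fibres of equal size make a uniform pair the same as a uniform first coordinate followed
  by a uniform point of its fibre; otherwise the outer average would be weighted by fibre
  size.\<close>

lemma avg_Sigma:
  assumes "finite A" "\<And>x. x \<in> A \<Longrightarrow> finite (B x)" "\<And>x. x \<in> A \<Longrightarrow> card (B x) = c"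
  shows "avg (Sigma A B) f = avg A (\<lambda>x. avg (B x) (\<lambda>y. f (x, y)))"
proof -
  have "(\<Sum>p\<in>Sigma A B. f p) = (\<Sum>x\<in>A. \<Sum>y\<in>B x. f (x, y))"
    using assms by (subst sum.Sigma) auto
  moreover have "card (Sigma A B) = card A * c"
    using assms by (simp add: card_SigmaI)
  ultimately show ?thesis
    using assms(3) by (simp add: avg_def scaleR_sum_right)
qed

lemma integral_pmf_of_set_avg:
  "finite A \<Longrightarrow> A \<noteq> {} \<Longrightarrow> measure_pmf.expectation (pmf_of_set A) f = avg A (f :: 'a \<Rightarrow> real)"
  by (simp add: integral_pmf_of_set avg_def divide_inverse mult.commute)

text \<open>An element of \<open>perms (A - S)\<close> encodes the random order in which the free positions \<open>A - S\<close> are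
  filled, starting from the set \<open>S\<close> of occupied positions; \<open>S \<union> set (take i xs)\<close> is the set occupied
  after \<open>i\<close> steps.\<close>
abbreviation perms :: "'a set \<Rightarrow> 'a list set" where "perms \<equiv> permutations_of_set"

definition subsets_of_card :: "'a set \<Rightarrow> nat \<Rightarrow> 'a set set" where
  "subsets_of_card A h = {T. T \<subseteq> A \<and> card T = h}"

lemma finite_subsets_of_card: "finite A \<Longrightarrow> finite (subsets_of_card A h)"
  by (simp add: subsets_of_card_def)

lemma card_subsets_of_card: "finite A \<Longrightarrow> card (subsets_of_card A h) = card A choose h"
  by (simp add: subsets_of_card_def n_subsets)

lemma subsets_of_card_nonempty: "finite A \<Longrightarrow> h \<le> card A \<Longrightarrow> subsets_of_card A h \<noteq> {}"
  unfolding subsets_of_card_def using obtain_subset_with_card_n[of h A] by blast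

lemma length_perms: "xs \<in> perms A \<Longrightarrow> length xs = card A"
  by (auto simp: permutations_of_set_def distinct_card)

lemma avg_perms_Cons:
  assumes "finite A" "A \<noteq> {}"
  shows "avg (perms A) f = avg A (\<lambda>x. avg (perms (A - {x})) (\<lambda>xs. f (x # xs)))"
proof -
  have "bij_betw (\<lambda>(x, xs). x # xs) (SIGMA x:A. perms (A - {x})) (perms A)"
    unfolding permutations_of_set_nonempty[OF assms(2)] by (auto simp: bij_betw_def inj_on_def)
  then have "avg (perms A) f = avg (SIGMA x:A. perms (A - {x})) (\<lambda>p. f (case p of (x, xs) \<Rightarrow> x # xs))"
    by (subst avg_reindex) auto
  also have "\<dots> = avg A (\<lambda>x. avg (perms (A - {x})) (\<lambda>xs. f (x # xs)))"
    using assms by (subst avg_Sigma[where c = "fact (card A - 1)"]) auto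
  finally show ?thesis .
qed

text \<open>Given the set \<open>T\<close> of the first \<open>J\<close> positions, their order and
  the order of the rest are independent and uniform. This is the Markov property at a fixed time and
  also the independence of past and future used at half filling.\<close>

lemma avg_perms_split:
  assumes A: "finite A" and J: "J \<le> card A"
  shows "avg (perms A) f = avg (subsets_of_card A J)
           (\<lambda>T. avg (perms T) (\<lambda>ys. avg (perms (A - T)) (\<lambda>zs. f (ys @ zs))))"
proof -
  let ?S = "SIGMA T:subsets_of_card A J. perms T \<times> perms (A - T)"
  let ?h = "\<lambda>(T, ys, zs). ys @ zs"
  have fin: "finite T" if "T \<in> subsets_of_card A J" for T
    using that A finite_subset by (auto simp: subsets_of_card_def)
  have "bij_betw ?h ?S (perms A)"
  proof (rule bij_betw_byWitness[where f' = "\<lambda>xs. (set (take J xs), take J xs, drop J xs)"])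
    show "\<forall>p\<in>?S. (\<lambda>xs. (set (take J xs), take J xs, drop J xs)) (?h p) = p"
      using fin length_perms by (fastforce simp: subsets_of_card_def permutations_of_set_def)
    show "\<forall>xs\<in>perms A. ?h (set (take J xs), take J xs, drop J xs) = xs" by auto
    show "?h ` ?S \<subseteq> perms A"
      using A by (auto simp: subsets_of_card_def permutations_of_set_def)
    show "(\<lambda>xs. (set (take J xs), take J xs, drop J xs)) ` perms A \<subseteq> ?S"
    proof clarsimp
      fix xs assume xs: "xs \<in> perms A"
      then have d: "set xs = A" "distinct xs" by (auto simp: permutations_of_set_def)
      have "set (take J xs) \<union> set (drop J xs) = A"
        using d by (metis append_take_drop_id set_append)
      moreover have "set (take J xs) \<inter> set (drop J xs) = {}"
        using d(2) by (metis append_take_drop_id distinct_append)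
      ultimately have "set (drop J xs) = A - set (take J xs)" by auto
      then show "set (take J xs) \<in> subsets_of_card A J \<and> take J xs \<in> perms (set (take J xs))
          \<and> drop J xs \<in> perms (A - set (take J xs))"
        using d J length_perms[OF xs] set_take_subset[of J xs] distinct_card[of "take J xs"]
        by (simp add: subsets_of_card_def permutations_of_set_def)
    qed
  qed
  then have "avg (perms A) f = avg ?S (\<lambda>p. f (?h p))" by (subst avg_reindex) auto
  also have "\<dots> = avg (subsets_of_card A J) (\<lambda>T. avg (perms T \<times> perms (A - T)) (\<lambda>(ys, zs). f (ys @ zs)))"
  proof (subst avg_Sigma[where c = "fact J * fact (card A - J)"])
    show "finite (subsets_of_card A J)" using A by (rule finite_subsets_of_card)
    fix T assume T: "T \<in> subsets_of_card A J"
    then have "card (A - T) = card A - J" "card T = J"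
      using fin[OF T] by (auto simp: subsets_of_card_def card_Diff_subset)
    then show "card (perms T \<times> perms (A - T)) = fact J * fact (card A - J)"
      using fin[OF T] A by (simp add: card_cartesian_product)
  qed (simp_all add: case_prod_unfold)
  also have "\<dots> = avg (subsets_of_card A J) (\<lambda>T. avg (perms T) (\<lambda>ys. avg (perms (A - T)) (\<lambda>zs. f (ys @ zs))))"
  proof (rule avg_cong)
    fix T assume T: "T \<in> subsets_of_card A J"
    show "avg (perms T \<times> perms (A - T)) (\<lambda>(ys, zs). f (ys @ zs)) = avg (perms T) (\<lambda>ys. avg (perms (A - T)) (\<lambda>zs. f (ys @ zs)))"
      by (subst avg_Sigma[where c = "fact (card (A - T))"]) (use A in auto)
  qed simp
  finally show ?thesis .
qed

lemma avg_perms_take: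
  assumes "finite B" "h \<le> card B"
  shows "avg (perms B) (\<lambda>xs. g (set (take h xs))) = avg (subsets_of_card B h) g"
  unfolding avg_perms_split[OF assms]
proof (rule avg_cong)
  fix T assume "T \<in> subsets_of_card B h"
  then have T: "T \<subseteq> B" "card T = h" "finite T" using assms finite_subset by (auto simp: subsets_of_card_def)
  have "avg (perms T) (\<lambda>ys. avg (perms (B - T)) (\<lambda>zs. g (set (take h (ys @ zs))))) = avg (perms T) (\<lambda>ys. g T)"
  proof (rule avg_cong)
    fix ys assume ys: "ys \<in> perms T"
    have "length ys = h" "set ys = T" using length_perms[OF ys] T ys by (auto simp: permutations_of_set_def)
    then show "avg (perms (B - T)) (\<lambda>zs. g (set (take h (ys @ zs)))) = g T" using assms by (simp add: avg_const)
  qed simp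
  also have "\<dots> = g T" using T by (simp add: avg_const)
  finally show "avg (perms T) (\<lambda>ys. avg (perms (B - T)) (\<lambda>zs. g (set (take h (ys @ zs))))) = g T" .
qed simp

text \<open>A restart at time \<open>m\<close>: a bound valid from every set of size
  \<open>m\<close> survives averaging over the set actually reached.\<close>

lemma avg_perms_take_drop_le:
  fixes g :: "'a set \<Rightarrow> 'a list \<Rightarrow> real"
  assumes A: "finite A" "m \<le> card A"
    and le: "\<And>T. T \<subseteq> A \<Longrightarrow> card T = m \<Longrightarrow> avg (perms (A - T)) (g T) \<le> c"
  shows "avg (perms A) (\<lambda>xs. g (set (take m xs)) (drop m xs)) \<le> c"
  unfolding avg_perms_split[OF A]
proof (rule avg_le_const)
  show "finite (subsets_of_card A m)" "subsets_of_card A m \<noteq> {}"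
    using A by (auto simp: finite_subsets_of_card subsets_of_card_nonempty)
  fix T assume T: "T \<in> subsets_of_card A m"
  then have T': "T \<subseteq> A" "card T = m" "finite T" using A finite_subset by (auto simp: subsets_of_card_def)
  show "avg (perms T) (\<lambda>ys. avg (perms (A - T)) (\<lambda>zs. g (set (take m (ys @ zs))) (drop m (ys @ zs)))) \<le> c"
  proof (rule avg_le_const)
    fix ys assume ys: "ys \<in> perms T"
    have "length ys = m" "set ys = T" using length_perms[OF ys] T' ys by (auto simp: permutations_of_set_def)
    then show "avg (perms (A - T)) (\<lambda>zs. g (set (take m (ys @ zs))) (drop m (ys @ zs))) \<le> c"
      using le[OF T'(1,2)] by simp
  qed (use T' in auto)
qed

lemma avg_perms_rev: "avg (perms A) (\<lambda>xs. f (rev xs)) = avg (perms A) f"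
  by (rule avg_reindex[of rev "perms A"], rule bij_betw_byWitness[where f' = rev])
     (auto simp: permutations_of_set_def)

lemma avg_subsets_of_card_compl:
  assumes "finite A" "h \<le> card A"
  shows "avg (subsets_of_card A h) (\<lambda>S. f (A - S)) = avg (subsets_of_card A (card A - h)) f"
  by (rule avg_reindex[where h = "\<lambda>S. A - S"], rule bij_betw_byWitness[where f' = "\<lambda>S. A - S"])
     (use assms in \<open>auto simp: subsets_of_card_def card_Diff_subset finite_subset\<close>)

text \<open>Ville's inequality for the nonnegative supermartingale \<open>\<Psi>\<close>, by
  induction on the number of free positions. If \<open>\<Psi> S\<close> is already at least 1, the
  bound is trivial; otherwise a crossing can only happen after the first insertion, and the
  supermartingale property closes the step.\<close>

lemma ville_random_filling:
  fixes \<Psi> :: "'a set \<Rightarrow> real"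
  assumes A: "finite A"
    and nonneg: "\<And>S. S \<subseteq> A \<Longrightarrow> 0 \<le> \<Psi> S"
    and super: "\<And>S. S \<subset> A \<Longrightarrow> S0 \<subseteq> S \<Longrightarrow> avg (A - S) (\<lambda>x. \<Psi> (insert x S)) \<le> \<Psi> S"
    and S0: "S0 \<subseteq> A"
  shows "avg (perms (A - S0)) (\<lambda>xs. of_bool (\<exists>i\<le>length xs. 1 \<le> \<Psi> (S0 \<union> set (take i xs)))) \<le> \<Psi> S0"
proof -
  have "avg (perms (A - S)) (\<lambda>xs. of_bool (\<exists>i\<le>length xs. 1 \<le> \<Psi> (S \<union> set (take i xs)))) \<le> \<Psi> S"
    if "S0 \<subseteq> S" "S \<subseteq> A" for S
    using that
  proof (induction "card (A - S)" arbitrary: S rule: less_induct)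
    case less
    have fin: "finite (A - S)" using A by auto
    show ?case
    proof (cases "1 \<le> \<Psi> S")
      case True
      have "avg (perms (A - S)) (\<lambda>xs. of_bool (\<exists>i\<le>length xs. 1 \<le> \<Psi> (S \<union> set (take i xs)))) \<le> (1::real)"
        by (rule avg_le_const) (use fin in auto)
      then show ?thesis using True by linarith
    next
      case False
      show ?thesis
      proof (cases "S = A")
        case True
        then show ?thesis using False nonneg[of A] by (simp add: avg_def)
      next
        case neq: False
        have ne: "A - S \<noteq> {}" using neq less.prems by auto
        have "avg (perms (A - S)) (\<lambda>xs. of_bool (\<exists>i\<le>length xs. 1 \<le> \<Psi> (S \<union> set (take i xs))))
          = avg (A - S) (\<lambda>x. avg (perms (A - S - {x})) (\<lambda>xs. of_bool (\<exists>i\<le>length (x # xs). 1 \<le> \<Psi> (S \<union> set (take i (x # xs))))))"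
          by (rule avg_perms_Cons[OF fin ne])
        also have "\<dots> \<le> avg (A - S) (\<lambda>x. \<Psi> (insert x S))"
        proof (rule avg_mono)
          fix x assume x: "x \<in> A - S"
          have eq: "(\<exists>i\<le>length (x # xs). 1 \<le> \<Psi> (S \<union> set (take i (x # xs))))
               \<longleftrightarrow> (\<exists>i\<le>length xs. 1 \<le> \<Psi> (insert x S \<union> set (take i xs)))" for xs
          proof
            assume "\<exists>i\<le>length (x # xs). 1 \<le> \<Psi> (S \<union> set (take i (x # xs)))"
            then obtain i where i: "i \<le> length (x # xs)" "1 \<le> \<Psi> (S \<union> set (take i (x # xs)))" by blast
            then obtain j where "i = Suc j" using False by (cases i) auto
            with i show "\<exists>i\<le>length xs. 1 \<le> \<Psi> (insert x S \<union> set (take i xs))" by auto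
          next
            assume "\<exists>i\<le>length xs. 1 \<le> \<Psi> (insert x S \<union> set (take i xs))"
            then obtain i where "i \<le> length xs" "1 \<le> \<Psi> (insert x S \<union> set (take i xs))" by blast
            then show "\<exists>i\<le>length (x # xs). 1 \<le> \<Psi> (S \<union> set (take i (x # xs)))"
              by (intro exI[of _ "Suc i"]) auto
          qed
          have e2: "A - S - {x} = A - insert x S" by auto
          have "card (A - insert x S) < card (A - S)"
            using x fin by (intro psubset_card_mono) auto
          from less.hyps[OF this] less.prems x
          show "avg (perms (A - S - {x})) (\<lambda>xs. of_bool (\<exists>i\<le>length (x # xs). 1 \<le> \<Psi> (S \<union> set (take i (x # xs))))) \<le> \<Psi> (insert x S)"
            unfolding eq e2 by auto
        qed
        also have "\<dots> \<le> \<Psi> S" using super[of S] neq less.prems by blast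
        finally show ?thesis .
      qed
    qed
  qed
  then show ?thesis using S0 by blast
qed

subsection \<open>Cyclic runs of a randomly filled set\<close>

text \<open>Hoeffding's lemma for an interval of length 2, where
  \<open>(1 - (-1))^2 / 8 = 1 / 2\<close>. Negative \<open>l\<close> follow by applying the positive
  case to \<open>- f\<close>.\<close>

lemma avg_exp_Hoeffding:
  fixes f :: "'a \<Rightarrow> real"
  assumes X: "finite X" "X \<noteq> {}" and f: "\<And>x. x \<in> X \<Longrightarrow> \<bar>f x\<bar> \<le> 1"
  shows "avg X (\<lambda>x. exp (l * (f x - avg X f))) \<le> exp (l\<^sup>2 / 2)"
proof -
  have pos: "avg X (\<lambda>x. exp (l * (f x - avg X f))) \<le> exp (l\<^sup>2 / 2)"
    if f: "\<And>x. x \<in> X \<Longrightarrow> \<bar>f x\<bar> \<le> 1" and l: "0 < l" for l and f :: "'a \<Rightarrow> real"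
  proof -
    interpret interval_bounded_random_variable "measure_pmf (pmf_of_set X)" f "-1" 1
      by unfold_locales (use f X in \<open>auto simp: AE_measure_pmf_iff abs_le_iff\<close>)
    have E: "measure_pmf.expectation (pmf_of_set X) g = avg X g" for g :: "'a \<Rightarrow> real"
      by (rule integral_pmf_of_set_avg[OF X])
    have "nn_integral (measure_pmf (pmf_of_set X)) (\<lambda>x. exp (l * (f x - avg X f)))
        = ennreal (avg X (\<lambda>x. exp (l * (f x - avg X f))))"
      by (subst nn_integral_eq_integral) (use X in \<open>auto simp: E integrable_measure_pmf_finite\<close>)
    then have "ennreal (avg X (\<lambda>x. exp (l * (f x - avg X f)))) \<le> ennreal (exp (l\<^sup>2 * (1 - (-1))\<^sup>2 / 8))"
      using Hoeffdings_lemma_nn_integral[OF l] unfolding E by simp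
    then show ?thesis by (simp add: field_simps)
  qed
  consider "l = 0" | "l > 0" | "l < 0" by linarith
  then show ?thesis
  proof cases
    case 1
    then show ?thesis using X by (simp add: avg_const)
  next
    case 2
    then show ?thesis using pos[of f l] f by blast
  next
    case 3
    have "avg X (\<lambda>x. - f x) = - avg X f" using avg_mult_left[of X "-1" f] by simp
    then show ?thesis using pos[of "\<lambda>x. - f x" "- l"] f 3 by (simp add: algebra_simps)
  qed
qed

text \<open>Averaging the two exponentials separately gives the factor \<open>exp (l^2 / 2)\<close>.
  Since \<open>cosh\<close> is even and increasing in the absolute value, the contraction
  \<open>\<rho>\<close> can then be dropped for \<open>z\<close> of either sign, which a single
  exponential would not allow.\<close>

lemma avg_cosh_Hoeffding:
  fixes f :: "'a \<Rightarrow> real"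
  assumes X: "finite X" "X \<noteq> {}" and f: "\<And>x. x \<in> X \<Longrightarrow> \<bar>f x\<bar> \<le> 1" and \<rho>: "\<bar>\<rho>\<bar> \<le> 1"
  shows "avg X (\<lambda>x. cosh (l * (\<rho> * z + (f x - avg X f)))) \<le> cosh (l * z) * exp (l\<^sup>2 / 2)"
proof -
  have cosh_eq: "cosh (l * (\<rho> * z + y)) = exp (l * \<rho> * z) / 2 * exp (l * y) + exp (- (l * \<rho> * z)) / 2 * exp ((- l) * y)" for y
    by (simp add: cosh_field_def exp_add[symmetric] algebra_simps)
  have "avg X (\<lambda>x. cosh (l * (\<rho> * z + (f x - avg X f))))
      = exp (l * \<rho> * z) / 2 * avg X (\<lambda>x. exp (l * (f x - avg X f)))
        + exp (- (l * \<rho> * z)) / 2 * avg X (\<lambda>x. exp ((- l) * (f x - avg X f)))"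
    unfolding cosh_eq avg_add avg_mult_left ..
  also have "\<dots> \<le> exp (l * \<rho> * z) / 2 * exp (l\<^sup>2 / 2) + exp (- (l * \<rho> * z)) / 2 * exp ((- l)\<^sup>2 / 2)"
    by (intro add_mono mult_left_mono avg_exp_Hoeffding X f) auto
  also have "\<dots> = cosh (l * \<rho> * z) * exp (l\<^sup>2 / 2)"
    by (simp add: cosh_field_def field_simps)
  also have "cosh (l * \<rho> * z) \<le> cosh (l * z)"
  proof -
    have "\<bar>l * \<rho> * z\<bar> \<le> \<bar>l * z\<bar>"
      using mult_right_mono[OF \<rho>, of "\<bar>l * z\<bar>"] by (simp add: abs_mult mult_ac)
    then have "cosh \<bar>l * \<rho> * z\<bar> \<le> cosh \<bar>l * z\<bar>" by (subst cosh_real_nonneg_le_iff) auto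
    then show ?thesis by simp
  qed
  finally show ?thesis by (simp add: mult_right_mono)
qed

text \<open>Only three consecutive positions are asked to be distinct, so \<open>s\<close> may be
  any permutation of \<open>A\<close> all of whose cycles have length at least 3. The two neighbours
  of a position are then distinct, which is what the local counting rests on.\<close>

locale cyclic_shift =
  fixes A :: "'a set" and s :: "'a \<Rightarrow> 'a"
  assumes finite_A: "finite A" and bij: "bij_betw s A A"
    and s_neq: "\<And>x. x \<in> A \<Longrightarrow> s x \<noteq> x" and ss_neq: "\<And>x. x \<in> A \<Longrightarrow> s (s x) \<noteq> x"
begin

text \<open>A run is counted at the free position in front of it. The full set therefore has 0
  cyclic runs, like the empty one, which makes the count invariant under complementation.\<close>

definition runs :: "'a set \<Rightarrow> real" where
  "runs S = (\<Sum>k\<in>A. of_bool (k \<notin> S \<and> s k \<in> S))"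

text \<open>Isolated free positions: filling one merges two runs. They enter the conditional variance of
  the increments of \<open>runs\<close>.\<close>
definition pits :: "'a set \<Rightarrow> real" where
  "pits S = (\<Sum>k\<in>A. of_bool (k \<in> S \<and> s k \<notin> S \<and> s (s k) \<in> S))"

text \<open>Mean number of cyclic runs of a uniform \<open>m\<close>-subset, see
  \<open>avg_runs\<close>. The argument is real so that it can be treated as a parabola in
  \<open>m\<close>.\<close>

definition run_mean :: "real \<Rightarrow> real" where
  "run_mean m = m * (real (card A) - m) / (real (card A) - 1)"

definition dev :: "'a set \<Rightarrow> real" where
  "dev S = runs S - run_mean (card S)"

text \<open>The weight that turns \<open>dev\<close> into the martingale \<open>dev / bw\<close>.\<close>
definition bw :: "'a set \<Rightarrow> real" where
  "bw S = real (card (A - S)) * (real (card (A - S)) - 1)"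

lemma s_in: "k \<in> A \<Longrightarrow> s k \<in> A"
  using bij by (auto simp: bij_betw_def)

lemma s_inj: "k \<in> A \<Longrightarrow> l \<in> A \<Longrightarrow> s k = s l \<longleftrightarrow> k = l"
  using bij by (auto simp: bij_betw_def inj_on_def)

lemma sum_shift: "(\<Sum>k\<in>A. f (s k)) = (\<Sum>k\<in>A. f k)"
  by (rule sum.reindex_bij_betw[OF bij])

lemma obtain_pred: assumes "x \<in> A" obtains p where "p \<in> A" "s p = x"
  using assms bij by (metis bij_betw_imp_surj_on imageE)

text \<open>Going round the cycle, exits from \<open>S\<close> balance entries: the difference is
  the sum of the indicator of \<open>S\<close> at \<open>k\<close> minus that at \<open>s k\<close>,
  which is 0 because \<open>s\<close> permutes \<open>A\<close>.\<close>

lemma runs_rev: "(\<Sum>k\<in>A. of_bool (k \<in> S \<and> s k \<notin> S)) = runs S"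
proof -
  have "(\<Sum>k\<in>A. of_bool (k \<in> S \<and> s k \<notin> S)) - runs S = (\<Sum>k\<in>A. of_bool (k \<in> S) - of_bool (s k \<in> S) :: real)"
    unfolding runs_def sum_subtractf[symmetric] by (rule sum.cong) auto
  also have "\<dots> = 0" using sum_shift[of "\<lambda>k. of_bool (k \<in> S) :: real"] by (simp add: sum_subtractf)
  finally show ?thesis by simp
qed

lemma runs_compl: "S \<subseteq> A \<Longrightarrow> runs (A - S) = runs S"
  unfolding runs_rev[of S, symmetric] unfolding runs_def[of "A - S"] by (rule sum.cong) (auto dest: s_in)

lemma runs_nonneg: "0 \<le> runs S"
  unfolding runs_def by (rule sum_nonneg) auto

text \<open>A filled position opens a new run unless it extends the run on its left or on its right;
  if it does both, two runs merge and the count drops.\<close>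

lemma runs_insert:
  assumes p: "p \<in> A" and x: "s p \<notin> S"
  shows "runs (insert (s p) S) = runs S + 1 - of_bool (p \<in> S) - of_bool (s (s p) \<in> S)"
proof -
  have "runs (insert (s p) S) - runs S = (\<Sum>k\<in>A. (if k = p then 1 - of_bool (p \<in> S) else 0)
     - (if k = s p then of_bool (s (s p) \<in> S) else 0))"
    unfolding runs_def sum_subtractf[symmetric]
    by (rule sum.cong) (use p x s_neq s_inj s_in in \<open>auto split: if_splits\<close>)
  also have "\<dots> = 1 - of_bool (p \<in> S) - of_bool (s (s p) \<in> S)"
    using finite_A p s_in[OF p] by (simp add: sum_subtractf)
  finally show ?thesis by simp
qed

lemma abs_gain_le:
  assumes "x \<in> A - S" shows "\<bar>runs (insert x S) - runs S\<bar> \<le> 1"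
proof -
  obtain p where "p \<in> A" "s p = x" using obtain_pred assms by blast
  then show ?thesis using runs_insert[of p S] assms by auto
qed

text \<open>Free positions are written as \<open>s k\<close>, so that the left neighbour
  \<open>k\<close> is available to \<open>runs_insert\<close> without an inverse of
  \<open>s\<close>.\<close>

lemma sum_compl_shift:
  fixes g :: "'a \<Rightarrow> 'b::real_algebra_1"
  assumes "S \<subseteq> A" shows "(\<Sum>x\<in>A - S. g x) = (\<Sum>k\<in>A. of_bool (s k \<notin> S) * g (s k))"
proof -
  have "(\<Sum>x\<in>A - S. g x) = (\<Sum>k\<in>A. of_bool (k \<notin> S) * g k)"
    using finite_A by (intro sum.mono_neutral_cong_left) auto
  then show ?thesis by (simp add: sum_shift[of "\<lambda>k. of_bool (k \<notin> S) * g k"])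
qed

lemma sum_notin: "S \<subseteq> A \<Longrightarrow> (\<Sum>k\<in>A. of_bool (s k \<notin> S) :: real) = card (A - S)"
  using sum_compl_shift[of S "\<lambda>_. 1::real"] by simp

text \<open>Every run has exactly one free position before it and one after it, so each of the two
  neighbour terms of \<open>runs_insert\<close> sums to \<open>runs S\<close>.\<close>

lemma sum_gain:
  assumes S: "S \<subseteq> A"
  shows "(\<Sum>x\<in>A - S. runs (insert x S) - runs S) = real (card (A - S)) - 2 * runs S"
proof -
  have "(\<Sum>x\<in>A - S. runs (insert x S) - runs S)
     = (\<Sum>k\<in>A. of_bool (s k \<notin> S) - of_bool (k \<in> S \<and> s k \<notin> S) - of_bool (s k \<notin> S \<and> s (s k) \<in> S))"
    unfolding sum_compl_shift[OF S]
  proof (rule sum.cong)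
    fix k assume "k \<in> A"
    then show "of_bool (s k \<notin> S) * (runs (insert (s k) S) - runs S) = of_bool (s k \<notin> S) - of_bool (k \<in> S \<and> s k \<notin> S) - of_bool (s k \<notin> S \<and> s (s k) \<in> S)"
      by (cases "s k \<in> S") (auto simp: runs_insert)
  qed simp
  also have "\<dots> = real (card (A - S)) - runs S - (\<Sum>k\<in>A. of_bool (s k \<notin> S \<and> s (s k) \<in> S))"
    using S by (simp add: sum_subtractf sum_notin runs_rev)
  also have "(\<Sum>k\<in>A. of_bool (s k \<notin> S \<and> s (s k) \<in> S)) = runs S"
    unfolding runs_def by (rule sum_shift)
  finally show ?thesis by simp
qed

text \<open>For indicators \<open>a\<close> and \<open>b\<close> the square of
  \<open>1 - a - b\<close> is \<open>1 - a - b + 2 a b\<close>; the product marks a free position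
  between two occupied ones, hence \<open>pits\<close>.\<close>

lemma sum_gain_sq:
  assumes S: "S \<subseteq> A"
  shows "(\<Sum>x\<in>A - S. (runs (insert x S) - runs S)\<^sup>2) = real (card (A - S)) - 2 * runs S + 2 * pits S"
proof -
  have "(\<Sum>x\<in>A - S. (runs (insert x S) - runs S)\<^sup>2)
     = (\<Sum>k\<in>A. of_bool (s k \<notin> S) - of_bool (k \<in> S \<and> s k \<notin> S) - of_bool (s k \<notin> S \<and> s (s k) \<in> S)
         + 2 * of_bool (k \<in> S \<and> s k \<notin> S \<and> s (s k) \<in> S))"
    unfolding sum_compl_shift[OF S]
  proof (rule sum.cong)
    fix k assume "k \<in> A"
    then show "of_bool (s k \<notin> S) * (runs (insert (s k) S) - runs S)\<^sup>2 = of_bool (s k \<notin> S) - of_bool (k \<in> S \<and> s k \<notin> S) - of_bool (s k \<notin> S \<and> s (s k) \<in> S) + 2 * of_bool (k \<in> S \<and> s k \<notin> S \<and> s (s k) \<in> S)"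
      by (cases "s k \<in> S") (auto simp: runs_insert)
  qed simp
  also have "\<dots> = real (card (A - S)) - runs S - (\<Sum>k\<in>A. of_bool (s k \<notin> S \<and> s (s k) \<in> S)) + 2 * pits S"
    using S by (simp add: sum_subtractf sum.distrib sum_notin runs_rev pits_def sum_distrib_left)
  also have "(\<Sum>k\<in>A. of_bool (s k \<notin> S \<and> s (s k) \<in> S)) = runs S"
    unfolding runs_def by (rule sum_shift)
  finally show ?thesis by simp
qed

lemma runs_le_card: "runs S \<le> card A"
  unfolding runs_def using sum_mono[of A "\<lambda>k. of_bool (k \<notin> S \<and> s k \<in> S)" "\<lambda>_. 1::real"] by simp

text \<open>The new position can be the left, the middle or the right element of at most one pattern
  each.\<close>

lemma abs_pits_insert_le: "\<bar>pits (insert x S) - pits S\<bar> \<le> 3"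
proof -
  have one: "(\<Sum>k\<in>A. of_bool (k = x) :: real) \<le> 1"
    using finite_A by (simp add: of_bool_def)
  have eq: "(\<Sum>k\<in>A. of_bool (s k = x) :: real) = (\<Sum>k\<in>A. of_bool (k = x))"
    by (rule sum_shift)
  have eq2: "(\<Sum>k\<in>A. of_bool (s (s k) = x) :: real) = (\<Sum>k\<in>A. of_bool (s k = x))"
    by (rule sum_shift)
  have "\<bar>pits (insert x S) - pits S\<bar> \<le> (\<Sum>k\<in>A. of_bool (k = x) + of_bool (s k = x) + of_bool (s (s k) = x))"
    unfolding pits_def sum_subtractf[symmetric]
    by (rule order_trans[OF sum_abs], rule sum_mono) auto
  also have "\<dots> \<le> 3" using one eq eq2 by (simp add: sum.distrib)
  finally show ?thesis .
qed

lemma card_A_ge: "A \<noteq> {} \<Longrightarrow> 3 \<le> card A"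
proof -
  assume "A \<noteq> {}"
  then obtain x where x: "x \<in> A" by blast
  then have "card {x, s x, s (s x)} \<le> card A"
    by (intro card_mono) (auto simp: finite_A s_in)
  moreover have "card {x, s x, s (s x)} = 3"
    using s_neq[OF x] ss_neq[OF x] s_neq[OF s_in[OF x]] by (auto simp: card_insert_if)
  ultimately show ?thesis by simp
qed

lemma avg_gain:
  assumes S: "S \<subset> A"
  shows "avg (A - S) (\<lambda>x. runs (insert x S) - runs S) = 1 - 2 * runs S / card (A - S)"
proof -
  have "card (A - S) > 0" using S finite_A by (simp add: card_gt_0_iff)
  then show ?thesis
    using sum_gain[of S] S by (simp add: avg_def field_simps)
qed

lemma card_Diff_A: "S \<subseteq> A \<Longrightarrow> real (card (A - S)) = real (card A) - real (card S)"
  using finite_A by (simp add: card_Diff_subset card_mono finite_subset of_nat_diff)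

lemma card_insert_S: "S \<subseteq> A \<Longrightarrow> x \<in> A - S \<Longrightarrow> card (insert x S) = Suc (card S)"
  using finite_A finite_subset by (subst card_insert_disjoint) auto

text \<open>\<open>run_mean\<close> satisfies the recurrence
  \<open>\<mu> (m + 1) = (1 - 2 / N) \<mu> m + 1\<close> with \<open>N = n - m\<close>, which is
  also the recurrence of the conditional mean of \<open>runs\<close>. Their difference therefore
  contracts by \<open>1 - 2 / N\<close>, up to the centred gain.\<close>

lemma dev_insert:
  assumes S: "S \<subset> A" and x: "x \<in> A - S"
  shows "dev (insert x S) = (1 - 2 / card (A - S)) * dev S
           + ((runs (insert x S) - runs S) - avg (A - S) (\<lambda>x. runs (insert x S) - runs S))"
proof -
  define n m where "n = real (card A)" and "m = real (card S)"
  have N: "real (card (A - S)) = n - m" using S card_Diff_A by (auto simp: n_def m_def)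
  have "card (A - S) > 0" using S finite_A by (simp add: card_gt_0_iff)
  then have pos: "n - m > 0" using N by linarith
  have n1: "n - 1 > 0" using card_A_ge S by (fastforce simp: n_def)
  have c: "real (card (insert x S)) = m + 1" using card_insert_S S x by (auto simp: m_def)
  have "(1 - 2 / d) * d = d - 2" if "d > 0" for d :: real using that by (simp add: left_diff_distrib)
  from this[OF pos] have "(1 - 2 / (n - m)) * (n - m) = n - m - 2" .
  then have "(1 - 2 / (n - m)) * (m * (n - m) / (n - 1)) = m * (n - m - 2) / (n - 1)"
    by (metis mult.assoc mult.commute times_divide_eq_right)
  then have "(1 - 2 / (n - m)) * (m * (n - m) / (n - 1)) + 1 = (m * (n - m - 2) + (n - 1)) / (n - 1)"
    using n1 by (simp add: add_divide_distrib)
  moreover have "m * (n - m - 2) + (n - 1) = (m + 1) * (n - (m + 1))" by (simp add: algebra_simps)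
  ultimately have "(m + 1) * (n - (m + 1)) / (n - 1) = (1 - 2 / (n - m)) * (m * (n - m) / (n - 1)) + 1"
    by simp
  then have "run_mean (m + 1) = (1 - 2 / (n - m)) * run_mean m + 1"
    unfolding run_mean_def n_def .
  moreover have "2 * runs S / (n - m) = (2 / (n - m)) * runs S" by simp
  ultimately show ?thesis
    unfolding dev_def avg_gain[OF S] N c m_def[symmetric] by (simp add: algebra_simps)
qed

lemma bw_insert:
  assumes S: "S \<subset> A" and x: "x \<in> A - S"
  shows "bw (insert x S) = (1 - 2 / card (A - S)) * bw S"
proof -
  define N where "N = real (card (A - S))"
  have "card (A - S) > 0" using S finite_A by (simp add: card_gt_0_iff)
  then have pos: "N > 0" unfolding N_def by linarith
  have "insert x S \<subseteq> A" using S x by auto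
  then have c: "real (card (A - insert x S)) = N - 1"
    using card_Diff_A[of "insert x S"] card_Diff_A[of S] S x card_insert_S[of S x] by (auto simp: N_def)
  show ?thesis unfolding bw_def c N_def[symmetric] using pos by (simp add: field_simps)
qed

text \<open>The process \<open>dev - q * bw\<close> is contracted towards \<open>0\<close> by each step, up to a centred increment;
  hence \<open>cosh\<close> of it grows at most by the Hoeffding factor.\<close>
lemma linear_boundary:
  assumes S0: "S0 \<subseteq> A" and q: "dev S0 = q * bw S0" and \<beta>: "0 \<le> \<beta>"
  shows "avg (perms (A - S0)) (\<lambda>xs. of_bool (\<exists>i\<le>length xs.
           a + \<beta> * i \<le> \<bar>dev (S0 \<union> set (take i xs)) - q * bw (S0 \<union> set (take i xs))\<bar>))
         \<le> 2 * exp (- (2 * a * \<beta>))"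
proof -
  \<comment> \<open>The Hoeffding factor \<open>exp (l^2 / 2)\<close> of each step has to be paid by
    the rising line, which contributes \<open>exp (- l \<beta>)\<close>; both balance at
    \<open>l = 2 \<beta>\<close>.\<close>
  define l where "l = 2 * \<beta>"
  define Z where "Z S = dev S - q * bw S" for S
  \<comment> \<open>The factor 2 is there for \<open>exp \<bar>u\<bar> \<le> 2 cosh u\<close>, so
    that a crossing of either sign forces \<open>\<Psi>\<close> up to 1. At \<open>S0\<close> the
    process \<open>Z\<close> is 0, which leaves \<open>2 exp (- l a)\<close>.\<close>
  define \<Psi> where "\<Psi> S = 2 * cosh (l * Z S) * exp (- l * (a + \<beta> * (real (card S) - real (card S0))))" for S
  have "avg (perms (A - S0)) (\<lambda>xs. of_bool (\<exists>i\<le>length xs. 1 \<le> \<Psi> (S0 \<union> set (take i xs)))) \<le> \<Psi> S0"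
  proof (rule ville_random_filling[OF finite_A _ _ S0])
    show "0 \<le> \<Psi> S" for S unfolding \<Psi>_def by (simp add: cosh_real_nonneg)
    fix S assume S: "S \<subset> A"
    define N where "N = real (card (A - S))"
    have ne: "A - S \<noteq> {}" "finite (A - S)" using S finite_A by auto
    have "card (A - S) > 0" using S finite_A by (simp add: card_gt_0_iff)
    then have N: "N \<ge> 1" unfolding N_def by linarith
    define f where "f x = runs (insert x S) - runs S" for x
    have Zi: "Z (insert x S) = (1 - 2 / N) * Z S + (f x - avg (A - S) f)" if "x \<in> A - S" for x
      unfolding Z_def dev_insert[OF S that] bw_insert[OF S that] N_def[symmetric] f_def by (simp add: algebra_simps)
    have "avg (A - S) (\<lambda>x. \<Psi> (insert x S)) = avg (A - S) (\<lambda>x. cosh (l * ((1 - 2 / N) * Z S + (f x - avg (A - S) f)))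
        * (2 * exp (- l * (a + \<beta> * (real (card S) + 1 - real (card S0))))))"
      by (rule avg_cong) (use S in \<open>auto simp: \<Psi>_def Zi card_insert_S\<close>)
    also have "\<dots> = avg (A - S) (\<lambda>x. cosh (l * ((1 - 2 / N) * Z S + (f x - avg (A - S) f))))
        * (2 * exp (- l * (a + \<beta> * (real (card S) + 1 - real (card S0)))))"
      by (rule avg_mult_right)
    also have "\<dots> \<le> (cosh (l * Z S) * exp (l\<^sup>2 / 2)) * (2 * exp (- l * (a + \<beta> * (real (card S) + 1 - real (card S0)))))"
    proof (intro mult_right_mono avg_cosh_Hoeffding ne)
      show "\<bar>f x\<bar> \<le> 1" if "x \<in> A - S" for x using abs_gain_le that by (auto simp: f_def)
      show "\<bar>1 - 2 / N\<bar> \<le> 1" using N by (auto simp: abs_le_iff field_simps)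
    qed auto
    also have "\<dots> = \<Psi> S"
      unfolding \<Psi>_def l_def by (simp add: exp_add[symmetric] algebra_simps power2_eq_square)
    finally show "avg (A - S) (\<lambda>x. \<Psi> (insert x S)) \<le> \<Psi> S" .
  qed
  also have "\<Psi> S0 = 2 * exp (- (2 * a * \<beta>))"
    unfolding \<Psi>_def Z_def l_def using q by simp
  finally have bound: "avg (perms (A - S0)) (\<lambda>xs. of_bool (\<exists>i\<le>length xs. 1 \<le> \<Psi> (S0 \<union> set (take i xs)))) \<le> 2 * exp (- (2 * a * \<beta>))" .
  have "avg (perms (A - S0)) (\<lambda>xs. of_bool (\<exists>i\<le>length xs.
           a + \<beta> * i \<le> \<bar>dev (S0 \<union> set (take i xs)) - q * bw (S0 \<union> set (take i xs))\<bar>))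
     \<le> avg (perms (A - S0)) (\<lambda>xs. of_bool (\<exists>i\<le>length xs. 1 \<le> \<Psi> (S0 \<union> set (take i xs))) :: real)"
  proof (rule avg_mono)
    fix xs assume xs: "xs \<in> perms (A - S0)"
    then have dx: "distinct xs" "set xs = A - S0" by (auto simp: permutations_of_set_def)
    have "1 \<le> \<Psi> (S0 \<union> set (take i xs))"
      if i: "i \<le> length xs" and Z: "a + \<beta> * i \<le> \<bar>Z (S0 \<union> set (take i xs))\<bar>" for i
    proof -
      let ?S = "S0 \<union> set (take i xs)"
      have "card ?S = card S0 + card (set (take i xs))"
        using S0 finite_A dx set_take_subset[of i xs] by (intro card_Un_disjoint) (auto intro: finite_subset)
      then have c: "real (card ?S) - real (card S0) = i"
        using dx i distinct_card[of "take i xs"] by simp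
      have "1 \<le> exp (l * \<bar>Z ?S\<bar> - l * (a + \<beta> * i))"
        using Z \<beta> by (simp add: l_def mult_left_mono)
      also have "\<dots> = exp \<bar>l * Z ?S\<bar> * exp (- l * (a + \<beta> * i))"
        using \<beta> by (simp add: exp_add[symmetric] l_def abs_mult)
      also have "\<dots> \<le> 2 * cosh (l * Z ?S) * exp (- l * (a + \<beta> * i))"
        by (intro mult_right_mono) (auto simp: cosh_field_def abs_if)
      finally show ?thesis unfolding \<Psi>_def c .
    qed
    then show "of_bool (\<exists>i\<le>length xs. a + \<beta> * i \<le> \<bar>dev (S0 \<union> set (take i xs)) - q * bw (S0 \<union> set (take i xs))\<bar>)
        \<le> (of_bool (\<exists>i\<le>length xs. 1 \<le> \<Psi> (S0 \<union> set (take i xs))) :: real)"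
      unfolding Z_def by auto
  qed
  with bound show ?thesis by linarith
qed

end

subsection \<open>Bounded Lipschitz test functions and convergence in distribution\<close>

text \<open>Both constants are fixed at 1 so that one-step averaging maps the class into itself. It
  is still rich enough for convergence in distribution, by
  \<open>cts_step_bounded_lipschitz\<close>.\<close>

definition bounded_lipschitz :: "(real \<Rightarrow> real) \<Rightarrow> bool" where
  "bounded_lipschitz F \<longleftrightarrow> (\<forall>x. \<bar>F x\<bar> \<le> 1) \<and> (\<forall>x y. \<bar>F x - F y\<bar> \<le> \<bar>x - y\<bar>)"

lemma bounded_lipschitzD:
  assumes "bounded_lipschitz F" shows "\<bar>F x\<bar> \<le> 1" "\<bar>F x - F y\<bar> \<le> \<bar>x - y\<bar>"
  using assms by (auto simp: bounded_lipschitz_def)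

lemma bounded_lipschitz_measurable:
  assumes "bounded_lipschitz F" shows "F \<in> borel_measurable borel"
proof -
  have "1-lipschitz_on UNIV F"
    using assms by (auto simp: lipschitz_on_def bounded_lipschitz_def dist_real_def)
  then show ?thesis
    by (intro borel_measurable_continuous_onI lipschitz_on_continuous_on)
qed

lemma bounded_lipschitz_diff:
  assumes "bounded_lipschitz F" shows "\<bar>F x - F y\<bar> \<le> min \<bar>x - y\<bar> 2"
  using bounded_lipschitzD(2)[OF assms, of x y] bounded_lipschitzD(1)[OF assms, of x] bounded_lipschitzD(1)[OF assms, of y] by linarith

lemma (in prob_space) integrable_bounded_lipschitz:
  assumes "bounded_lipschitz F" "X \<in> borel_measurable M"
  shows "integrable M (\<lambda>x. F (X x))"
  using bounded_lipschitz_measurable[OF assms(1)] assms(2) bounded_lipschitzD(1)[OF assms(1)]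
  by (intro integrable_const_bound[of _ 1]) (auto intro: measurable_compose)

lemma (in prob_space) bounded_lipschitz_expectation_diff:
  assumes F: "bounded_lipschitz F" and [measurable]: "X \<in> borel_measurable M" "Y \<in> borel_measurable M"
  shows "\<bar>expectation (\<lambda>x. F (X x)) - expectation (\<lambda>x. F (Y x))\<bar> \<le> expectation (\<lambda>x. min \<bar>X x - Y x\<bar> 2)"
proof -
  note int = integrable_bounded_lipschitz[OF F]
  have meas: "(\<lambda>x. F (X x) - F (Y x)) \<in> borel_measurable M"
    using bounded_lipschitz_measurable[OF F] by measurable
  have le: "\<bar>F (X x) - F (Y x)\<bar> \<le> \<bar>X x - Y x\<bar>" "\<bar>F (X x) - F (Y x)\<bar> \<le> 2" for x
    using bounded_lipschitz_diff[OF F, of "X x" "Y x"] by auto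
  have "\<bar>expectation (\<lambda>x. F (X x)) - expectation (\<lambda>x. F (Y x))\<bar> = \<bar>expectation (\<lambda>x. F (X x) - F (Y x))\<bar>"
    by (subst Bochner_Integration.integral_diff) (auto intro!: int)
  also have "\<dots> \<le> expectation (\<lambda>x. \<bar>F (X x) - F (Y x)\<bar>)"
    by (rule integral_abs_bound)
  also have "\<dots> \<le> expectation (\<lambda>x. min \<bar>X x - Y x\<bar> 2)"
    by (rule integral_mono)
       (auto intro!: integrable_const_bound[of _ 2] meas le borel_measurable_abs)
  finally show ?thesis .
qed

text \<open>Levy's theorem turns convergence of characteristic functions into weak convergence, and
  Skorohod's theorem turns that into a coupling with pointwise convergence. The mean of
  \<open>min \<bar>Yn - Y\<bar> 2\<close> bounds the error for all test functions at once, which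
  gives the uniformity in \<open>F\<close>.\<close>

lemma char_conv_imp_bounded_lipschitz_conv:
  fixes \<mu> :: "nat \<Rightarrow> real measure"
  assumes \<mu>: "\<And>n. real_distribution (\<mu> n)" and M: "real_distribution M"
    and char: "\<And>t. (\<lambda>n. char (\<mu> n) t) \<longlonglongrightarrow> char M t" and e: "0 < e"
  shows "\<forall>\<^sub>F n in sequentially. \<forall>F. bounded_lipschitz F \<longrightarrow> \<bar>(\<integral>x. F x \<partial>\<mu> n) - (\<integral>x. F x \<partial>M)\<bar> \<le> e"
proof -
  have "weak_conv_m \<mu> M" by (rule levy_continuity[OF \<mu> M char])
  from Skorohod[OF \<mu> M this] obtain \<Omega> :: "real measure" and Yn Y where
    \<Omega>: "prob_space \<Omega>" "\<forall>n. Yn n \<in> borel_measurable \<Omega>" "\<forall>n. distr \<Omega> borel (Yn n) = \<mu> n"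
    "Y \<in> measurable \<Omega> lborel" "distr \<Omega> borel Y = M"
    "\<forall>x\<in>space \<Omega>. (\<lambda>n. Yn n x) \<longlonglongrightarrow> Y x" by blast
  then have [measurable]: "\<And>n. Yn n \<in> borel_measurable \<Omega>" and dYn: "\<And>n. distr \<Omega> borel (Yn n) = \<mu> n"
    and Y: "Y \<in> measurable \<Omega> lborel" and dY: "distr \<Omega> borel Y = M"
    and lim: "\<And>x. x \<in> space \<Omega> \<Longrightarrow> (\<lambda>n. Yn n x) \<longlonglongrightarrow> Y x" by blast+
  interpret \<Omega>: prob_space \<Omega> by (rule \<Omega>(1))
  have [measurable]: "Y \<in> borel_measurable \<Omega>" using Y by simp
  have "(\<lambda>n. \<Omega>.expectation (\<lambda>x. min \<bar>Yn n x - Y x\<bar> 2)) \<longlonglongrightarrow> \<Omega>.expectation (\<lambda>x. 0)"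
  proof (rule integral_dominated_convergence[where w = "\<lambda>_. 2"])
    show "AE x in \<Omega>. (\<lambda>n. min \<bar>Yn n x - Y x\<bar> 2) \<longlonglongrightarrow> 0"
    proof (rule AE_I2)
      fix x assume "x \<in> space \<Omega>"
      then have "(\<lambda>n. \<bar>Yn n x - Y x\<bar>) \<longlonglongrightarrow> 0"
        using lim LIM_zero tendsto_rabs_zero by blast
      then have "(\<lambda>n. min \<bar>Yn n x - Y x\<bar> 2) \<longlonglongrightarrow> min 0 2" by (intro tendsto_min tendsto_const)
      then show "(\<lambda>n. min \<bar>Yn n x - Y x\<bar> 2) \<longlonglongrightarrow> 0" by simp
    qed
  qed auto
  then have "\<forall>\<^sub>F n in sequentially. \<Omega>.expectation (\<lambda>x. min \<bar>Yn n x - Y x\<bar> 2) < e"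
    using e by (auto dest: order_tendstoD(2))
  then show ?thesis
  proof eventually_elim
    case (elim n)
    show ?case
    proof (intro allI impI)
      fix F assume F: "bounded_lipschitz F"
      note [measurable] = bounded_lipschitz_measurable[OF F]
      have "(\<integral>x. F x \<partial>\<mu> n) = \<Omega>.expectation (\<lambda>x. F (Yn n x))" "(\<integral>x. F x \<partial>M) = \<Omega>.expectation (\<lambda>x. F (Y x))"
        unfolding dYn[symmetric] dY[symmetric] by (simp_all add: integral_distr)
      then show "\<bar>(\<integral>x. F x \<partial>\<mu> n) - (\<integral>x. F x \<partial>M)\<bar> \<le> e"
        using \<Omega>.bounded_lipschitz_expectation_diff[OF F, of "Yn n" Y] elim by simp
    qed
  qed
qed

section \<open>Centred Gaussian laws\<close>

definition gauss :: "real \<Rightarrow> real measure" where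
  "gauss \<sigma> = distr std_normal_distribution borel ((*) \<sigma>)"

lemma prob_space_std_normal: "prob_space std_normal_distribution"
  using real_dist_normal_dist by (simp add: real_distribution_def)

lemma real_distribution_gauss: "real_distribution (gauss \<sigma>)"
  unfolding gauss_def using prob_space.real_distribution_distr[OF prob_space_std_normal] by simp

lemma sets_gauss [measurable_cong, simp]: "sets (gauss \<sigma>) = sets borel"
  by (simp add: gauss_def)

lemma prob_space_gauss: "prob_space (gauss \<sigma>)"
  using real_distribution_gauss by (simp add: real_distribution_def)

lemma char_gauss: "char (gauss \<sigma>) t = complex_of_real (exp (- (\<sigma> * t)\<^sup>2 / 2))"
proof -
  have "char (gauss \<sigma>) t = char std_normal_distribution (\<sigma> * t)"
    unfolding char_def gauss_def by (subst integral_distr) (auto simp: mult_ac)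
  then show ?thesis by (simp add: char_std_normal_distribution)
qed

lemma abs_exp_minus_approx:
  assumes "0 \<le> (u::real)" shows "\<bar>exp (- u) - (1 - u)\<bar> \<le> u\<^sup>2"
proof -
  have "1 - u \<le> exp (- u)" using exp_ge_add_one_self[of "- u"] by simp
  moreover have "exp (- u) \<le> 1 - u + u\<^sup>2"
  proof -
    \<comment> \<open>The product is \<open>1 + u^3\<close>.\<close>
    have "1 \<le> (1 - u + u\<^sup>2) * (1 + u)"
      using assms by (simp add: algebra_simps power2_eq_square)
    also have "\<dots> \<le> (1 - u + u\<^sup>2) * exp u"
    proof (rule mult_left_mono)
      have "0 \<le> (1 - u)\<^sup>2 + u" using assms by simp
      then show "0 \<le> 1 - u + u\<^sup>2" by (simp add: power2_eq_square algebra_simps)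
    qed (rule exp_ge_add_one_self)
    finally show ?thesis by (simp add: exp_minus field_simps)
  qed
  ultimately show ?thesis by simp
qed

subsection \<open>Gaussian increments over one block\<close>

text \<open>Both sides are close to \<open>1 - \<theta>^2 / 4\<close>, the second-order expansion
  for a centred variable of variance 1/2. The constants: \<open>4^3 / 6 < 11\<close> from the cubic
  remainder, \<open>1 / 16\<close> from the square of \<open>\<theta>^2 / 4\<close>, and
  \<open>\<tau>\<close> from the error of the variance. The bound 4 on \<open>y\<close> will be a
  weight ratio of at most 2 times a centred gain of at most 2.\<close>

lemma iexp_centred_step:
  fixes y :: "'a \<Rightarrow> real"
  assumes X: "finite X" "X \<noteq> {}" and mean: "avg X y = 0" and y: "\<And>x. x \<in> X \<Longrightarrow> \<bar>y x\<bar> \<le> 4"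
    and var: "\<bar>avg X (\<lambda>x. (y x)\<^sup>2) - 1 / 2\<bar> \<le> \<tau>"
  shows "cmod (avg X (\<lambda>x. iexp (\<theta> * y x)) - complex_of_real (exp (- (\<theta>\<^sup>2 / 4))))
           \<le> 11 * \<bar>\<theta>\<bar> ^ 3 + \<theta> ^ 4 / 16 + \<theta>\<^sup>2 * \<tau> / 2"
proof -
  define v where "v = avg X (\<lambda>x. (y x)\<^sup>2)"
  have poly: "(\<Sum>k\<le>2. (\<i> * complex_of_real z) ^ k / fact k) = 1 + \<i> * z - complex_of_real (z\<^sup>2) / 2" for z :: real
    by (simp add: numeral_eq_Suc algebra_simps)
  have "avg X (\<lambda>x. 1 + \<i> * complex_of_real (\<theta> * y x) - complex_of_real ((\<theta> * y x)\<^sup>2) / 2)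
      = avg X (\<lambda>x. 1) + \<i> * \<theta> * avg X (\<lambda>x. complex_of_real (y x)) - \<theta>\<^sup>2 / 2 * avg X (\<lambda>x. complex_of_real ((y x)\<^sup>2))"
    unfolding avg_mult_left[symmetric] avg_add[symmetric] avg_diff[symmetric]
    by (rule avg_cong) (auto simp: power_mult_distrib)
  also have "\<dots> = complex_of_real (1 - \<theta>\<^sup>2 / 2 * v)"
    unfolding avg_complex_of_real mean v_def using X by (simp add: avg_const)
  finally have A: "avg X (\<lambda>x. 1 + \<i> * complex_of_real (\<theta> * y x) - complex_of_real ((\<theta> * y x)\<^sup>2) / 2)
     = complex_of_real (1 - \<theta>\<^sup>2 / 2 * v)" .
  have 1: "cmod (avg X (\<lambda>x. iexp (\<theta> * y x)) - complex_of_real (1 - \<theta>\<^sup>2 / 2 * v)) \<le> 11 * \<bar>\<theta>\<bar> ^ 3"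
    unfolding A[symmetric]
  proof (rule norm_avg_diff_le[OF X])
    fix x assume x: "x \<in> X"
    have "cmod (iexp (\<theta> * y x) - (1 + \<i> * complex_of_real (\<theta> * y x) - complex_of_real ((\<theta> * y x)\<^sup>2) / 2))
        \<le> \<bar>\<theta> * y x\<bar> ^ 3 / 6"
      using iexp_approx1[of "\<theta> * y x" 2] unfolding poly by (simp add: numeral_eq_Suc)
    also have "\<bar>\<theta> * y x\<bar> ^ 3 \<le> \<bar>\<theta>\<bar> ^ 3 * 4 ^ 3"
      unfolding abs_mult power_mult_distrib by (intro mult_left_mono power_mono y x) auto
    also have "\<bar>\<theta>\<bar> ^ 3 * 4 ^ 3 / 6 \<le> 11 * \<bar>\<theta>\<bar> ^ 3" by simp
    finally show "cmod (iexp (\<theta> * y x) - (1 + \<i> * complex_of_real (\<theta> * y x) - complex_of_real ((\<theta> * y x)\<^sup>2) / 2))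
        \<le> 11 * \<bar>\<theta>\<bar> ^ 3" by simp
  qed
  have 2: "\<bar>(1 - \<theta>\<^sup>2 / 2 * v) - (1 - \<theta>\<^sup>2 / 4)\<bar> \<le> \<theta>\<^sup>2 * \<tau> / 2"
  proof -
    have "(1 - \<theta>\<^sup>2 / 2 * v) - (1 - \<theta>\<^sup>2 / 4) = \<theta>\<^sup>2 / 2 * (1 / 2 - v)"
      by (simp add: algebra_simps)
    then have "\<bar>(1 - \<theta>\<^sup>2 / 2 * v) - (1 - \<theta>\<^sup>2 / 4)\<bar> = \<theta>\<^sup>2 / 2 * \<bar>v - 1 / 2\<bar>"
      by (simp only: abs_mult abs_minus_commute[of "1 / 2" v]) simp
    also have "\<dots> \<le> \<theta>\<^sup>2 / 2 * \<tau>" using var by (intro mult_left_mono) (auto simp: v_def)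
    finally show ?thesis by simp
  qed
  have 3: "\<bar>exp (- (\<theta>\<^sup>2 / 4)) - (1 - \<theta>\<^sup>2 / 4)\<bar> \<le> \<theta> ^ 4 / 16"
    using abs_exp_minus_approx[of "\<theta>\<^sup>2 / 4"] by (simp add: power_divide flip: power_mult)
  have "cmod (avg X (\<lambda>x. iexp (\<theta> * y x)) - complex_of_real (exp (- (\<theta>\<^sup>2 / 4))))
    \<le> cmod (avg X (\<lambda>x. iexp (\<theta> * y x)) - complex_of_real (1 - \<theta>\<^sup>2 / 2 * v))
      + cmod (complex_of_real ((1 - \<theta>\<^sup>2 / 2 * v) - exp (- (\<theta>\<^sup>2 / 4))))"
    by (rule order_trans[OF _ norm_triangle_ineq]) simp
  also have "\<dots> \<le> 11 * \<bar>\<theta>\<bar> ^ 3 + (\<theta>\<^sup>2 * \<tau> / 2 + \<theta> ^ 4 / 16)"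
    unfolding norm_of_real using 1 2 3 by linarith
  finally show ?thesis by simp
qed

section \<open>Characteristic function of a block of martingale increments\<close>

context cyclic_shift
begin

definition mart :: "'a set \<Rightarrow> real" where "mart S = dev S / bw S"

text \<open>Conditional variance of the next gain: mean square from \<open>sum_gain_sq\<close> minus
  squared mean from \<open>avg_gain\<close>.\<close>

definition gain_var :: "'a set \<Rightarrow> real" where
  "gain_var S = (real (card (A - S)) - 2 * runs S + 2 * pits S) / card (A - S)
                 - (1 - 2 * runs S / card (A - S))\<^sup>2"

lemma bw_nonzero: "2 \<le> card (A - S) \<Longrightarrow> bw S \<noteq> 0"
  by (auto simp: bw_def)

text \<open>The contracted deviation and the contracted weight cancel, so that only the centred gain
  over the new weight is left. Three free positions keep the new weight
  \<open>(N - 1) (N - 2)\<close> away from 0.\<close>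

lemma mart_insert:
  assumes S: "S \<subset> A" and x: "x \<in> A - S" and N: "3 \<le> card (A - S)"
  shows "mart (insert x S) - mart S
    = ((runs (insert x S) - runs S) - avg (A - S) (\<lambda>x. runs (insert x S) - runs S)) / bw (insert x S)"
proof -
  have "bw S \<noteq> 0" using N by (intro bw_nonzero) simp
  moreover have "1 - 2 / real (card (A - S)) \<noteq> 0" using N by simp
  moreover have "(r * d + z) / (r * b) - d / b = z / (r * b)" if "b \<noteq> 0" "r \<noteq> 0" for r d z b :: real
    using that by (simp add: add_divide_distrib)
  ultimately show ?thesis
    unfolding mart_def dev_insert[OF S x] bw_insert[OF S x] by blast
qed

lemma avg_gain_centred_sq:
  assumes S: "S \<subset> A"
  shows "avg (A - S) (\<lambda>x. ((runs (insert x S) - runs S) - avg (A - S) (\<lambda>x. runs (insert x S) - runs S))\<^sup>2) = gain_var S"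
proof -
  define f where "f x = runs (insert x S) - runs S" for x
  define m where "m = avg (A - S) f"
  have fin: "finite (A - S)" "A - S \<noteq> {}" using S finite_A by auto
  have "avg (A - S) (\<lambda>x. (f x - m)\<^sup>2) = avg (A - S) (\<lambda>x. (f x)\<^sup>2 - 2 * m * f x + m\<^sup>2)"
    by (rule avg_cong) (auto simp: power2_diff)
  also have "\<dots> = avg (A - S) (\<lambda>x. (f x)\<^sup>2) - 2 * m * m + m\<^sup>2"
    unfolding avg_add avg_diff avg_mult_left avg_const[OF fin] by (simp add: m_def)
  also have "avg (A - S) (\<lambda>x. (f x)\<^sup>2) = (real (card (A - S)) - 2 * runs S + 2 * pits S) / card (A - S)"
    using S unfolding avg_def f_def by (subst sum_gain_sq) (auto simp: divide_inverse mult.commute)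
  also have "m = 1 - 2 * runs S / card (A - S)" unfolding m_def f_def by (rule avg_gain[OF S])
  finally show ?thesis
    unfolding gain_var_def f_def m_def by (simp add: power2_eq_square avg_gain[OF S])
qed

lemma abs_gain_centred_le:
  assumes S: "S \<subset> A" and x: "x \<in> A - S"
  shows "\<bar>(runs (insert x S) - runs S) - avg (A - S) (\<lambda>x. runs (insert x S) - runs S)\<bar> \<le> 2"
proof -
  define f where "f x = runs (insert x S) - runs S" for x
  have fin: "finite (A - S)" "A - S \<noteq> {}" using S finite_A by auto
  have f: "- 1 \<le> f y" "f y \<le> 1" if "y \<in> A - S" for y
    using abs_gain_le[OF that] by (auto simp: f_def)
  have "avg (A - S) f \<le> 1" by (rule avg_le_const[OF fin]) (rule f)
  moreover have "- 1 \<le> avg (A - S) f"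
    using avg_mono[of "A - S" "\<lambda>_. -1" f] f unfolding avg_const[OF fin] by blast
  ultimately show ?thesis using f[OF x] unfolding f_def by linarith
qed

text \<open>Induction on \<open>J\<close>, peeling off the first step. By the induction hypothesis
  the later steps contribute nearly the constant \<open>g ^ J\<close>, whatever position was filled,
  so it factors out of the first average. All factors have modulus at most 1, hence the errors just
  add up.\<close>

lemma iexp_mart_block:
  assumes "S \<subseteq> A" "card S + J + 2 \<le> card A"
    and w: "\<And>S' x. S \<subseteq> S' \<Longrightarrow> S' \<subset> A \<Longrightarrow> x \<in> A - S' \<Longrightarrow> card S' < card S + J \<Longrightarrow>
         \<bar>c / bw (insert x S')\<bar> \<le> 2 \<and> \<bar>(c / bw (insert x S'))\<^sup>2 * gain_var S' - 1 / 2\<bar> \<le> \<tau>"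
    and \<tau>: "0 \<le> \<tau>"
  shows "cmod (avg (perms (A - S)) (\<lambda>xs. iexp (\<theta> * (c * mart (S \<union> set (take J xs)) - c * mart S)))
             - complex_of_real (exp (- (\<theta>\<^sup>2 / 4))) ^ J)
         \<le> real J * (11 * \<bar>\<theta>\<bar> ^ 3 + \<theta> ^ 4 / 16 + \<theta>\<^sup>2 * \<tau> / 2)"
  using assms(1,2) w
proof (induction J arbitrary: S)
  case 0
  then show ?case using finite_A by (simp add: avg_const)
next
  case (Suc J)
  define e where "e = 11 * \<bar>\<theta>\<bar> ^ 3 + \<theta> ^ 4 / 16 + \<theta>\<^sup>2 * \<tau> / 2"
  define g where "g = complex_of_real (exp (- (\<theta>\<^sup>2 / 4)))"
  have ng: "cmod g \<le> 1" unfolding g_def norm_of_real by simp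
  have S: "S \<subset> A" using Suc.prems by auto
  have fin: "finite (A - S)" "A - S \<noteq> {}" using S finite_A by auto
  have N: "3 \<le> card (A - S)" using Suc.prems finite_A by (simp add: card_Diff_subset finite_subset)
  define \<phi> where "\<phi> T = avg (perms (A - T)) (\<lambda>xs. iexp (\<theta> * (c * mart (T \<union> set (take J xs)) - c * mart T)))" for T
  define y where "y x = c * (mart (insert x S) - mart S)" for x
  \<comment> \<open>The weight after an insertion depends only on the cardinality, so the increments
    of this step are one constant \<open>r\<close> times the centred gains.\<close>
  obtain x0 where x0: "x0 \<in> A - S" using fin by blast
  define r where "r = c / bw (insert x0 S)"
  have r: "c / bw (insert x S) = r" if "x \<in> A - S" for x
    unfolding r_def bw_insert[OF S that] bw_insert[OF S x0] ..
  have r2: "\<bar>r\<bar> \<le> 2" "\<bar>r\<^sup>2 * gain_var S - 1 / 2\<bar> \<le> \<tau>"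
    using Suc.prems(3)[OF subset_refl S x0] by (auto simp: r_def)
  define \<xi> where "\<xi> x = (runs (insert x S) - runs S) - avg (A - S) (\<lambda>x. runs (insert x S) - runs S)" for x
  have y: "y x = r * \<xi> x" if "x \<in> A - S" for x
    unfolding y_def mart_insert[OF S that N] \<xi>_def r[OF that, symmetric] by simp
  have step: "cmod (avg (A - S) (\<lambda>x. iexp (\<theta> * y x)) - g) \<le> e"
    unfolding e_def g_def
  proof (rule iexp_centred_step[OF fin])
    have "avg (A - S) y = r * avg (A - S) \<xi>"
      using y by (subst avg_mult_left[symmetric]) (rule avg_cong, auto)
    also have "avg (A - S) \<xi> = 0"
      unfolding \<xi>_def avg_diff[of _ _ "\<lambda>_. avg _ _"] avg_const[OF fin] by simp
    finally show "avg (A - S) y = 0" by simp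
    show "\<bar>y x\<bar> \<le> 4" if "x \<in> A - S" for x
      using mult_mono[OF r2(1) abs_gain_centred_le[OF S that]] y[OF that] by (simp add: abs_mult \<xi>_def)
    have "avg (A - S) (\<lambda>x. (y x)\<^sup>2) = r\<^sup>2 * avg (A - S) (\<lambda>x. (\<xi> x)\<^sup>2)"
      using y by (subst avg_mult_left[symmetric]) (rule avg_cong, auto simp: power_mult_distrib)
    also have "avg (A - S) (\<lambda>x. (\<xi> x)\<^sup>2) = gain_var S"
      unfolding \<xi>_def by (rule avg_gain_centred_sq[OF S])
    finally show "\<bar>avg (A - S) (\<lambda>x. (y x)\<^sup>2) - 1 / 2\<bar> \<le> \<tau>" using r2(2) by simp
  qed
  have IH: "cmod (\<phi> (insert x S) - g ^ J) \<le> real J * e" if x: "x \<in> A - S" for x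
    unfolding \<phi>_def g_def e_def
  proof (rule Suc.IH)
    show "insert x S \<subseteq> A" using S x by auto
    have c: "card (insert x S) = Suc (card S)" using card_insert_S[of S x] S x by auto
    show "card (insert x S) + J + 2 \<le> card A" using Suc.prems c by simp
    fix S' x' assume "insert x S \<subseteq> S'" "S' \<subset> A" "x' \<in> A - S'" "card S' < card (insert x S) + J"
    then show "\<bar>c / bw (insert x' S')\<bar> \<le> 2 \<and> \<bar>(c / bw (insert x' S'))\<^sup>2 * gain_var S' - 1 / 2\<bar> \<le> \<tau>"
      using c by (intro Suc.prems(3)) auto
  qed
  have "avg (perms (A - S)) (\<lambda>xs. iexp (\<theta> * (c * mart (S \<union> set (take (Suc J) xs)) - c * mart S)))
     = avg (A - S) (\<lambda>x. avg (perms (A - S - {x})) (\<lambda>xs. iexp (\<theta> * (c * mart (S \<union> set (take (Suc J) (x # xs))) - c * mart S))))"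
    by (rule avg_perms_Cons[OF fin])
  also have "\<dots> = avg (A - S) (\<lambda>x. iexp (\<theta> * y x) * \<phi> (insert x S))"
  proof (rule avg_cong)
    fix x assume "x \<in> A - S"
    have e1: "A - S - {x} = A - insert x S" by auto
    have e2: "iexp (\<theta> * (c * u - c * mart S)) = iexp (\<theta> * y x) * iexp (\<theta> * (c * u - c * mart (insert x S)))" for u
    proof -
      have "\<theta> * (c * u - c * mart S) = \<theta> * y x + \<theta> * (c * u - c * mart (insert x S))"
        by (simp add: y_def algebra_simps)
      then show ?thesis by (simp add: exp_add[symmetric] distrib_left)
    qed
    show "avg (perms (A - S - {x})) (\<lambda>xs. iexp (\<theta> * (c * mart (S \<union> set (take (Suc J) (x # xs))) - c * mart S)))
       = iexp (\<theta> * y x) * \<phi> (insert x S)"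
      unfolding \<phi>_def avg_mult_left[symmetric] e1 e2[symmetric] by simp
  qed simp
  finally have eq: "avg (perms (A - S)) (\<lambda>xs. iexp (\<theta> * (c * mart (S \<union> set (take (Suc J) xs)) - c * mart S)))
     = avg (A - S) (\<lambda>x. iexp (\<theta> * y x) * \<phi> (insert x S))" .
  have "cmod (avg (A - S) (\<lambda>x. iexp (\<theta> * y x) * \<phi> (insert x S)) - avg (A - S) (\<lambda>x. iexp (\<theta> * y x) * g ^ J)) \<le> real J * e"
  proof (rule norm_avg_diff_le[OF fin])
    fix x assume x: "x \<in> A - S"
    have "cmod (iexp (\<theta> * y x) * \<phi> (insert x S) - iexp (\<theta> * y x) * g ^ J) = cmod (\<phi> (insert x S) - g ^ J)"
      by (simp add: right_diff_distrib[symmetric] norm_mult)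
    then show "cmod (iexp (\<theta> * y x) * \<phi> (insert x S) - iexp (\<theta> * y x) * g ^ J) \<le> real J * e"
      using IH[OF x] by simp
  qed
  moreover have "cmod (avg (A - S) (\<lambda>x. iexp (\<theta> * y x) * g ^ J) - g ^ Suc J) \<le> e"
  proof -
    have "avg (A - S) (\<lambda>x. iexp (\<theta> * y x) * g ^ J) - g ^ Suc J = (avg (A - S) (\<lambda>x. iexp (\<theta> * y x)) - g) * g ^ J"
      unfolding avg_mult_right by (simp add: algebra_simps)
    then have "cmod (avg (A - S) (\<lambda>x. iexp (\<theta> * y x) * g ^ J) - g ^ Suc J)
       = cmod (avg (A - S) (\<lambda>x. iexp (\<theta> * y x)) - g) * cmod g ^ J" by (simp add: norm_mult norm_power)
    also have "\<dots> \<le> e * 1" using step ng by (intro mult_mono power_le_one) (auto intro: order_trans[OF norm_ge_zero])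
    finally show ?thesis by simp
  qed
  ultimately have "cmod (avg (A - S) (\<lambda>x. iexp (\<theta> * y x) * \<phi> (insert x S)) - g ^ Suc J) \<le> real J * e + e"
    by (smt (verit) norm_triangle_ineq diff_add_cancel add_diff_eq)
  then show ?case unfolding eq g_def[symmetric] e_def[symmetric] by (simp add: algebra_simps)
qed

end

section \<open>Typical configurations and their stability over a short window\<close>

context cyclic_shift
begin

text \<open>The tolerance \<open>\<tau> n\<close> is far coarser than the true fluctuations of order
  \<open>sqrt n\<close>. It only has to make \<open>gain_var\<close> close to 1/2, and it persists,
  up to constants, during \<open>\<tau> n\<close> further insertions.\<close>

definition typical :: "real \<Rightarrow> 'a set \<Rightarrow> bool" where
  "typical \<tau> S \<longleftrightarrow> S \<subseteq> A \<and> \<bar>2 * real (card S) - real (card A)\<bar> \<le> 1 \<and> \<bar>dev S\<bar> \<le> \<tau> * card A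
     \<and> \<bar>pits S - real (card A) / 8\<bar> \<le> \<tau> * card A"

lemma typical_mono: "typical \<tau> S \<Longrightarrow> \<tau> \<le> \<tau>' \<Longrightarrow> typical \<tau>' S"
  unfolding typical_def using mult_right_mono[of \<tau> \<tau>' "real (card A)"] by auto

lemma lipschitz_superset:
  fixes f :: "'a set \<Rightarrow> real"
  assumes step: "\<And>x S. S \<subseteq> A \<Longrightarrow> x \<in> A - S \<Longrightarrow> \<bar>f (insert x S) - f S\<bar> \<le> K"
    and S: "S0 \<subseteq> S" "S \<subseteq> A"
  shows "\<bar>f S - f S0\<bar> \<le> K * (real (card S) - real (card S0))"
proof -
  have fin: "finite S" using S finite_A finite_subset by blast
  have "\<bar>f (S0 \<union> T) - f S0\<bar> \<le> K * card T" if "finite T" "T \<subseteq> S - S0" for T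
    using that
  proof (induction T rule: finite_induct)
    case (insert x T)
    have "\<bar>f (insert x (S0 \<union> T)) - f (S0 \<union> T)\<bar> \<le> K"
      using insert.prems insert.hyps S by (intro step) auto
    then show ?case using insert by (simp add: algebra_simps)
  qed simp
  from this[of "S - S0"] fin S show ?thesis
    by (simp add: card_Diff_subset finite_subset card_mono of_nat_diff Un_absorb1)
qed

lemma run_mean_half:
  assumes "\<bar>2 * h - real (card A)\<bar> \<le> 1" "2 \<le> card A"
  shows "\<bar>run_mean h - real (card A) / 4\<bar> \<le> 1"
proof -
  define n d where "n = real (card A)" and "d = 2 * h - n"
  have n: "n \<ge> 2" using assms by (simp add: n_def)
  have d: "d\<^sup>2 \<le> 1" using assms(1) by (simp add: d_def n_def abs_square_le_1)
  have h: "h = (d + n) / 2" by (simp add: d_def)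
  have "run_mean h - n / 4 = (n - d\<^sup>2) / (4 * (n - 1))"
    unfolding run_mean_def n_def[symmetric] h using n by (simp add: field_simps power2_eq_square)
  moreover have "\<bar>(n - d\<^sup>2) / (4 * (n - 1))\<bar> \<le> 1"
    using n d by (simp add: abs_le_iff field_simps, use zero_le_power2[of d] in linarith)
  ultimately show ?thesis by (simp add: n_def)
qed

text \<open>Runs and pits change by at most 1 and 3 per insertion, so typicality of
  \<open>S0\<close> alone controls every set reached from it within \<open>\<tau> n\<close> steps;
  the chain never has to be examined again inside the window.\<close>

lemma typical_window:
  fixes \<tau> :: real
  assumes ty: "typical \<tau> S0" and S: "S0 \<subseteq> S" "S \<subseteq> A" "real (card S) \<le> card S0 + \<tau> * card A"
    and n: "100 \<le> card A" "1 \<le> \<tau> * card A" and \<tau>: "\<tau> \<le> 1 / 100"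
  shows "\<bar>real (card (A - S)) - real (card A) / 2\<bar> \<le> 2 * (\<tau> * card A)"
    and "\<bar>runs S - real (card A) / 4\<bar> \<le> 3 * (\<tau> * card A)"
    and "\<bar>pits S - real (card A) / 8\<bar> \<le> 4 * (\<tau> * card A)"
    and "\<bar>gain_var S - 1 / 2\<bar> \<le> 39 * \<tau>"
proof -
  define n where "n = real (card A)"
  have n100: "n \<ge> 100" using n by (simp add: n_def)
  have tn: "\<tau> * n \<ge> 1" "\<tau> * n \<le> n / 100" using n \<tau> n100 by (auto simp: n_def mult_right_mono)
  note t = ty[unfolded typical_def, folded n_def]
  have cS: "real (card S0) \<le> card S" "real (card S) \<le> card S0 + \<tau> * n"
    using S card_mono[OF finite_subset[OF S(2) finite_A] S(1)] by (auto simp: n_def)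
  define N where "N = real (card (A - S))"
  have N: "N = n - card S" using card_Diff_A[OF S(2)] by (simp add: N_def n_def)
  show 1: "\<bar>real (card (A - S)) - real (card A) / 2\<bar> \<le> 2 * (\<tau> * card A)"
    unfolding N_def[symmetric] n_def[symmetric] N using t cS tn by (simp add: abs_le_iff)
  have "\<bar>runs S - runs S0\<bar> \<le> 1 * (real (card S) - real (card S0))"
    by (rule lipschitz_superset[OF _ S(1,2)]) (use abs_gain_le in auto)
  moreover have "\<bar>runs S0 - n / 4\<bar> \<le> \<tau> * n + 1"
  proof -
    have "\<bar>runs S0 - run_mean (card S0)\<bar> \<le> \<tau> * n" "\<bar>2 * real (card S0) - n\<bar> \<le> 1" using t by (auto simp: dev_def)
    then show ?thesis using run_mean_half[of "card S0"] n unfolding n_def by linarith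
  qed
  ultimately show 2: "\<bar>runs S - real (card A) / 4\<bar> \<le> 3 * (\<tau> * card A)"
    unfolding n_def[symmetric] using cS tn by (simp add: abs_le_iff)
  have "\<bar>pits S - pits S0\<bar> \<le> 3 * (real (card S) - real (card S0))"
    by (rule lipschitz_superset[OF _ S(1,2)]) (rule abs_pits_insert_le)
  then show 3: "\<bar>pits S - real (card A) / 8\<bar> \<le> 4 * (\<tau> * card A)"
    unfolding n_def[symmetric] using cS t by (simp add: abs_le_iff)
  note 1 = 1[folded N_def n_def] and 2 = 2[folded n_def] and 3 = 3[folded n_def]
  have N48: "N \<ge> 48 / 100 * n" using 1 tn by linarith
  then have Npos: "N > 0" using n100 by linarith
  have \<tau>0: "\<tau> \<ge> 0" using tn n100 by (smt (verit) mult_neg_pos)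
  have \<tau>N: "\<tau> * n * (48 / 100) \<le> \<tau> * N" using mult_left_mono[OF N48 \<tau>0] by (simp add: mult_ac)
  \<comment> \<open>\<open>c\<close> is the mean gain, close to 0, and \<open>g\<close> the
    contribution of the pits, close to 1/2. The constants 17 and 19 come from deviations of
    \<open>8 \<tau> n\<close> and \<open>18 \<tau> n\<close>, divided by \<open>N\<close> and
    \<open>2 N\<close> with \<open>N \<ge> 0.48 n\<close>; with 3 for \<open>c^2\<close> they make
    up the 39.\<close>
  define c where "c = (N - 2 * runs S) / N"
  define g where "g = 2 * pits S / N"
  have "\<bar>N - 2 * runs S\<bar> \<le> 17 * \<tau> * N" using 1 2 \<tau>N by (simp add: abs_le_iff)
  then have c: "\<bar>c\<bar> \<le> 17 * \<tau>" using Npos by (simp add: c_def abs_divide divide_le_eq)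
  have "\<bar>4 * pits S - N\<bar> \<le> 19 * \<tau> * (2 * N)" using 1 3 \<tau>N by (simp add: abs_le_iff)
  moreover have "g - 1 / 2 = (4 * pits S - N) / (2 * N)" using Npos by (simp add: g_def field_simps)
  ultimately have g: "\<bar>g - 1 / 2\<bar> \<le> 19 * \<tau>" using Npos by (simp add: abs_divide divide_le_eq)
  have "c\<^sup>2 \<le> 3 * \<tau>"
  proof -
    have "\<bar>c\<bar> * \<bar>c\<bar> \<le> (17 * \<tau>) * (17 / 100)" using c \<tau> by (intro mult_mono) auto
    then show ?thesis using \<tau>0 by (simp add: power2_eq_square)
  qed
  moreover have "gain_var S = c + g - c\<^sup>2"
    unfolding gain_var_def N_def[symmetric] c_def g_def using Npos by (simp add: diff_divide_distrib add_divide_distrib)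
  ultimately show "\<bar>gain_var S - 1 / 2\<bar> \<le> 39 * \<tau>" using c g zero_le_power2[of c] by linarith
qed

text \<open>Each of the two factors of the weight changes relatively by at most
  \<open>2.2 \<tau>\<close>, so the weight may be frozen at \<open>S0\<close> throughout the
  window.\<close>

lemma weight_window:
  fixes \<tau> :: real
  assumes ty: "typical \<tau> S0" and S: "S0 \<subseteq> S" "S \<subseteq> A" "real (card S) \<le> card S0 + \<tau> * card A"
    and n: "100 \<le> card A" "1 \<le> \<tau> * card A" and \<tau>: "\<tau> \<le> 1 / 100"
  shows "1 \<le> bw S0 / bw S" and "bw S0 / bw S \<le> 1 + 5 * \<tau>" and "bw S > 0"
proof -
  define n where "n = real (card A)"
  have n100: "n \<ge> 100" using n by (simp add: n_def)
  have tn: "\<tau> * n \<ge> 1" "\<tau> * n \<le> n / 100" using n \<tau> n100 by (auto simp: n_def mult_right_mono)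
  have \<tau>0: "\<tau> \<ge> 0" using tn n100 by (smt (verit) mult_neg_pos)
  have cS: "real (card S0) \<le> card S" "real (card S) \<le> card S0 + \<tau> * n"
    using S card_mono[OF finite_subset[OF S(2) finite_A] S(1)] by (auto simp: n_def)
  define N M where "N = real (card (A - S0))" and "M = real (card (A - S))"
  have NM: "N = n - card S0" "M = n - card S" using card_Diff_A S by (auto simp: N_def M_def n_def)
  have M48: "M \<ge> 48 / 100 * n" using typical_window(1)[OF ty S n \<tau>] tn by (simp add: M_def n_def abs_le_iff)
  have le: "M \<le> N" "N \<le> M + \<tau> * n" using cS NM by auto
  have M1: "M - 1 \<ge> 47 / 100 * n" using M48 n100 by linarith
  have t22: "\<tau> * n \<le> 22 / 10 * \<tau> * (M - 1)"
  proof -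
    have "22 / 10 * \<tau> * (M - 1) \<ge> 22 / 10 * \<tau> * (47 / 100 * n)" using M1 \<tau>0 by (intro mult_left_mono) auto
    moreover have "22 / 10 * \<tau> * (47 / 100 * n) \<ge> 1 * (\<tau> * n)" using tn by simp
    ultimately show ?thesis by linarith
  qed
  have pos: "M - 1 > 0" "M > 0" using M1 n100 by linarith+
  show bw: "bw S > 0" unfolding bw_def M_def[symmetric] using pos by simp
  have eq: "bw S0 / bw S = (N / M) * ((N - 1) / (M - 1))" unfolding bw_def M_def N_def by simp
  have a: "1 \<le> N / M" "1 \<le> (N - 1) / (M - 1)" using le pos by auto
  have "22 / 10 * \<tau> * (M - 1) \<le> 22 / 10 * \<tau> * M" using \<tau>0 by (intro mult_left_mono) auto
  then have b: "N / M \<le> 1 + 22 / 10 * \<tau>" using le t22 pos by (simp add: divide_le_eq algebra_simps)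
  have "N - 1 \<le> (1 + 22 / 10 * \<tau>) * (M - 1)" 
  proof -
    have "(1 + 22 / 10 * \<tau>) * (M - 1) = (M - 1) + 22 / 10 * \<tau> * (M - 1)" by (simp only: distrib_right mult_1_left)
    moreover have "N - 1 \<le> (M - 1) + \<tau> * n" using le by simp
    ultimately show ?thesis using t22 by (metis add_left_mono order_trans)
  qed
  then have c: "(N - 1) / (M - 1) \<le> 1 + 22 / 10 * \<tau>" using pos by (simp add: divide_le_eq)
  show "1 \<le> bw S0 / bw S" unfolding eq using mult_mono[OF a(1) a(2)] a by simp
  have "bw S0 / bw S \<le> (1 + 22 / 10 * \<tau>) * (1 + 22 / 10 * \<tau>)"
    unfolding eq using a b c \<tau>0 by (intro mult_mono) auto
  also have "\<dots> = 1 + 44 / 10 * \<tau> + (484 / 100 * \<tau>) * \<tau>" by (simp add: algebra_simps)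
  also have "\<dots> \<le> 1 + 44 / 10 * \<tau> + (484 / 100 * \<tau>) * (1 / 100)" using \<tau> \<tau>0 by (intro add_left_mono mult_left_mono) auto
  finally show "bw S0 / bw S \<le> 1 + 5 * \<tau>" using \<tau>0 by simp
qed

text \<open>With the weight frozen at \<open>S0\<close>, the increments of
  \<open>bw S0 * mart\<close> are almost the centred gains themselves. The 50 is 39 from
  \<open>gain_var\<close> plus 11 from the squared weight ratio.\<close>

lemma iexp_mart_block_typical:
  fixes \<tau> :: real
  assumes ty: "typical \<tau> S0" and S: "S0 \<subseteq> S" "S \<subseteq> A" "real (card S + J) \<le> card S0 + \<tau> * card A"
    and n: "100 \<le> card A" "1 \<le> \<tau> * card A" and \<tau>: "\<tau> \<le> 1 / 100"
  shows "cmod (avg (perms (A - S)) (\<lambda>xs. iexp (\<theta> * (bw S0 * mart (S \<union> set (take J xs)) - bw S0 * mart S)))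
             - complex_of_real (exp (- (\<theta>\<^sup>2 / 4))) ^ J)
         \<le> real J * (11 * \<bar>\<theta>\<bar> ^ 3 + \<theta> ^ 4 / 16 + \<theta>\<^sup>2 * (50 * \<tau>) / 2)"
proof (rule iexp_mart_block[OF S(2)])
  have tn: "\<tau> * card A \<le> real (card A) / 100" using n \<tau> by (auto simp: mult_right_mono)
  have \<tau>0: "\<tau> \<ge> 0" using n by (smt (verit) mult_neg_pos of_nat_0_le_iff mult_nonneg_nonneg mult_nonpos_nonneg)
  then show "0 \<le> 50 * \<tau>" by simp
  have "\<bar>2 * real (card S0) - real (card A)\<bar> \<le> 1" using ty by (simp add: typical_def)
  then have "real (card S + J + 2) \<le> real (card A)"
    using S(3) tn n by linarith
  then show "card S + J + 2 \<le> card A" by linarith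
  fix S' x assume S': "S \<subseteq> S'" "S' \<subset> A" "x \<in> A - S'" "card S' < card S + J"
  have c: "real (card (insert x S')) \<le> card S0 + \<tau> * card A" "real (card S') \<le> card S0 + \<tau> * card A"
    using S' S(3) card_insert_S[of S' x] by auto
  have sub: "S0 \<subseteq> insert x S'" "insert x S' \<subseteq> A" "S0 \<subseteq> S'" "S' \<subseteq> A" using S S' by auto
  define r v where "r = bw S0 / bw (insert x S')" and "v = gain_var S'"
  have r: "1 \<le> r" "r \<le> 1 + 5 * \<tau>"
    using weight_window(1,2)[OF ty sub(1,2) c(1) n \<tau>] by (simp_all add: r_def)
  have v: "\<bar>v - 1 / 2\<bar> \<le> 39 * \<tau>" using typical_window(4)[OF ty sub(3,4) c(2) n \<tau>] by (simp add: v_def)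
  have "r\<^sup>2 \<le> (1 + 5 * \<tau>)\<^sup>2" using r by (intro power_mono) auto
  also have "\<dots> = 1 + 10 * \<tau> + 25 * \<tau> * \<tau>" by (simp add: power2_eq_square algebra_simps)
  also have "\<dots> \<le> 1 + 10 * \<tau> + 25 * \<tau> * (1 / 100)" using \<tau> \<tau>0 by (intro add_left_mono mult_left_mono) auto
  finally have r2: "r\<^sup>2 - 1 \<le> 11 * \<tau>" using \<tau>0 by simp
  have r20: "0 \<le> r\<^sup>2 - 1" using r by simp
  have "\<bar>r\<^sup>2 * v - 1 / 2\<bar> = \<bar>(v - 1 / 2) + (r\<^sup>2 - 1) * v\<bar>" by (simp add: algebra_simps)
  also have "\<dots> \<le> \<bar>v - 1 / 2\<bar> + (r\<^sup>2 - 1) * \<bar>v\<bar>" using r20 abs_triangle_ineq[of "v - 1 / 2" "(r\<^sup>2 - 1) * v"] by (simp add: abs_mult)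
  also have "\<dots> \<le> 39 * \<tau> + (11 * \<tau>) * 1" using r2 r20 v \<tau> by (intro add_mono mult_mono) auto
  finally show "\<bar>bw S0 / bw (insert x S')\<bar> \<le> 2 \<and> \<bar>(bw S0 / bw (insert x S'))\<^sup>2 * gain_var S' - 1 / 2\<bar> \<le> 50 * \<tau>"
    using r \<tau> unfolding r_def[symmetric] v_def[symmetric] by simp
qed

end

lemma char_avg:
  assumes "finite X" "X \<noteq> {}"
  shows "char (distr (measure_pmf (pmf_of_set X)) borel f) t = avg X (\<lambda>x. iexp (t * f x))"
proof -
  have "char (distr (measure_pmf (pmf_of_set X)) borel f) t = (CLINT x|measure_pmf (pmf_of_set X). iexp (t * f x))"
    unfolding char_def by (subst integral_distr) auto
  also have "\<dots> = (\<Sum>x\<in>X. pmf (pmf_of_set X) x *\<^sub>R iexp (t * f x))"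
    by (rule integral_measure_pmf) (use assms in auto)
  also have "\<dots> = avg X (\<lambda>x. iexp (t * f x))"
    using assms by (simp add: avg_def scaleR_sum_right inverse_eq_divide)
  finally show ?thesis .
qed

text \<open>Uniformity in the configuration and in the test function is obtained by contradiction: a sequence
  of bad configurations would still have characteristic functions that converge to the Gaussian one.\<close>
lemma block_bounded_lipschitz:
  assumes \<eta>: "0 < \<eta>" and e: "0 < e"
  shows "\<exists>\<tau>::real>0. \<exists>n0. \<forall>(A :: 'a set) s S0 S J F. cyclic_shift A s \<longrightarrow> n0 \<le> card A \<longrightarrow> cyclic_shift.typical A s \<tau> S0 \<longrightarrow>
     S0 \<subseteq> S \<longrightarrow> S \<subseteq> A \<longrightarrow> real (card S + J) \<le> card S0 + \<tau> * card A \<longrightarrow> \<bar>real J - \<eta> / 2 * card A powr (2/3)\<bar> \<le> 1 \<longrightarrow>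
     bounded_lipschitz F \<longrightarrow>
     \<bar>avg (perms (A - S)) (\<lambda>xs. F (card A powr (-1/3) * (cyclic_shift.bw A S0 * cyclic_shift.mart A s (S \<union> set (take J xs))
            - cyclic_shift.bw A S0 * cyclic_shift.mart A s S)))
        - (\<integral>z. F z \<partial>gauss (sqrt \<eta> / 2))\<bar> \<le> e"
proof (rule ccontr)
  define P where "P = (\<lambda>(\<tau>::real) n0 (A :: 'a set) s S0 S J F. cyclic_shift A s \<and> n0 \<le> card A \<and> cyclic_shift.typical A s \<tau> S0 \<and>
     S0 \<subseteq> S \<and> S \<subseteq> A \<and> real (card S + J) \<le> card S0 + \<tau> * card A \<and> \<bar>real J - \<eta> / 2 * card A powr (2/3)\<bar> \<le> 1 \<and>
     bounded_lipschitz F \<and>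
     \<not> \<bar>avg (perms (A - S)) (\<lambda>xs. F (card A powr (-1/3) * (cyclic_shift.bw A S0 * cyclic_shift.mart A s (S \<union> set (take J xs))
            - cyclic_shift.bw A S0 * cyclic_shift.mart A s S)))
        - (\<integral>z. F z \<partial>gauss (sqrt \<eta> / 2))\<bar> \<le> e)"
  assume "\<not> ?thesis"
  then have "\<forall>\<tau>>0. \<forall>n0. \<exists>A s S0 S J F. P \<tau> n0 A s S0 S J F"
    unfolding P_def not_all not_ex not_imp bex_simps by meson
  \<comment> \<open>Tolerances that tend to 0, with sizes so large that \<open>\<tau>\<close> times
    the size is still at least 1, as the window lemmas require.\<close>
  then have "\<forall>p::nat. \<exists>A s S0 S J F. P (1 / (real p + 100)) ((p + 100)\<^sup>2) A s S0 S J F" by simp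
  then obtain A s S0 S J F where P: "\<And>p::nat. P (1 / (real p + 100)) ((p + 100)\<^sup>2) (A p) (s p) (S0 p) (S p) (J p) (F p)"
    by metis
  define r where "r p = real (card (A p)) powr (-1/3)" for p
  define \<tau> where "\<tau> p = 1 / (real p + 100)" for p
  have card: "(p + 100)\<^sup>2 \<le> card (A p)" for p using P[of p] by (auto simp: P_def)
  have cardr: "(real p + 100)\<^sup>2 \<le> real (card (A p))" for p
    using card[of p] by (metis of_nat_add of_nat_le_iff of_nat_numeral of_nat_power)
  have lim_card: "filterlim (\<lambda>p. real (card (A p))) at_top sequentially"
    by (rule filterlim_at_top_mono[of "\<lambda>p. (real p + 100)\<^sup>2"]) (real_asymp, simp add: cardr)
  have r0: "r \<longlonglongrightarrow> 0" unfolding r_def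
    using filterlim_compose[OF _ lim_card, of "\<lambda>x. x powr (-1/3)" "nhds 0"] by (simp add: tendsto_neg_powr filterlim_ident)
  have \<tau>0: "\<tau> \<longlonglongrightarrow> 0" unfolding \<tau>_def by real_asymp
  have rpos: "r p > 0" for p
  proof -
    have "card (A p) \<noteq> 0" using card[of p] by (cases "card (A p)") auto
    then show ?thesis by (simp add: r_def)
  qed
  have r2: "real (card (A p)) powr (2/3) * (r p)\<^sup>2 = 1" for p
    using rpos[of p] unfolding r_def by (simp add: powr_power powr_add[symmetric])
  have J: "\<bar>real (J p) * (r p)\<^sup>2 - \<eta> / 2\<bar> \<le> (r p)\<^sup>2" for p
  proof -
    have "\<bar>real (J p) - \<eta> / 2 * card (A p) powr (2/3)\<bar> \<le> 1" using P[of p] by (auto simp: P_def)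
    then have "\<bar>real (J p) - \<eta> / 2 * card (A p) powr (2/3)\<bar> * (r p)\<^sup>2 \<le> 1 * (r p)\<^sup>2" by (rule mult_right_mono) simp
    then have "\<bar>(real (J p) - \<eta> / 2 * card (A p) powr (2/3)) * (r p)\<^sup>2\<bar> \<le> (r p)\<^sup>2" by (simp add: abs_mult)
    moreover have "(real (J p) - \<eta> / 2 * card (A p) powr (2/3)) * (r p)\<^sup>2 = real (J p) * (r p)\<^sup>2 - \<eta> / 2"
      using r2[of p] by (simp add: algebra_simps)
    ultimately show ?thesis by simp
  qed
  \<comment> \<open>\<open>J\<close> steps of variance 1/2, scaled by \<open>r^2\<close>, have a
    variance tending to \<open>\<eta> / 4\<close>, the square of
    \<open>sqrt \<eta> / 2\<close>.\<close>
  have Jlim: "(\<lambda>p. real (J p) * (r p)\<^sup>2) \<longlonglongrightarrow> \<eta> / 2"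
  proof (rule LIM_zero_cancel, rule Lim_null_comparison)
    show "\<forall>\<^sub>F p in sequentially. norm (real (J p) * (r p)\<^sup>2 - \<eta> / 2) \<le> (r p)\<^sup>2" using J by simp
    show "(\<lambda>p. (r p)\<^sup>2) \<longlonglongrightarrow> 0" using tendsto_power[OF r0, of 2] by simp
  qed
  define X where "X p xs = r p * (cyclic_shift.bw (A p) (S0 p) * cyclic_shift.mart (A p) (s p) (S p \<union> set (take (J p) xs))
            - cyclic_shift.bw (A p) (S0 p) * cyclic_shift.mart (A p) (s p) (S p))" for p xs
  define \<mu> where "\<mu> p = distr (measure_pmf (pmf_of_set (perms (A p - S p)))) borel (X p)" for p
  have fin: "finite (perms (A p - S p))" "perms (A p - S p) \<noteq> {}" for p
    using P[of p] by (auto simp: P_def cyclic_shift_def)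
  have "\<forall>\<^sub>F p in sequentially. \<forall>F. bounded_lipschitz F \<longrightarrow> \<bar>(\<integral>x. F x \<partial>\<mu> p) - (\<integral>x. F x \<partial>gauss (sqrt \<eta> / 2))\<bar> \<le> e"
  proof (rule char_conv_imp_bounded_lipschitz_conv[OF _ real_distribution_gauss _ e])
    show "real_distribution (\<mu> p)" for p
      unfolding \<mu>_def by (rule prob_space.real_distribution_distr) (auto simp: measure_pmf.prob_space_axioms)
    fix t
    have bound: "cmod (char (\<mu> p) t - complex_of_real (exp (- (t\<^sup>2 / 4 * (real (J p) * (r p)\<^sup>2)))))
        \<le> (real (J p) * (r p)\<^sup>2) * (11 * \<bar>t\<bar> ^ 3 * r p + t ^ 4 / 16 * (r p)\<^sup>2 + t\<^sup>2 * 25 * \<tau> p)" for p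
    proof -
      interpret cyclic_shift "A p" "s p" using P[of p] by (simp add: P_def)
      have 1: "char (\<mu> p) t = avg (perms (A p - S p)) (\<lambda>xs. iexp (t * r p *
          (bw (S0 p) * mart (S p \<union> set (take (J p) xs)) - bw (S0 p) * mart (S p))))"
        unfolding \<mu>_def char_avg[OF fin] X_def by (simp add: mult.assoc)
      have cc: "100 \<le> real p + 100" by simp
      then have c100: "100 * 1 \<le> (real p + 100) * (real p + 100)" by (intro mult_mono) auto
      have "cmod (char (\<mu> p) t - complex_of_real (exp (- ((t * r p)\<^sup>2 / 4))) ^ J p)
         \<le> real (J p) * (11 * \<bar>t * r p\<bar> ^ 3 + (t * r p) ^ 4 / 16 + (t * r p)\<^sup>2 * (50 * \<tau> p) / 2)"
        unfolding 1
      proof (rule iexp_mart_block_typical)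
        show "typical (\<tau> p) (S0 p)" "S0 p \<subseteq> S p" "S p \<subseteq> A p"
          "real (card (S p) + J p) \<le> card (S0 p) + \<tau> p * card (A p)"
          using P[of p] by (auto simp: P_def \<tau>_def)
        show "\<tau> p \<le> 1 / 100" by (simp add: \<tau>_def field_simps)
        show "100 \<le> card (A p)" using cardr[of p] c100 by (simp add: power2_eq_square)
        have "real p + 100 \<le> (real p + 100)\<^sup>2" by (simp add: power2_eq_square algebra_simps)
        then show "1 \<le> \<tau> p * card (A p)" using cardr[of p] by (simp add: \<tau>_def field_simps)
      qed
      also have "real (J p) * (11 * \<bar>t * r p\<bar> ^ 3 + (t * r p) ^ 4 / 16 + (t * r p)\<^sup>2 * (50 * \<tau> p) / 2)
         = (real (J p) * (r p)\<^sup>2) * (11 * \<bar>t\<bar> ^ 3 * r p + t ^ 4 / 16 * (r p)\<^sup>2 + t\<^sup>2 * 25 * \<tau> p)"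
        using rpos[of p] by (simp add: abs_mult power_mult_distrib algebra_simps power2_eq_square power3_eq_cube power4_eq_xxxx)
      also have "complex_of_real (exp (- ((t * r p)\<^sup>2 / 4))) ^ J p = complex_of_real (exp (- (t\<^sup>2 / 4 * (real (J p) * (r p)\<^sup>2))))"
        unfolding of_real_power[symmetric] exp_of_nat_mult[symmetric] by (simp add: power_mult_distrib mult_ac)
      finally show ?thesis .
    qed
    have "(\<lambda>p. char (\<mu> p) t - complex_of_real (exp (- (t\<^sup>2 / 4 * (real (J p) * (r p)\<^sup>2))))) \<longlonglongrightarrow> 0"
    proof (rule Lim_null_comparison)
      show "\<forall>\<^sub>F p in sequentially. norm (char (\<mu> p) t - complex_of_real (exp (- (t\<^sup>2 / 4 * (real (J p) * (r p)\<^sup>2)))))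
        \<le> (real (J p) * (r p)\<^sup>2) * (11 * \<bar>t\<bar> ^ 3 * r p + t ^ 4 / 16 * (r p)\<^sup>2 + t\<^sup>2 * 25 * \<tau> p)"
        using bound by simp
      have "(\<lambda>p. (real (J p) * (r p)\<^sup>2) * (11 * \<bar>t\<bar> ^ 3 * r p + t ^ 4 / 16 * (r p)\<^sup>2 + t\<^sup>2 * 25 * \<tau> p))
         \<longlonglongrightarrow> (\<eta> / 2) * (11 * \<bar>t\<bar> ^ 3 * 0 + t ^ 4 / 16 * 0\<^sup>2 + t\<^sup>2 * 25 * 0)"
        by (intro tendsto_intros Jlim r0 \<tau>0)
      then show "(\<lambda>p. (real (J p) * (r p)\<^sup>2) * (11 * \<bar>t\<bar> ^ 3 * r p + t ^ 4 / 16 * (r p)\<^sup>2 + t\<^sup>2 * 25 * \<tau> p)) \<longlonglongrightarrow> 0" by simp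
    qed
    moreover have "(\<lambda>p. complex_of_real (exp (- (t\<^sup>2 / 4 * (real (J p) * (r p)\<^sup>2))))) \<longlonglongrightarrow> complex_of_real (exp (- (t\<^sup>2 / 4 * (\<eta> / 2))))"
      by (intro tendsto_intros Jlim)
    ultimately have "(\<lambda>p. char (\<mu> p) t) \<longlonglongrightarrow> 0 + complex_of_real (exp (- (t\<^sup>2 / 4 * (\<eta> / 2))))"
      using tendsto_add by fastforce
    moreover have "char (gauss (sqrt \<eta> / 2)) t = complex_of_real (exp (- (t\<^sup>2 / 4 * (\<eta> / 2))))"
      using \<eta> unfolding char_gauss by (simp add: power_mult_distrib power_divide mult_ac)
    ultimately show "(\<lambda>p. char (\<mu> p) t) \<longlonglongrightarrow> char (gauss (sqrt \<eta> / 2)) t" by simp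
  qed
  then obtain p where "\<forall>F. bounded_lipschitz F \<longrightarrow> \<bar>(\<integral>x. F x \<partial>\<mu> p) - (\<integral>x. F x \<partial>gauss (sqrt \<eta> / 2))\<bar> \<le> e"
    by (auto simp: eventually_sequentially)
  moreover have "bounded_lipschitz (F p)" using P[of p] by (simp add: P_def)
  moreover have "(\<integral>x. F p x \<partial>\<mu> p) = avg (perms (A p - S p)) (\<lambda>xs. F p (X p xs))"
    unfolding \<mu>_def using bounded_lipschitz_measurable[OF \<open>bounded_lipschitz (F p)\<close>]
    by (subst integral_distr) (auto simp: integral_pmf_of_set_avg[OF fin])
  ultimately have "\<bar>avg (perms (A p - S p)) (\<lambda>xs. F p (X p xs)) - (\<integral>x. F p x \<partial>gauss (sqrt \<eta> / 2))\<bar> \<le> e" by metis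
  then show False using P[of p] unfolding P_def X_def r_def by blast
qed

subsection \<open>Maxima over a grid\<close>

text \<open>\<open>r\<close> is the running maximum, \<open>S\<close> the current set and
  \<open>xs\<close> what remains of the filling order. The recursion has the shape of
  \<open>gauss_max\<close> below, so that the two can be compared block by block.\<close>

fun grid_max :: "nat \<Rightarrow> ('a set \<Rightarrow> real) \<Rightarrow> real list \<Rightarrow> real \<Rightarrow> 'a set \<Rightarrow> 'a list \<Rightarrow> real" where
  "grid_max J f [] r S xs = r"
| "grid_max J f (d # ds) r S xs =
     grid_max J f ds (max r (f (S \<union> set (take J xs)) + d)) (S \<union> set (take J xs)) (drop J xs)"

text \<open>Upper bounds describe the maximum without unfolding the recursion; the block ends become
  the times \<open>J\<close>, \<open>2 J\<close> and so on, counted from \<open>S\<close>.\<close>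

lemma grid_max_le_iff:
  "grid_max J f ds r S xs \<le> c \<longleftrightarrow> r \<le> c \<and> (\<forall>i<length ds. f (S \<union> set (take (Suc i * J) xs)) + ds ! i \<le> c)"
proof (induction ds arbitrary: r S xs)
  case (Cons d ds)
  have t: "S \<union> set (take J xs) \<union> set (take (Suc i * J) (drop J xs)) = S \<union> set (take (Suc (Suc i) * J) xs)" for i
    by (simp add: take_add Un_assoc)
  show ?case
    unfolding grid_max.simps Cons.IH t by (auto simp: less_Suc_eq_0_disj)
qed simp

text \<open>Backward recursion: \<open>x\<close> is the current position of a Gaussian random walk, \<open>r\<close> the maximum reached so
  far, and the list contains the offsets to be added at the remaining times.\<close>
fun gauss_max :: "real \<Rightarrow> (real \<Rightarrow> real) \<Rightarrow> real list \<Rightarrow> real \<Rightarrow> real \<Rightarrow> real" where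
  "gauss_max \<sigma> F [] x r = F r"
| "gauss_max \<sigma> F (d # ds) x r = (\<integral>z. gauss_max \<sigma> F ds (x + z) (max r (x + z + d)) \<partial>gauss \<sigma>)"

text \<open>In the maximum norm the map from \<open>(x, r)\<close> to
  \<open>(x + z, max r (x + z + d))\<close> is nonexpansive, so the constant stays 1 through any
  number of steps; in the sum norm it would not.\<close>

lemma gauss_max_bounded_lipschitz:
  assumes F: "bounded_lipschitz F"
  shows "\<bar>gauss_max \<sigma> F ds x r\<bar> \<le> 1 \<and>
    \<bar>gauss_max \<sigma> F ds x r - gauss_max \<sigma> F ds x' r'\<bar> \<le> max \<bar>x - x'\<bar> \<bar>r - r'\<bar>"
proof (induction ds arbitrary: x r x' r')
  case Nil
  then show ?case using bounded_lipschitzD[OF F] by (simp add: max.coboundedI2)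
next
  case (Cons d ds)
  interpret prob_space "gauss \<sigma>" by (rule prob_space_gauss)
  define H where "H x r z = gauss_max \<sigma> F ds (x + z) (max r (x + z + d))" for x r z
  have H1: "\<bar>H x r z\<bar> \<le> 1" for x r z unfolding H_def using Cons by blast
  have H2: "\<bar>H x r z - H x' r' z'\<bar> \<le> max \<bar>(x + z) - (x' + z')\<bar> \<bar>r - r'\<bar>" for x r z x' r' z'
  proof -
    have "\<bar>H x r z - H x' r' z'\<bar> \<le> max \<bar>(x + z) - (x' + z')\<bar> \<bar>max r (x + z + d) - max r' (x' + z' + d)\<bar>"
      unfolding H_def using Cons by blast
    then show ?thesis by (auto simp: max_def abs_if split: if_splits)
  qed
  have BL: "bounded_lipschitz (H x r)" for x r
    using H1[of x r] H2[of x r _ x r] by (auto simp: bounded_lipschitz_def)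
  note int = integrable_bounded_lipschitz[OF BL, of "\<lambda>x. x"]
  have int: "integrable (gauss \<sigma>) (H x r)" for x r using int by simp
  have "\<bar>expectation (H x r)\<bar> \<le> expectation (\<lambda>_. 1)"
    by (rule order_trans[OF integral_abs_bound], rule integral_mono) (auto intro!: integrable_abs int H1)
  moreover have "\<bar>expectation (H x r) - expectation (H x' r')\<bar> \<le> expectation (\<lambda>_. max \<bar>x - x'\<bar> \<bar>r - r'\<bar>)"
    unfolding Bochner_Integration.integral_diff[OF int int, symmetric]
  proof (rule order_trans[OF integral_abs_bound], rule integral_mono)
    show "\<bar>H x r z - H x' r' z\<bar> \<le> max \<bar>x - x'\<bar> \<bar>r - r'\<bar>" for z using H2[of x r z x' r' z] by simp
  qed (auto intro!: integrable_abs int Bochner_Integration.integrable_diff)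
  ultimately show ?case unfolding gauss_max.simps H_def by (simp add: prob_space)
qed

text \<open>The step \<open>z\<close> moves both arguments at once, and the maximum norm again gives
  constant 1. So the tail of the recursion is itself an admissible test function for the next
  block.\<close>

lemma gauss_max_step_bounded_lipschitz:
  assumes F: "bounded_lipschitz F"
  shows "bounded_lipschitz (\<lambda>z. gauss_max \<sigma> F ds (x + z) (max r (x + z + d)))"
proof -
  have "\<bar>gauss_max \<sigma> F ds (x + z) (max r (x + z + d)) - gauss_max \<sigma> F ds (x + z') (max r (x + z' + d))\<bar> \<le> \<bar>z - z'\<bar>" for z z'
    using gauss_max_bounded_lipschitz[OF F, of \<sigma> ds "x + z" "max r (x + z + d)" "x + z'" "max r (x + z' + d)"]
    by (auto simp: max_def abs_if split: if_splits)
  then show ?thesis using gauss_max_bounded_lipschitz[OF F] by (auto simp: bounded_lipschitz_def)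
qed

text \<open>Backward induction: the tail is replaced by \<open>gauss_max\<close>, then the first
  block by its Gaussian step, at a cost \<open>e\<close> per block. \<open>block\<close> is assumed
  for all test functions because the one applied, built from \<open>gauss_max\<close>, changes with
  the configuration and with \<open>r\<close>.\<close>

lemma grid_max_approx:
  fixes e :: real
  assumes A: "finite A" and F: "bounded_lipschitz F"
    and block: "\<And>S H. S0 \<subseteq> S \<Longrightarrow> S \<subseteq> A \<Longrightarrow> card S + J \<le> m \<Longrightarrow> bounded_lipschitz H \<Longrightarrow>
       \<bar>avg (perms (A - S)) (\<lambda>xs. H (f (S \<union> set (take J xs)) - f S)) - (\<integral>z. H z \<partial>gauss \<sigma>)\<bar> \<le> e"
    and m: "m \<le> card A" and S: "S0 \<subseteq> S" "S \<subseteq> A" "card S + length ds * J \<le> m"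
  shows "\<bar>avg (perms (A - S)) (\<lambda>xs. F (grid_max J f ds r S xs)) - gauss_max \<sigma> F ds (f S) r\<bar> \<le> length ds * e"
  using S
proof (induction ds arbitrary: r S)
  case Nil
  then show ?case using A by (simp add: avg_const)
next
  case (Cons d ds)
  define X where "X = subsets_of_card (A - S) J"
  define H where "H z = gauss_max \<sigma> F ds (f S + z) (max r (f S + z + d))" for z
  have fin: "finite (A - S)" using A by auto
  have J: "J \<le> card (A - S)" using Cons.prems m A by (simp add: card_Diff_subset finite_subset)
  have X: "finite X" "X \<noteq> {}" unfolding X_def using fin J by (auto simp: finite_subsets_of_card subsets_of_card_nonempty)
  have T: "T \<subseteq> A - S" "card T = J" "finite T" if "T \<in> X" for T
    using that fin finite_subset by (auto simp: X_def subsets_of_card_def)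
  \<comment> \<open>After the first block the future depends on it only through the set
    \<open>T\<close>, not through the order in which \<open>T\<close> was filled.\<close>
  define G where "G T = avg (perms (A - (S \<union> T))) (\<lambda>zs. F (grid_max J f ds (max r (f (S \<union> T) + d)) (S \<union> T) zs))" for T
  have pT: "finite (perms T)" "perms T \<noteq> {}" if "T \<in> X" for T using T[OF that] by auto
  have eq1: "avg (perms (A - S)) (\<lambda>xs. F (grid_max J f (d # ds) r S xs)) = avg X G"
    unfolding avg_perms_split[OF fin J] X_def[symmetric]
  proof (rule avg_cong)
    fix T assume T': "T \<in> X"
    have D: "A - S - T = A - (S \<union> T)" by auto
    have "avg (perms T) (\<lambda>ys. avg (perms (A - S - T)) (\<lambda>zs. F (grid_max J f (d # ds) r S (ys @ zs)))) = avg (perms T) (\<lambda>ys. G T)"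
    proof (rule avg_cong)
      fix ys assume ys: "ys \<in> perms T"
      have "length ys = J" "set ys = T" using length_perms[OF ys] T[OF T'] ys by (auto simp: permutations_of_set_def)
      then show "avg (perms (A - S - T)) (\<lambda>zs. F (grid_max J f (d # ds) r S (ys @ zs))) = G T"
        unfolding G_def by (simp add: D)
    qed simp
    then show "avg (perms T) (\<lambda>ys. avg (perms (A - S - T)) (\<lambda>zs. F (grid_max J f (d # ds) r S (ys @ zs)))) = G T"
      using avg_const[OF pT[OF T']] by simp
  qed simp
  have eq2: "avg (perms (A - S)) (\<lambda>xs. H (f (S \<union> set (take J xs)) - f S)) = avg X (\<lambda>T. H (f (S \<union> T) - f S))"
    unfolding avg_perms_split[OF fin J] X_def[symmetric]
  proof (rule avg_cong)
    fix T assume T': "T \<in> X"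
    have "avg (perms T) (\<lambda>ys. avg (perms (A - S - T)) (\<lambda>zs. H (f (S \<union> set (take J (ys @ zs))) - f S))) = avg (perms T) (\<lambda>ys. H (f (S \<union> T) - f S))"
    proof (rule avg_cong)
      fix ys assume ys: "ys \<in> perms T"
      have "length ys = J" "set ys = T" using length_perms[OF ys] T[OF T'] ys by (auto simp: permutations_of_set_def)
      then show "avg (perms (A - S - T)) (\<lambda>zs. H (f (S \<union> set (take J (ys @ zs))) - f S)) = H (f (S \<union> T) - f S)"
        using fin by (simp add: avg_const)
    qed simp
    then show "avg (perms T) (\<lambda>ys. avg (perms (A - S - T)) (\<lambda>zs. H (f (S \<union> set (take J (ys @ zs))) - f S))) = H (f (S \<union> T) - f S)"
      using avg_const[OF pT[OF T']] by simp
  qed simp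
  have "norm (avg X G - avg X (\<lambda>T. H (f (S \<union> T) - f S))) \<le> length ds * e"
  proof (rule norm_avg_diff_le[OF X])
    fix T assume T': "T \<in> X"
    have "card (S \<union> T) = card S + J"
      using T[OF T'] Cons.prems A finite_subset by (subst card_Un_disjoint) auto
    then have "\<bar>G T - gauss_max \<sigma> F ds (f (S \<union> T)) (max r (f (S \<union> T) + d))\<bar> \<le> length ds * e"
      unfolding G_def using Cons.prems T[OF T'] by (intro Cons.IH) auto
    then show "norm (G T - H (f (S \<union> T) - f S)) \<le> length ds * e" by (simp add: H_def)
  qed
  moreover have "\<bar>avg (perms (A - S)) (\<lambda>xs. H (f (S \<union> set (take J xs)) - f S)) - (\<integral>z. H z \<partial>gauss \<sigma>)\<bar> \<le> e"
    using Cons.prems unfolding H_def by (intro block gauss_max_step_bounded_lipschitz F) auto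
  moreover have "(\<integral>z. H z \<partial>gauss \<sigma>) = gauss_max \<sigma> F (d # ds) (f S) r" by (simp add: H_def)
  ultimately show ?case unfolding eq1 eq2 by (simp add: algebra_simps)
qed

section \<open>Maxima along a Gaussian random walk\<close>

fun path_max :: "(nat \<Rightarrow> real) \<Rightarrow> real list \<Rightarrow> real \<Rightarrow> nat \<Rightarrow> real" where
  "path_max g [] r k = r"
| "path_max g (d # ds) r k = path_max g ds (max r (g (Suc k) + d)) (Suc k)"

lemma path_max_le_iff:
  "path_max g ds r k \<le> c \<longleftrightarrow> r \<le> c \<and> (\<forall>i<length ds. g (Suc (k + i)) + ds ! i \<le> c)"
  by (induction ds arbitrary: r k) (auto simp: less_Suc_eq_0_disj)

lemma path_max_measurable:
  assumes g: "\<And>i. (\<lambda>\<omega>. g \<omega> i) \<in> borel_measurable M" and "r \<in> borel_measurable M"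
  shows "(\<lambda>\<omega>. path_max (g \<omega>) ds (r \<omega>) k) \<in> borel_measurable M"
  using assms(2)
proof (induction ds arbitrary: r k)
  case (Cons d ds)
  note [measurable] = g Cons.prems
  show ?case unfolding path_max.simps by (rule Cons.IH) measurable
qed simp

lemma gauss_max_measurable:
  assumes F: "bounded_lipschitz F"
  shows "(\<lambda>(x, r). gauss_max \<sigma> F ds x r) \<in> borel_measurable (borel \<Otimes>\<^sub>M borel)"
proof -
  have "1-lipschitz_on UNIV (\<lambda>(x, r). gauss_max \<sigma> F ds x r)"
  proof (rule lipschitz_onI)
    fix p q :: "real \<times> real"
    obtain x r x' r' where pq: "p = (x, r)" "q = (x', r')" by fastforce
    have "max \<bar>x - x'\<bar> \<bar>r - r'\<bar> \<le> dist p q"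
      using dist_fst_le[of p q] dist_snd_le[of p q] by (simp add: pq dist_real_def)
    then show "dist (case p of (x, r) \<Rightarrow> gauss_max \<sigma> F ds x r) (case q of (x, r) \<Rightarrow> gauss_max \<sigma> F ds x r) \<le> 1 * dist p q"
      using order_trans[OF conjunct2[OF gauss_max_bounded_lipschitz[OF F, of \<sigma> ds x r x' r']]]
      by (simp add: pq dist_real_def)
  qed simp
  then have "(\<lambda>(x, r). gauss_max \<sigma> F ds x r) \<in> borel_measurable borel"
    by (intro borel_measurable_continuous_onI lipschitz_on_continuous_on)
  then show ?thesis by (simp only: borel_prod)
qed

context prob_space
begin

text \<open>\<open>gauss_max\<close> is the conditional expectation of the final value given the
  walk so far. The running maximum enters as an arbitrary measurable function \<open>R\<close> of
  the first \<open>k\<close> increments, which is the generality that the induction needs.\<close>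

lemma expectation_path_max:
  fixes Z :: "nat \<Rightarrow> 'a \<Rightarrow> real"
  assumes F: "bounded_lipschitz F" and indep: "\<And>n. indep_vars (\<lambda>_. borel) Z {..<n}"
    and law: "\<And>i. distr M borel (Z i) = gauss \<sigma>"
    and R: "R \<in> borel_measurable (PiM {..<k} (\<lambda>_. borel))"
  shows "expectation (\<lambda>\<omega>. F (path_max (\<lambda>j. \<Sum>i<j. Z i \<omega>) ds (R (\<lambda>i\<in>{..<k}. Z i \<omega>)) k))
       = expectation (\<lambda>\<omega>. gauss_max \<sigma> F ds (\<Sum>i<k. Z i \<omega>) (R (\<lambda>i\<in>{..<k}. Z i \<omega>)))"
  using R
proof (induction ds arbitrary: k R)
  case Nil
  then show ?case by simp
next
  case (Cons d ds)
  note R [measurable] = Cons.prems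
  define P where "P = PiM {..<k} (\<lambda>_. borel :: real measure)"
  define U where "U \<omega> = (\<lambda>i\<in>{..<k}. Z i \<omega>)" for \<omega>
  \<comment> \<open>The updated running maximum, read off from \<open>k + 1\<close> increments;
    restriction to \<open>{..<k}\<close> recovers the old argument of \<open>R\<close>.\<close>
  define R' where "R' u = max (R (restrict u {..<k})) ((\<Sum>i<Suc k. u i) + d)" for u
  have R': "R' \<in> borel_measurable (PiM {..<Suc k} (\<lambda>_. borel))"
  proof -
    have "(\<lambda>u. restrict u {..<k}) \<in> measurable (PiM {..<Suc k} (\<lambda>_. borel)) (PiM {..<k} (\<lambda>_. borel :: real measure))"
      by (rule measurable_restrict_subset) auto
    from measurable_compose[OF this R] show ?thesis unfolding R'_def by measurable
  qed
  have R'_eq: "R' (\<lambda>i\<in>{..<Suc k}. Z i \<omega>) = max (R (U \<omega>)) ((\<Sum>i<Suc k. Z i \<omega>) + d)" for \<omega>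
  proof -
    have "restrict (\<lambda>i\<in>{..<Suc k}. Z i \<omega>) {..<k} = U \<omega>" by (auto simp: U_def restrict_def)
    moreover have "(\<Sum>j<Suc k. (\<lambda>i\<in>{..<Suc k}. Z i \<omega>) j) = (\<Sum>j<Suc k. Z j \<omega>)" by (rule sum.cong) auto
    ultimately show ?thesis unfolding R'_def by (simp only:)
  qed
  define h where "h = (\<lambda>(u, z). gauss_max \<sigma> F ds ((\<Sum>i<k. u i) + z) (max (R u) ((\<Sum>i<k. u i) + z + d)))"
  define Q where "Q = PiM {k} (\<lambda>_. borel :: real measure)"
  define V where "V \<omega> = (\<lambda>i\<in>{k}. Z i \<omega>)" for \<omega>
  \<comment> \<open>The next increment is packed as a function on \<open>{k}\<close>, the form in
    which \<open>indep_var_restrict\<close> separates it from the first \<open>k\<close>.\<close>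
  have "indep_var P U Q V"
    unfolding P_def U_def[abs_def] Q_def V_def[abs_def] by (rule indep_var_restrict[OF indep[of "Suc k"]]) auto
  then have [measurable]: "U \<in> measurable M P" "V \<in> measurable M Q"
    and joint: "distr M P U \<Otimes>\<^sub>M distr M Q V = distr M (P \<Otimes>\<^sub>M Q) (\<lambda>\<omega>. (U \<omega>, V \<omega>))"
    unfolding indep_var_distribution_eq by blast+
  have comp [measurable]: "(\<lambda>v. v k) \<in> borel_measurable Q" unfolding Q_def by (rule measurable_component_singleton) simp
  have h [measurable]: "h \<in> borel_measurable (P \<Otimes>\<^sub>M borel)"
  proof -
    have [measurable]: "R \<in> borel_measurable P" using R by (simp add: P_def)
    have [measurable]: "(\<lambda>u. \<Sum>i<k. u i) \<in> borel_measurable P" unfolding P_def by measurable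
    have "(\<lambda>p. (((\<Sum>i<k. fst p i) + snd p), max (R (fst p)) ((\<Sum>i<k. fst p i) + snd p + d))) \<in> measurable (P \<Otimes>\<^sub>M borel) (borel \<Otimes>\<^sub>M borel)"
      by measurable
    from measurable_compose[OF this gauss_max_measurable[OF F, of \<sigma> ds]]
    show ?thesis unfolding h_def by (simp add: case_prod_beta)
  qed
  have h1: "\<bar>h p\<bar> \<le> 1" for p using gauss_max_bounded_lipschitz[OF F] by (auto simp: h_def split: prod.split)
  interpret U: prob_space "distr M P U" by (rule prob_space_distr) measurable
  interpret G: prob_space "gauss \<sigma>" by (rule prob_space_gauss)
  interpret V: prob_space "distr M Q V" by (rule prob_space_distr) measurable
  interpret UV: pair_prob_space "distr M P U" "distr M Q V" ..
  have law_V: "distr (distr M Q V) borel (\<lambda>v. v k) = gauss \<sigma>"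
    unfolding law[of k, symmetric] by (subst distr_distr) (auto simp: comp_def V_def intro!: distr_cong)
  have "expectation (\<lambda>\<omega>. F (path_max (\<lambda>j. \<Sum>i<j. Z i \<omega>) (d # ds) (R (U \<omega>)) k))
     = expectation (\<lambda>\<omega>. F (path_max (\<lambda>j. \<Sum>i<j. Z i \<omega>) ds (R' (\<lambda>i\<in>{..<Suc k}. Z i \<omega>)) (Suc k)))"
    unfolding R'_eq by simp
  also have "\<dots> = expectation (\<lambda>\<omega>. gauss_max \<sigma> F ds (\<Sum>i<Suc k. Z i \<omega>) (R' (\<lambda>i\<in>{..<Suc k}. Z i \<omega>)))"
    by (rule Cons.IH[OF R'])
  also have "\<dots> = expectation (\<lambda>\<omega>. h (U \<omega>, Z k \<omega>))"
    unfolding R'_eq h_def by (simp add: U_def)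
  also have "\<dots> = expectation (\<lambda>\<omega>. h (fst (U \<omega>, V \<omega>), snd (U \<omega>, V \<omega>) k))"
    by (simp add: V_def)
  also have "\<dots> = (\<integral>p. h (fst p, snd p k) \<partial>(distr M P U \<Otimes>\<^sub>M distr M Q V))"
    unfolding joint by (rule integral_distr[symmetric]) measurable
  also have "\<dots> = (\<integral>u. (\<integral>v. h (fst (u, v), snd (u, v) k) \<partial>distr M Q V) \<partial>distr M P U)"
  proof (rule UV.integral_fst'[symmetric])
    have sets: "sets (distr M P U \<Otimes>\<^sub>M distr M Q V) = sets (P \<Otimes>\<^sub>M Q)" by (intro sets_pair_measure_cong) auto
    have "(\<lambda>p. h (fst p, snd p k)) \<in> borel_measurable (P \<Otimes>\<^sub>M Q)" by measurable
    then have "(\<lambda>p. h (fst p, snd p k)) \<in> borel_measurable (distr M P U \<Otimes>\<^sub>M distr M Q V)"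
      by (simp only: measurable_cong_sets[OF sets refl])
    then show "integrable (distr M P U \<Otimes>\<^sub>M distr M Q V) (\<lambda>p. h (fst p, snd p k))"
      by (intro UV.integrable_const_bound[of _ 1]) (auto simp: h1)
  qed
  also have "\<dots> = (\<integral>u. (\<integral>z. h (u, z) \<partial>gauss \<sigma>) \<partial>distr M P U)"
  proof (rule Bochner_Integration.integral_cong[OF refl])
    fix u assume "u \<in> space (distr M P U)"
    then have u: "u \<in> space P" by simp
    have "(\<lambda>z. h (u, z)) \<in> borel_measurable borel" by (rule measurable_Pair2[OF h u])
    then show "(\<integral>v. h (fst (u, v), snd (u, v) k) \<partial>distr M Q V) = (\<integral>z. h (u, z) \<partial>gauss \<sigma>)"
      unfolding law_V[symmetric] by (subst integral_distr) auto
  qed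
  also have "\<dots> = (\<integral>u. gauss_max \<sigma> F (d # ds) (\<Sum>i<k. u i) (R u) \<partial>distr M P U)"
    unfolding h_def by simp
  also have "\<dots> = expectation (\<lambda>\<omega>. gauss_max \<sigma> F (d # ds) (\<Sum>i<k. U \<omega> i) (R (U \<omega>)))"
  proof (rule integral_distr)
    have [measurable]: "R \<in> borel_measurable P" using R by (simp add: P_def)
    have [measurable]: "(\<lambda>u. \<Sum>i<k. u i) \<in> borel_measurable P" unfolding P_def by measurable
    have "(\<lambda>u. ((\<Sum>i<k. u i), R u)) \<in> measurable P (borel \<Otimes>\<^sub>M borel)" by measurable
    from measurable_compose[OF this gauss_max_measurable[OF F, of \<sigma> "d # ds"]]
    show "(\<lambda>u. gauss_max \<sigma> F (d # ds) (\<Sum>i<k. u i) (R u)) \<in> borel_measurable P" by simp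
  qed measurable
  also have "\<dots> = expectation (\<lambda>\<omega>. gauss_max \<sigma> F (d # ds) (\<Sum>i<k. Z i \<omega>) (R (U \<omega>)))"
    by (simp add: U_def)
  finally show ?case unfolding U_def .
qed

end

lemma gauss_exp:
  shows "integrable (gauss \<sigma>) (\<lambda>z. exp (l * z))" and "(\<integral>z. exp (l * z) \<partial>gauss \<sigma>) = exp (l\<^sup>2 * \<sigma>\<^sup>2 / 2)"
proof -
  define m where "m = l * \<sigma>"
  have eq: "std_normal_density z * exp (m * z) = exp (m\<^sup>2 / 2) * normal_density m 1 z" for z
    unfolding normal_density_def
    by (simp add: exp_add[symmetric] exp_diff[symmetric] field_simps power2_eq_square)
  have "integrable std_normal_distribution (\<lambda>z. exp (m * z))"
    by (subst integrable_density) (auto simp: eq)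
  then show "integrable (gauss \<sigma>) (\<lambda>z. exp (l * z))"
    unfolding gauss_def by (subst integrable_distr_eq) (auto simp: m_def mult.assoc)
  have "(\<integral>z. exp (l * z) \<partial>gauss \<sigma>) = (\<integral>z. exp (m * z) \<partial>std_normal_distribution)"
    unfolding gauss_def m_def by (subst integral_distr) (auto simp: mult.assoc)
  also have "\<dots> = (\<integral>z. std_normal_density z * exp (m * z) \<partial>lborel)"
    by (subst integral_density) auto
  also have "\<dots> = exp (m\<^sup>2 / 2)" unfolding eq by simp
  finally show "(\<integral>z. exp (l * z) \<partial>gauss \<sigma>) = exp (l\<^sup>2 * \<sigma>\<^sup>2 / 2)" by (simp add: m_def power_mult_distrib)
qed

text \<open>With \<open>l = 2 \<gamma> / \<sigma>^2\<close> the Gaussian factor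
  \<open>exp (l^2 \<sigma>^2 / 2)\<close> equals \<open>exp (l \<gamma>)\<close>, so
  \<open>exp (l (x - c))\<close> is preserved by a step during which the line rises by
  \<open>\<gamma>\<close>. This is the exponential martingale bound, read as an induction on
  \<open>gauss_max\<close>; by \<open>F0\<close>, paths that stay below the line contribute nothing
  positive.\<close>

lemma gauss_max_linear_boundary:
  assumes F: "bounded_lipschitz F" and F0: "\<And>r. r \<le> 0 \<Longrightarrow> F r \<le> 0" and \<sigma>: "\<sigma> \<noteq> 0" and \<gamma>: "0 \<le> \<gamma>"
    and r: "r \<le> 0" and ds: "\<And>i. i < length ds \<Longrightarrow> ds ! i = - (c + \<gamma> * (real i + 1))"
  shows "gauss_max \<sigma> F ds x r \<le> exp (2 * \<gamma> / \<sigma>\<^sup>2 * (x - c))"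
  using r ds
proof (induction ds arbitrary: x r c)
  case Nil
  then show ?case using F0[of r] by (auto intro: order_trans)
next
  case (Cons d ds)
  interpret prob_space "gauss \<sigma>" by (rule prob_space_gauss)
  define l where "l = 2 * \<gamma> / \<sigma>\<^sup>2"
  have l: "l \<ge> 0" using \<gamma> by (simp add: l_def)
  have d: "d = - (c + \<gamma>)" using Cons.prems(2)[of 0] by simp
  have ds': "ds ! i = - ((c + \<gamma>) + \<gamma> * (real i + 1))" if "i < length ds" for i
    using Cons.prems(2)[of "Suc i"] that by (simp add: algebra_simps)
  have le: "gauss_max \<sigma> F ds (x + z) (max r (x + z + d)) \<le> exp (l * (x - c - \<gamma>)) * exp (l * z)" for z
  proof (cases "x + z + d \<le> 0")
    case True
    then have "gauss_max \<sigma> F ds (x + z) (max r (x + z + d)) \<le> exp (2 * \<gamma> / \<sigma>\<^sup>2 * (x + z - (c + \<gamma>)))"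
      using Cons.prems(1) by (intro Cons.IH ds') auto
    also have "\<dots> = exp (l * (x - c - \<gamma>)) * exp (l * z)"
      unfolding l_def[symmetric] by (simp add: exp_add[symmetric] algebra_simps)
    finally show ?thesis .
  next
    case False
    have "gauss_max \<sigma> F ds (x + z) (max r (x + z + d)) \<le> 1"
      using gauss_max_bounded_lipschitz[OF F] by (simp add: abs_le_iff)
    also have "1 \<le> exp (l * (x + z + d))" using l False by simp
    also have "\<dots> = exp (l * (x - c - \<gamma>)) * exp (l * z)"
      by (simp add: exp_add[symmetric] d algebra_simps)
    finally show ?thesis .
  qed
  have "gauss_max \<sigma> F (d # ds) x r \<le> (\<integral>z. exp (l * (x - c - \<gamma>)) * exp (l * z) \<partial>gauss \<sigma>)"
    unfolding gauss_max.simps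
    by (rule integral_mono)
       (auto intro!: le integrable_bounded_lipschitz[OF gauss_max_step_bounded_lipschitz[OF F], of "\<lambda>x. x", simplified] gauss_exp)
  also have "\<dots> = exp (l * (x - c - \<gamma>)) * exp (l\<^sup>2 * \<sigma>\<^sup>2 / 2)" by (simp add: gauss_exp)
  also have "\<dots> = exp (l * (x - c))"
  proof -
    have "l\<^sup>2 * \<sigma>\<^sup>2 / 2 = l * \<gamma>" using \<sigma> by (simp add: l_def power2_eq_square field_simps)
    then show ?thesis by (simp add: exp_add[symmetric] algebra_simps)
  qed
  finally show ?case by (simp add: l_def)
qed

subsection \<open>Suprema of Brownian motion with parabolic drift\<close>

text \<open>On the reals \<open>Sup\<close> is defined as the \<open>LEAST\<close> upper bound, so
  equal sets of upper bounds give equal suprema even when these sets are empty. Paths with infinite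
  supremum thus need no separate treatment.\<close>

lemma Sup_eq_if_same_upper_bounds:
  fixes X Y :: "real set"
  assumes "\<And>c. (\<forall>x\<in>X. x \<le> c) \<longleftrightarrow> (\<forall>y\<in>Y. y \<le> c)"
  shows "Sup X = Sup Y"
  unfolding Sup_real_def using assms by simp

text \<open>On the measurable set \<open>B\<close> of bounded families the usual theorem applies;
  off \<open>B\<close> there is no upper bound and \<open>Sup\<close> is the fixed value
  \<open>LEAST z. False\<close>.\<close>

lemma borel_measurable_SUP_real:
  fixes F :: "'i \<Rightarrow> 'a \<Rightarrow> real"
  assumes I: "countable I" "I \<noteq> {}" and F: "\<And>i. i \<in> I \<Longrightarrow> F i \<in> borel_measurable M"
  shows "(\<lambda>x. SUP i\<in>I. F i x) \<in> borel_measurable M"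
proof -
  define B where "B = {x \<in> space M. \<exists>k::nat. \<forall>i\<in>I. F i x \<le> real k}"
  note [measurable] = F
  have B [measurable]: "B \<in> sets M" unfolding B_def using I(1) by measurable
  have bdd: "bdd_above ((\<lambda>i. F i x) ` I) \<longleftrightarrow> x \<in> B" if "x \<in> space M" for x
  proof
    assume "bdd_above ((\<lambda>i. F i x) ` I)"
    then obtain c where "\<forall>i\<in>I. F i x \<le> c" by (auto simp: bdd_above_def)
    moreover obtain k :: nat where "c \<le> real k" using real_arch_simple by blast
    ultimately have "\<forall>i\<in>I. F i x \<le> real k" by force
    then show "x \<in> B" using that by (auto simp: B_def)
  qed (auto simp: B_def bdd_above_def)
  define G where "G i x = (if x \<in> B then F i x else 0)" for i x
  have "(\<lambda>x. SUP i\<in>I. G i x) \<in> borel_measurable M"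
  proof (rule borel_measurable_cSUP[OF I(1)])
    show "G i \<in> borel_measurable M" if "i \<in> I" for i unfolding G_def[abs_def] using that by measurable
    show "bdd_above ((\<lambda>i. G i x) ` I)" if "x \<in> space M" for x
      using bdd[OF that] by (cases "x \<in> B") (auto simp: G_def bdd_above_def)
  qed
  then have "(\<lambda>x. if x \<in> B then SUP i\<in>I. G i x else (LEAST z::real. False)) \<in> borel_measurable M" by measurable
  moreover have "(if x \<in> B then SUP i\<in>I. G i x else (LEAST z::real. False)) = (SUP i\<in>I. F i x)" if "x \<in> space M" for x
  proof (cases "x \<in> B")
    case False
    then have "\<not> (\<forall>y\<in>(\<lambda>i. F i x) ` I. y \<le> z)" for z using bdd[OF that] by (meson bdd_above.I)
    then have "(\<lambda>z. \<forall>y\<in>(\<lambda>i. F i x) ` I. y \<le> z) = (\<lambda>_. False)" by (intro ext) (rule eq_False[THEN iffD2])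
    then have "(SUP i\<in>I. F i x) = (LEAST z::real. False)" by (simp only: Sup_real_def)
    then show ?thesis using False by simp
  qed (simp add: G_def)
  ultimately show ?thesis by (simp cong: measurable_cong)
qed

definition dyadic_floor :: "nat \<Rightarrow> real \<Rightarrow> real" where
  "dyadic_floor p t = real (nat \<lfloor>t * 2 ^ p\<rfloor>) / 2 ^ p"

lemma dyadic_floor_tendsto:
  assumes "0 \<le> t" shows "(\<lambda>p. dyadic_floor p t) \<longlonglongrightarrow> t"
proof (rule LIM_zero_cancel, rule Lim_null_comparison)
  have "\<bar>dyadic_floor p t - t\<bar> \<le> (1 / 2) ^ p" for p
  proof -
    have "0 \<le> \<lfloor>t * 2 ^ p\<rfloor>" using assms by simp
    then have "\<bar>real (nat \<lfloor>t * 2 ^ p\<rfloor>) - t * 2 ^ p\<bar> \<le> 1" by linarith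
    then have "\<bar>real (nat \<lfloor>t * 2 ^ p\<rfloor>) - t * 2 ^ p\<bar> / 2 ^ p \<le> 1 / 2 ^ p" by (rule divide_right_mono) simp
    then have "\<bar>(real (nat \<lfloor>t * 2 ^ p\<rfloor>) - t * 2 ^ p) / 2 ^ p\<bar> \<le> 1 / 2 ^ p" by (simp add: abs_divide)
    then show ?thesis by (simp add: dyadic_floor_def diff_divide_distrib power_divide)
  qed
  then show "\<forall>\<^sub>F p in sequentially. norm (dyadic_floor p t - t) \<le> (1 / 2) ^ p" by simp
  show "(\<lambda>p. (1 / 2) ^ p) \<longlonglongrightarrow> (0::real)" by (rule LIMSEQ_realpow_zero) auto
qed

text \<open>The grid of mesh \<open>1 / 2 ^ p\<close> reaches only up to \<open>p\<close>. As
  \<open>p\<close> grows, the mesh shrinks and the range expands, so one parameter handles both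
  limits.\<close>

lemma eventually_dyadic_floor_index:
  fixes t :: real
  assumes "0 \<le> t" shows "\<forall>\<^sub>F p in sequentially. nat \<lfloor>t * 2 ^ p\<rfloor> \<le> p * 2 ^ p"
proof -
  obtain k :: nat where k: "t \<le> real k" using real_arch_simple by blast
  have "nat \<lfloor>t * 2 ^ p\<rfloor> \<le> p * 2 ^ p" if "k \<le> p" for p
  proof -
    have "t * 2 ^ p \<le> real p * 2 ^ p" using k that by (intro mult_right_mono) auto
    then have "t * 2 ^ p \<le> real (p * 2 ^ p)" by simp
    then show ?thesis by linarith
  qed
  then show ?thesis unfolding eventually_sequentially by blast
qed

lemma le_on_rationals_imp_le:
  fixes f :: "real \<Rightarrow> real"
  assumes f: "continuous_on {0..} f" and le: "\<And>q. q \<in> \<rat> \<Longrightarrow> 0 \<le> q \<Longrightarrow> f q \<le> c" and t: "0 \<le> t"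
  shows "f t \<le> c"
proof -
  have q: "0 \<le> dyadic_floor p t" "dyadic_floor p t \<in> \<rat>" for p by (simp_all add: dyadic_floor_def)
  have "(\<lambda>p. f (dyadic_floor p t)) \<longlonglongrightarrow> f t"
    using f dyadic_floor_tendsto[OF t] t q by (auto simp: continuous_on_sequentially comp_def)
  then show ?thesis by (rule LIMSEQ_le_const2) (use le q in auto)
qed

text \<open>Over rational times the supremum is measurable with respect to the product sigma-algebra on
  paths, in which the independence of the two halves is expressed.\<close>
definition rat_sup :: "(real \<Rightarrow> real) \<Rightarrow> real" where
  "rat_sup f = (SUP q\<in>\<rat> \<inter> {0..}. f q - q\<^sup>2 / 2)"

lemma rat_sup_measurable: "rat_sup \<in> borel_measurable (PiM {0..} (\<lambda>_. borel))"
  unfolding rat_sup_def[abs_def]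
proof (rule borel_measurable_SUP_real)
  show "countable (\<rat> \<inter> {0::real..})" by (simp add: countable_rat)
  show "\<rat> \<inter> {0::real..} \<noteq> {}" by auto
  show "(\<lambda>f. f q - q\<^sup>2 / 2) \<in> borel_measurable (PiM {0..} (\<lambda>_. borel))" if "q \<in> \<rat> \<inter> {0..}" for q :: real
    using that by (intro borel_measurable_diff measurable_component_singleton) auto
qed

text \<open>The values of \<open>- t\<^sup>2 / 4\<close> on the grid of mesh \<open>1 / 2 ^ p\<close> in \<open>(0, p]\<close>, to be added to the halved path.\<close>
definition parabola_offsets :: "nat \<Rightarrow> real list" where
  "parabola_offsets p = map (\<lambda>i. - ((real i + 1) / 2 ^ p)\<^sup>2 / 4) [0..<p * 2 ^ p]"

section \<open>Suprema over one half of the Brownian motion\<close>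

context standard_brownian_motion
begin

text \<open>Halved Brownian increments over the mesh \<open>\<eta>\<close> are independent with law
  \<open>gauss (sqrt \<eta> / 2)\<close>, the limit law in \<open>block_bounded_lipschitz\<close>.
  The filling process and the Brownian path thus meet in \<open>gauss_max\<close>.\<close>

lemma path_max_law:
  assumes F: "bounded_lipschitz F" and \<eta>: "0 < \<eta>"
  shows "expectation (\<lambda>\<omega>. F (path_max (\<lambda>j. W (real j * \<eta>) \<omega> / 2) ds 0 0)) = gauss_max (sqrt \<eta> / 2) F ds 0 0"
proof -
  define D where "D i \<omega> = W (real (Suc i) * \<eta>) \<omega> - W (real i * \<eta>) \<omega>" for i \<omega>
  define Z where "Z i \<omega> = D i \<omega> / 2" for i \<omega>
  have step: "real i * \<eta> < real (Suc i) * \<eta>" for i using \<eta> by simp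
  have [measurable]: "W (real i * \<eta>) \<in> borel_measurable M" for i using \<eta> by (intro measurable_W) auto
  have "indep_vars (\<lambda>_. borel) D {..<n}" for n
    unfolding D_def[abs_def] using independent_increments[of "\<lambda>i. real i * \<eta>" n] step \<eta> by (auto simp: less_imp_le)
  then have indep: "indep_vars (\<lambda>_. borel) Z {..<n}" for n
    unfolding Z_def[abs_def] by (rule indep_vars_compose2) auto
  have law: "distr M borel (Z i) = gauss (sqrt \<eta> / 2)" for i
  proof -
    have "distributed M lborel (D i) (\<lambda>x. ennreal (normal_density 0 (sqrt \<eta>) x))"
      using gaussian_increments[of "real i * \<eta>" "real (Suc i) * \<eta>"] step[of i] \<eta>
      by (simp add: D_def[abs_def] algebra_simps)
    then have "distributed M lborel (\<lambda>\<omega>. D i \<omega> / sqrt \<eta>) (\<lambda>x. ennreal (std_normal_density x))"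
      using \<eta> by (subst (asm) normal_standard_normal_convert) auto
    then have std: "distr M lborel (\<lambda>\<omega>. D i \<omega> / sqrt \<eta>) = std_normal_distribution"
      by (rule distributed_distr_eq_density)
    have [measurable]: "D i \<in> borel_measurable M" unfolding D_def[abs_def] by measurable
    have "gauss (sqrt \<eta> / 2) = distr (distr M lborel (\<lambda>\<omega>. D i \<omega> / sqrt \<eta>)) borel ((*) (sqrt \<eta> / 2))"
      unfolding gauss_def std ..
    also have "\<dots> = distr M borel (Z i)"
      by (subst distr_distr) (use \<eta> in \<open>auto simp: comp_def Z_def intro!: distr_cong\<close>)
    finally show ?thesis ..
  qed
  have sum: "(\<Sum>i<j. Z i \<omega>) = W (real j * \<eta>) \<omega> / 2" if "\<omega> \<in> space M" for j \<omega>
    unfolding Z_def D_def sum_divide_distrib[symmetric]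
    using sum_lessThan_telescope[of "\<lambda>i. W (real i * \<eta>) \<omega>" j] starts_at_0[OF that] by simp
  have "expectation (\<lambda>\<omega>. F (path_max (\<lambda>j. \<Sum>i<j. Z i \<omega>) ds ((\<lambda>_. 0) (\<lambda>i\<in>{..<0}. Z i \<omega>)) 0))
      = expectation (\<lambda>\<omega>. gauss_max (sqrt \<eta> / 2) F ds (\<Sum>i<0. Z i \<omega>) ((\<lambda>_. 0) (\<lambda>i\<in>{..<0}. Z i \<omega>)))"
    by (rule expectation_path_max[OF F indep law]) simp
  also have "\<dots> = gauss_max (sqrt \<eta> / 2) F ds 0 0" by (simp add: prob_space)
  finally show ?thesis by (simp add: sum cong: Bochner_Integration.integral_cong)
qed

text \<open>The bound does not depend on the mesh: slope \<open>b \<eta>\<close> per step against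
  variance \<open>\<eta> / 4\<close> gives the rate \<open>8 b\<close>. The extra 1 in the boundary
  leaves room for the ramp \<open>F\<close>, which reaches 1 only at excess 1.\<close>

lemma prob_linear_boundary_dyadic:
  assumes "0 \<le> a" "0 \<le> b"
  shows "prob {\<omega> \<in> space M. \<exists>i<n. a + 1 + b * (real (Suc i) / 2 ^ p) < W (real (Suc i) / 2 ^ p) \<omega> / 2} \<le> exp (- 8 * a * b)"
proof -
  define \<eta> where "\<eta> = 1 / (2::real) ^ p"
  have \<eta>: "\<eta> > 0" by (simp add: \<eta>_def)
  define ds where "ds = map (\<lambda>i. - (a + b * \<eta> * (real i + 1))) [0..<n]"
  define F where "F x = min 1 (max 0 x)" for x :: real
  have F: "bounded_lipschitz F" by (auto simp: bounded_lipschitz_def F_def)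
  note [measurable] = bounded_lipschitz_measurable[OF F]
  define m where "m \<omega> = path_max (\<lambda>j. W (real j * \<eta>) \<omega> / 2) ds 0 0" for \<omega>
  have Wm [measurable]: "W (real i * \<eta>) \<in> borel_measurable M" for i using \<eta> by (intro measurable_W) auto
  have [measurable]: "m \<in> borel_measurable M" unfolding m_def[abs_def] by (rule path_max_measurable) auto
  have "{\<omega> \<in> space M. \<exists>i<n. a + 1 + b * (real (Suc i) / 2 ^ p) < W (real (Suc i) / 2 ^ p) \<omega> / 2} \<subseteq> {\<omega> \<in> space M. 1 \<le> F (m \<omega>)}"
  proof clarify
    fix \<omega> i assume i: "i < n" and lt: "a + 1 + b * (real (Suc i) / 2 ^ p) < W (real (Suc i) / 2 ^ p) \<omega> / 2"
    have "W (real (Suc (0 + i)) * \<eta>) \<omega> / 2 + ds ! i \<le> m \<omega>"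
      using path_max_le_iff[of "\<lambda>j. W (real j * \<eta>) \<omega> / 2" ds 0 0 "m \<omega>"] i by (auto simp: m_def ds_def)
    moreover have "ds ! i = - (a + b * (real (Suc i) / 2 ^ p))" using i by (simp add: ds_def \<eta>_def add.commute)
    moreover have e: "real (Suc (0 + i)) * \<eta> = real (Suc i) / 2 ^ p" by (simp add: \<eta>_def)
    ultimately have "1 \<le> m \<omega>" using lt unfolding e by linarith
    then show "1 \<le> F (m \<omega>)" by (simp add: F_def)
  qed
  then have "prob {\<omega> \<in> space M. \<exists>i<n. a + 1 + b * (real (Suc i) / 2 ^ p) < W (real (Suc i) / 2 ^ p) \<omega> / 2} \<le> prob {\<omega> \<in> space M. 1 \<le> F (m \<omega>)}"
    by (intro finite_measure_mono) auto
  also have "\<dots> = expectation (indicator {\<omega> \<in> space M. 1 \<le> F (m \<omega>)})"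
    by simp
  also have "\<dots> \<le> expectation (\<lambda>\<omega>. F (m \<omega>))"
  proof (rule integral_mono)
    show "integrable M (indicator {\<omega> \<in> space M. 1 \<le> F (m \<omega>)} :: _ \<Rightarrow> real)"
      by (intro integrable_const_bound[of _ 1]) auto
    show "integrable M (\<lambda>\<omega>. F (m \<omega>))" by (rule integrable_bounded_lipschitz[OF F]) measurable
  qed (auto simp: indicator_def F_def)
  also have "\<dots> = gauss_max (sqrt \<eta> / 2) F ds 0 0" unfolding m_def by (rule path_max_law[OF F \<eta>])
  also have "\<dots> \<le> exp (2 * (b * \<eta>) / (sqrt \<eta> / 2)\<^sup>2 * (0 - a))"
    by (rule gauss_max_linear_boundary[OF F]) (use \<eta> assms in \<open>auto simp: F_def ds_def\<close>)
  also have "\<dots> = exp (- 8 * a * b)" using \<eta> by (simp add: power_divide)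
  finally show ?thesis .
qed

text \<open>A path above the line \<open>k + 1 + k t\<close> at some time is, by continuity, above
  it at a point of every sufficiently fine grid, so it lies in the lower limit \<open>L k\<close> of
  the grid events. A path exceeding all these lines lies in every \<open>L k\<close>, and
  \<open>L k\<close> has probability at most \<open>exp (- 8 k^2)\<close>.\<close>

lemma AE_linear_bound: "AE \<omega> in M. \<exists>k::nat. \<forall>t\<ge>0. W t \<omega> / 2 \<le> real k + 1 + real k * t"
proof -
  define E where "E k p = {\<omega> \<in> space M. \<exists>i<p * 2 ^ p. real k + 1 + real k * (real (Suc i) / 2 ^ p) < W (real (Suc i) / 2 ^ p) \<omega> / 2}" for k p :: nat
  have [measurable]: "W (real (Suc i) / 2 ^ p) \<in> borel_measurable M" for i and p :: nat by (rule measurable_W) auto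
  have E [measurable]: "E k p \<in> sets M" for k p unfolding E_def by measurable
  define L where "L k = (\<Union>q. \<Inter>p\<in>{q..}. E k p)" for k
  have L [measurable]: "L k \<in> sets M" for k unfolding L_def by measurable
  have "prob (L k) \<le> exp (- 8 * real k * real k)" for k
  proof -
    have "(\<lambda>q. prob (\<Inter>p\<in>{q..}. E k p)) \<longlonglongrightarrow> prob (\<Union>q. \<Inter>p\<in>{q..}. E k p)"
      by (rule finite_Lim_measure_incseq) (auto simp: incseq_def)
    moreover have "prob (\<Inter>p\<in>{q..}. E k p) \<le> exp (- 8 * real k * real k)" for q
    proof -
      have "prob (\<Inter>p\<in>{q..}. E k p) \<le> prob (E k q)" by (rule finite_measure_mono) auto
      also have "\<dots> \<le> exp (- 8 * real k * real k)" unfolding E_def by (rule prob_linear_boundary_dyadic) auto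
      finally show ?thesis .
    qed
    ultimately show ?thesis unfolding L_def by (intro LIMSEQ_le_const2) auto
  qed
  then have "prob (\<Inter>k. L k) \<le> exp (- 8 * real k * real k)" for k
    using finite_measure_mono[of "\<Inter>k. L k" "L k"] order_trans by (metis INT_lower L UNIV_I)
  moreover have "(\<lambda>k. exp (- 8 * real k * real k)) \<longlonglongrightarrow> 0" by real_asymp
  ultimately have "prob (\<Inter>k. L k) \<le> 0" by (intro LIMSEQ_le_const) auto
  then have null: "(\<Inter>k. L k) \<in> null_sets M"
    by (intro null_setsI) (auto simp: emeasure_eq_measure measure_nonneg order_antisym)
  show ?thesis
  proof (rule AE_I'[OF null], clarify)
    fix \<omega> assume \<omega>: "\<omega> \<in> space M" and no: "\<not> (\<exists>k::nat. \<forall>t\<ge>0. W t \<omega> / 2 \<le> real k + 1 + real k * t)"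
    show "\<omega> \<in> L k" for k
    proof -
      from no obtain t where t: "t \<ge> 0" "real k + 1 + real k * t < W t \<omega> / 2" by (auto simp: not_le)
      define q where "q p = dyadic_floor p t" for p
      have q: "q \<longlonglongrightarrow> t" unfolding q_def by (rule dyadic_floor_tendsto[OF t(1)])
      have q0: "q p \<ge> 0" for p by (simp add: q_def dyadic_floor_def)
      have "(\<lambda>p. W (q p) \<omega>) \<longlonglongrightarrow> W t \<omega>"
        using continuous_paths[OF \<omega>] q t(1) q0 by (auto simp: continuous_on_sequentially comp_def)
      then have "(\<lambda>p. W (q p) \<omega> / 2 - (real k + 1 + real k * q p)) \<longlonglongrightarrow> W t \<omega> / 2 - (real k + 1 + real k * t)"
        by (intro tendsto_intros q) auto
      moreover have "W t \<omega> / 2 - (real k + 1 + real k * t) > 0" using t by simp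
      ultimately have "\<forall>\<^sub>F p in sequentially. 0 < W (q p) \<omega> / 2 - (real k + 1 + real k * q p)"
        by (rule order_tendstoD(1))
      then have "\<forall>\<^sub>F p in sequentially. \<omega> \<in> E k p"
        using eventually_dyadic_floor_index[OF t(1)]
      proof eventually_elim
        case (elim p)
        define j where "j = nat \<lfloor>t * 2 ^ p\<rfloor>"
        have qj: "q p = real j / 2 ^ p" by (simp add: q_def dyadic_floor_def j_def)
        \<comment> \<open>The grid events omit time 0, but there the path is 0 and hence below the
          line.\<close>
        have "j \<noteq> 0"
        proof
          assume "j = 0"
          then have "q p = 0" by (simp add: qj)
          then show False using elim(1) starts_at_0[OF \<omega>] by simp
        qed
        then obtain i where i: "j = Suc i" by (cases j) auto
        show ?case unfolding E_def using elim \<omega> i qj by (auto simp: j_def[symmetric] intro!: exI[of _ i])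
      qed
      then show ?thesis unfolding L_def eventually_sequentially by auto
    qed
  qed
qed

definition half_sup :: "'a \<Rightarrow> real" where
  "half_sup \<omega> = (SUP t\<in>{0..}. W t \<omega> - t\<^sup>2 / 2)"

lemma half_sup_eq_rat_sup:
  assumes "\<omega> \<in> space M" shows "half_sup \<omega> = rat_sup (\<lambda>t\<in>{0..}. W t \<omega>)"
proof -
  have c: "continuous_on {0..} (\<lambda>t. W t \<omega> - t\<^sup>2 / 2)"
    by (intro continuous_intros continuous_paths assms) auto
  have "half_sup \<omega> = (SUP q\<in>\<rat> \<inter> {0..}. W q \<omega> - q\<^sup>2 / 2)"
    unfolding half_sup_def
    by (rule Sup_eq_if_same_upper_bounds) (auto intro: le_on_rationals_imp_le[OF c])
  also have "\<dots> = rat_sup (\<lambda>t\<in>{0..}. W t \<omega>)" unfolding rat_sup_def by (intro SUP_cong) auto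
  finally show ?thesis .
qed

lemma paths_measurable: "(\<lambda>\<omega>. \<lambda>t\<in>{0..}. W t \<omega>) \<in> measurable M (PiM {0..} (\<lambda>_. borel))"
  by (rule measurable_restrict) (simp add: measurable_W)

lemma half_sup_measurable [measurable]: "half_sup \<in> borel_measurable M"
  using measurable_compose[OF paths_measurable rat_sup_measurable]
  by (subst measurable_cong[OF half_sup_eq_rat_sup]) auto

text \<open>The parabola overtakes any linear bound, so far times are beaten by the value 0 at time
  0, and the maximum over a compact interval is the global one.\<close>

lemma AE_half_sup_attained:
  "AE \<omega> in M. \<exists>t\<ge>0. half_sup \<omega> = W t \<omega> - t\<^sup>2 / 2 \<and> (\<forall>s\<ge>0. W s \<omega> - s\<^sup>2 / 2 \<le> half_sup \<omega>)"
  using AE_linear_bound AE_space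
proof eventually_elim
  case (elim \<omega>)
  from elim(1) obtain k :: nat where k: "\<And>t. t \<ge> 0 \<Longrightarrow> W t \<omega> / 2 \<le> real k + 1 + real k * t" by blast
  \<comment> \<open>For \<open>s \<ge> 4 k + 4\<close> one has
    \<open>s^2 / 2 \<ge> (2 k + 2) s\<close>, which is at least the bound
    \<open>2 k + 2 + 2 k s\<close> on the path.\<close>
  define K where "K = 4 * real k + 4"
  have c: "continuous_on {0..} (\<lambda>t. W t \<omega> - t\<^sup>2 / 2)"
    by (intro continuous_intros continuous_paths elim) auto
  have "\<exists>t\<in>{0..K}. \<forall>s\<in>{0..K}. W s \<omega> - s\<^sup>2 / 2 \<le> W t \<omega> - t\<^sup>2 / 2"
    by (rule continuous_attains_sup) (auto simp: K_def intro: continuous_on_subset[OF c])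
  then obtain t where t: "t \<ge> 0" "t \<le> K" and max: "\<And>s. s \<ge> 0 \<Longrightarrow> s \<le> K \<Longrightarrow> W s \<omega> - s\<^sup>2 / 2 \<le> W t \<omega> - t\<^sup>2 / 2" by auto
  have pos: "0 \<le> W t \<omega> - t\<^sup>2 / 2" using max[of 0] starts_at_0[OF elim(2)] by (simp add: K_def)
  have far: "W s \<omega> - s\<^sup>2 / 2 \<le> 0" if "s \<ge> K" for s
  proof -
    have s: "s \<ge> 4 * real k + 4" using that by (simp add: K_def)
    then have "s * (4 * real k + 4) \<le> s * s" by (intro mult_left_mono) auto
    moreover have "real k * s + s \<ge> real k + 1"
      using mult_left_mono[of 1 s "real k + 1"] s by (simp add: algebra_simps)
    ultimately show ?thesis using k[of s] s by (simp add: power2_eq_square algebra_simps)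
  qed
  have all: "W s \<omega> - s\<^sup>2 / 2 \<le> W t \<omega> - t\<^sup>2 / 2" if "s \<ge> 0" for s
    using max[OF that] far[of s] pos by (cases "s \<le> K") auto
  have "half_sup \<omega> = W t \<omega> - t\<^sup>2 / 2"
    unfolding half_sup_def by (rule cSup_eq_maximum) (use t all in auto)
  then show ?case using t all by auto
qed

text \<open>Each grid maximum is at most \<open>half_sup / 2\<close>, and the grid point just below
  a maximiser gives the matching lower bound in the limit. Dominated convergence of the truncated
  distance then covers all test functions at once.\<close>

lemma half_sup_grid_limit:
  assumes e: "0 < e"
  shows "\<forall>\<^sub>F p in sequentially. \<forall>F. bounded_lipschitz F \<longrightarrow>
    \<bar>gauss_max (sqrt (1 / 2 ^ p) / 2) F (parabola_offsets p) 0 0 - expectation (\<lambda>\<omega>. F (half_sup \<omega> / 2))\<bar> \<le> e"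
proof -
  define m where "m p \<omega> = path_max (\<lambda>j. W (real j * (1 / 2 ^ p)) \<omega> / 2) (parabola_offsets p) 0 0" for p \<omega>
  have [measurable]: "W (real i / 2 ^ p) \<in> borel_measurable M" for i and p :: nat by (rule measurable_W) auto
  have m [measurable]: "m p \<in> borel_measurable M" for p unfolding m_def[abs_def] by (rule path_max_measurable) auto
  have "AE \<omega> in M. (\<lambda>p. min \<bar>m p \<omega> - half_sup \<omega> / 2\<bar> 2) \<longlonglongrightarrow> 0"
    using AE_half_sup_attained AE_space
  proof eventually_elim
    case (elim \<omega>)
    then obtain t where t: "t \<ge> 0" "half_sup \<omega> = W t \<omega> - t\<^sup>2 / 2" and max: "\<And>s. s \<ge> 0 \<Longrightarrow> W s \<omega> - s\<^sup>2 / 2 \<le> half_sup \<omega>" by blast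
    have ub: "m p \<omega> \<le> half_sup \<omega> / 2" for p
      unfolding m_def path_max_le_iff
    proof (intro conjI allI impI)
      show "0 \<le> half_sup \<omega> / 2" using max[of 0] starts_at_0[OF elim(2)] by simp
      fix i assume i: "i < length (parabola_offsets p)"
      show "W (real (Suc (0 + i)) * (1 / 2 ^ p)) \<omega> / 2 + parabola_offsets p ! i \<le> half_sup \<omega> / 2"
        using max[of "real (Suc i) / 2 ^ p"] i by (simp add: parabola_offsets_def add.commute)
    qed
    define q where "q p = dyadic_floor p t" for p
    have q: "q \<longlonglongrightarrow> t" unfolding q_def by (rule dyadic_floor_tendsto[OF t(1)])
    have q0: "q p \<ge> 0" for p by (simp add: q_def dyadic_floor_def)
    have "(\<lambda>p. W (q p) \<omega>) \<longlonglongrightarrow> W t \<omega>"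
      using continuous_paths[OF elim(2)] q t(1) q0 by (auto simp: continuous_on_sequentially comp_def)
    then have lim: "(\<lambda>p. (W (q p) \<omega> - (q p)\<^sup>2 / 2) / 2) \<longlonglongrightarrow> half_sup \<omega> / 2"
      unfolding t(2) by (intro tendsto_intros q) auto
    have lb: "\<forall>\<^sub>F p in sequentially. (W (q p) \<omega> - (q p)\<^sup>2 / 2) / 2 \<le> m p \<omega>"
      using eventually_dyadic_floor_index[OF t(1)]
    proof eventually_elim
      case (elim p)
      define j where "j = nat \<lfloor>t * 2 ^ p\<rfloor>"
      have qj: "q p = real j / 2 ^ p" by (simp add: q_def dyadic_floor_def j_def)
      note iff = path_max_le_iff[of "\<lambda>j. W (real j * (1 / 2 ^ p)) \<omega> / 2" "parabola_offsets p" 0 0 "m p \<omega>", folded m_def]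
      show ?case
      proof (cases j)
        case 0
        then show ?thesis using iff starts_at_0[OF \<open>\<omega> \<in> space M\<close>] by (simp add: qj)
      next
        case (Suc i)
        have i: "i < p * 2 ^ p" using elim Suc by (simp add: j_def[symmetric])
        then have "W (real (Suc (0 + i)) * (1 / 2 ^ p)) \<omega> / 2 + parabola_offsets p ! i \<le> m p \<omega>"
          using iff by (auto simp: parabola_offsets_def)
        then show ?thesis using i by (simp add: qj Suc parabola_offsets_def add.commute diff_divide_distrib)
      qed
    qed
    have "(\<lambda>p. m p \<omega>) \<longlonglongrightarrow> half_sup \<omega> / 2"
      by (rule tendsto_sandwich[OF lb _ lim tendsto_const]) (use ub in auto)
    then have "(\<lambda>p. min \<bar>m p \<omega> - half_sup \<omega> / 2\<bar> 2) \<longlonglongrightarrow> min \<bar>half_sup \<omega> / 2 - half_sup \<omega> / 2\<bar> 2"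
      by (intro tendsto_intros)
    then show ?case by simp
  qed
  then have "(\<lambda>p. expectation (\<lambda>\<omega>. min \<bar>m p \<omega> - half_sup \<omega> / 2\<bar> 2)) \<longlonglongrightarrow> expectation (\<lambda>\<omega>. 0)"
    by (intro integral_dominated_convergence[where w = "\<lambda>_. 2"]) auto
  then have "\<forall>\<^sub>F p in sequentially. expectation (\<lambda>\<omega>. min \<bar>m p \<omega> - half_sup \<omega> / 2\<bar> 2) < e"
    using e by (auto dest: order_tendstoD(2))
  then show ?thesis
  proof eventually_elim
    case (elim p)
    show ?case
    proof (intro allI impI)
      fix F assume F: "bounded_lipschitz F"
      have "gauss_max (sqrt (1 / 2 ^ p) / 2) F (parabola_offsets p) 0 0 = expectation (\<lambda>\<omega>. F (m p \<omega>))"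
        unfolding m_def by (rule path_max_law[OF F, symmetric]) simp
      then show "\<bar>gauss_max (sqrt (1 / 2 ^ p) / 2) F (parabola_offsets p) 0 0 - expectation (\<lambda>\<omega>. F (half_sup \<omega> / 2))\<bar> \<le> e"
        using bounded_lipschitz_expectation_diff[OF F m[of p], of "\<lambda>\<omega>. half_sup \<omega> / 2"] elim by simp
    qed
  qed
qed

end

subsection \<open>Tail bounds and the comparison with the grid\<close>

context cyclic_shift
begin

text \<open>The increment of the martingale \<open>dev / bw\<close> between \<open>S0\<close> and \<open>S\<close>, rescaled by \<open>bw S\<close>.\<close>
definition zdev :: "'a set \<Rightarrow> 'a set \<Rightarrow> real" where
  "zdev S0 S = dev S - dev S0 / bw S0 * bw S"

definition runs_excess :: "'a set \<Rightarrow> 'a list \<Rightarrow> real" where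
  "runs_excess S xs = Max ((\<lambda>i. runs (S \<union> set (take i xs)) - runs S) ` {0..length xs})"

lemma runs_excess_le_iff:
  "runs_excess S xs \<le> c \<longleftrightarrow> (\<forall>i\<le>length xs. runs (S \<union> set (take i xs)) - runs S \<le> c)"
  unfolding runs_excess_def by (subst Max_le_iff) auto

lemma runs_excess_nonneg: "0 \<le> runs_excess S xs"
  using runs_excess_le_iff[of S xs "runs_excess S xs"] by (auto dest: spec[of _ 0])

lemma runs_excess_le_card: "runs_excess S xs \<le> card A"
  unfolding runs_excess_le_iff
proof (intro allI impI)
  fix i
  show "runs (S \<union> set (take i xs)) - runs S \<le> card A"
    using runs_le_card[of "S \<union> set (take i xs)"] runs_nonneg[of S] by linarith
qed

lemma card_fill:
  assumes "S \<subseteq> A" "xs \<in> perms (A - S)" "i \<le> length xs"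
  shows "card (S \<union> set (take i xs)) = card S + i" "S \<union> set (take i xs) \<subseteq> A"
proof -
  have d: "distinct xs" "set xs = A - S" using assms by (auto simp: permutations_of_set_def)
  have "card (S \<union> set (take i xs)) = card S + card (set (take i xs))"
    using assms(1) finite_A d set_take_subset[of i xs] by (intro card_Un_disjoint) (auto intro: finite_subset)
  then show "card (S \<union> set (take i xs)) = card S + i"
    using d assms(3) distinct_card[of "take i xs"] by simp
  show "S \<union> set (take i xs) \<subseteq> A" using assms(1) d set_take_subset[of i xs] by auto
qed

lemma linear_boundary_zdev:
  assumes S0: "S0 \<subseteq> A" "2 \<le> card (A - S0)" and \<beta>: "0 \<le> \<beta>"
  shows "avg (perms (A - S0)) (\<lambda>xs. of_bool (\<exists>i\<le>length xs. a + \<beta> * i \<le> \<bar>zdev S0 (S0 \<union> set (take i xs))\<bar>))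
         \<le> 2 * exp (- (2 * a * \<beta>))"
proof -
  have "dev S0 = dev S0 / bw S0 * bw S0" using bw_nonzero[OF S0(2)] by simp
  from linear_boundary[OF S0(1) this \<beta>] show ?thesis unfolding zdev_def .
qed

text \<open>The increment of \<open>runs\<close> is exactly \<open>zdev\<close> plus the increment
  of \<open>run_mean\<close> plus \<open>dev S0\<close> times the relative change of the weight.
  Near half filling the linear part of \<open>run_mean\<close> almost cancels and leaves
  \<open>- j^2 / n\<close>; the remaining errors are of order \<open>j / n\<close> and
  \<open>\<bar>dev S0\<bar> j / n\<close>.\<close>

lemma runs_diff_decomp:
  assumes S: "S0 \<subseteq> S" "S \<subseteq> A" and half: "\<bar>2 * real (card S0) - real (card A)\<bar> \<le> 1" and n6: "6 \<le> card A"
    and j: "j = real (card S) - real (card S0)"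
  shows "\<bar>runs S - runs S0 - (zdev S0 S - j\<^sup>2 / card A)\<bar> \<le> (4 + 8 * \<bar>dev S0\<bar>) * j / card A"
proof -
  define n h where "n = real (card A)" and "h = real (card S0)"
  define N where "N = real (card (A - S0))"
  have n: "n \<ge> 6" using n6 by (simp add: n_def)
  have N: "N = n - h" "real (card (A - S)) = N - j"
    using S card_Diff_A by (auto simp: N_def n_def h_def j)
  have half: "\<bar>2 * h - n\<bar> \<le> 1" using half by (simp add: n_def h_def)
  have j0: "0 \<le> j" using S finite_A card_mono[OF finite_subset[OF S(2) finite_A] S(1)] by (simp add: j)
  have jN: "j \<le> N" using N(2) of_nat_0_le_iff[of "card (A - S)"] by linarith
  have jn: "j \<le> n" using jN N(1) by (simp add: h_def)
  have N1: "N - 1 \<ge> n / 4" using N half n by linarith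
  have Npos: "N > 0" "N - 1 > 0" using N1 n by linarith+
  have b: "\<bar>bw S / bw S0 - 1\<bar> \<le> 8 * j / n"
  proof -
    have bw: "bw S0 = N * (N - 1)" "bw S = (N - j) * (N - j - 1)"
      unfolding bw_def N(2) N_def[symmetric] by simp_all
    define u where "u = j * (2 * N - 1 - j)"
    have "bw S / bw S0 - 1 = (bw S - bw S0) / bw S0" using Npos by (simp add: bw(1) diff_divide_distrib)
    also have "bw S - bw S0 = - u" unfolding bw u_def by (simp add: algebra_simps)
    finally have "bw S / bw S0 - 1 = - u / (N * (N - 1))" unfolding bw(1) .
    moreover have "u \<le> j * (2 * N)" "0 \<le> u"
      unfolding u_def using j0 jN Npos by (auto intro!: mult_left_mono mult_nonneg_nonneg)
    moreover from this have "u / (N * (N - 1)) \<le> j * (2 * N) / (N * (N - 1))"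
      using Npos by (intro divide_right_mono) auto
    ultimately have "\<bar>bw S / bw S0 - 1\<bar> \<le> j * (2 * N) / (N * (N - 1))"
      using Npos by (simp only: abs_divide abs_minus_cancel) simp
    also have "\<dots> = 2 * j / (N - 1)" using Npos by simp
    also have "\<dots> \<le> 2 * j / (n / 4)" using N1 n j0 by (intro divide_left_mono) auto
    finally show ?thesis by simp
  qed
  have m: "\<bar>run_mean (h + j) - run_mean h + j\<^sup>2 / n\<bar> \<le> 4 * j / n"
  proof -
    have n1: "n - 1 > 0" using n by simp
    have "run_mean (h + j) - run_mean h = (j * (n - 2 * h) - j\<^sup>2) / (n - 1)"
      unfolding run_mean_def n_def[symmetric] diff_divide_distrib[symmetric] by (simp add: algebra_simps power2_eq_square)
    moreover have "j\<^sup>2 / n = (j\<^sup>2 - j\<^sup>2 / n) / (n - 1)" using n n1 by (simp add: field_simps)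
    ultimately have "run_mean (h + j) - run_mean h + j\<^sup>2 / n = (j * (n - 2 * h) - j\<^sup>2) / (n - 1) + (j\<^sup>2 - j\<^sup>2 / n) / (n - 1)"
      by presburger
    then have eq: "run_mean (h + j) - run_mean h + j\<^sup>2 / n = (j * (n - 2 * h) - j\<^sup>2 / n) / (n - 1)"
      unfolding add_divide_distrib[symmetric] by simp
    have "\<bar>j * (n - 2 * h)\<bar> \<le> j * 1" unfolding abs_mult using j0 half by (intro mult_mono) auto
    moreover have "j\<^sup>2 / n \<le> j" using j0 jn n by (simp add: power2_eq_square divide_le_eq mult_left_mono)
    moreover have "0 \<le> j\<^sup>2 / n" using n by simp
    ultimately have "\<bar>j * (n - 2 * h) - j\<^sup>2 / n\<bar> \<le> 2 * j" by linarith
    then have "\<bar>run_mean (h + j) - run_mean h + j\<^sup>2 / n\<bar> \<le> 2 * j / (n - 1)"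
      unfolding eq using n1 by (simp add: abs_divide divide_right_mono)
    also have "\<dots> \<le> 2 * j / (n / 2)" using n j0 by (intro divide_left_mono) auto
    finally show ?thesis by simp
  qed
  have hj: "real (card S) = h + j" by (simp add: j h_def)
  have "runs S - runs S0 - (zdev S0 S - j\<^sup>2 / n)
     = (run_mean (h + j) - run_mean h + j\<^sup>2 / n) + dev S0 * (bw S / bw S0 - 1)"
  proof -
    have "runs S = dev S + run_mean (h + j)" "runs S0 = dev S0 + run_mean h" by (simp_all add: dev_def hj h_def)
    moreover have "zdev S0 S = dev S - dev S0 * (bw S / bw S0)" by (simp add: zdev_def)
    ultimately show ?thesis by (simp only:) (simp add: right_diff_distrib)
  qed
  also have "\<bar>\<dots>\<bar> \<le> 4 * j / n + \<bar>dev S0\<bar> * (8 * j / n)"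
    by (rule order_trans[OF abs_triangle_ineq]) (use mult_left_mono[OF b, of "\<bar>dev S0\<bar>"] m in \<open>simp add: abs_mult\<close>)
  also have "\<dots> = (4 + 8 * \<bar>dev S0\<bar>) * j / n" by (simp add: add_divide_distrib algebra_simps)
  finally show ?thesis by (simp add: n_def)
qed

text \<open>Half of the parabola is spent to absorb the linear error, by
  \<open>12 \<Lambda> j \<le> j^2 / 2 + 72 \<Lambda>^2\<close>.\<close>

lemma runs_diff_upper:
  assumes S: "S0 \<subseteq> S" "S \<subseteq> A" and half: "\<bar>2 * real (card S0) - real (card A)\<bar> \<le> 1" and n6: "6 \<le> card A"
    and j: "j = real (card S) - real (card S0)" and \<Lambda>: "\<bar>dev S0\<bar> \<le> \<Lambda>" "1 \<le> \<Lambda>"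
  shows "runs S - runs S0 \<le> zdev S0 S - j\<^sup>2 / (2 * card A) + 72 * \<Lambda>\<^sup>2 / card A"
proof -
  define n where "n = real (card A)"
  have n: "n > 0" using n6 by (simp add: n_def)
  have j0: "0 \<le> j" using S finite_A card_mono[OF finite_subset[OF S(2) finite_A] S(1)] by (simp add: j)
  have "runs S - runs S0 \<le> zdev S0 S - j\<^sup>2 / n + (4 + 8 * \<bar>dev S0\<bar>) * j / n"
    using runs_diff_decomp[OF S half n6 j] by (simp add: n_def)
  also have "(4 + 8 * \<bar>dev S0\<bar>) * j / n \<le> (12 * \<Lambda>) * j / n"
    using \<Lambda> j0 n by (intro divide_right_mono mult_right_mono) auto
  also have "(12 * \<Lambda>) * j / n \<le> j\<^sup>2 / (2 * n) + 72 * \<Lambda>\<^sup>2 / n"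
  proof -
    have "0 \<le> (j - 12 * \<Lambda>)\<^sup>2 / (2 * n)" using n by simp
    also have "\<dots> = j\<^sup>2 / (2 * n) + 72 * \<Lambda>\<^sup>2 / n - (12 * \<Lambda>) * j / n"
      using n by (simp add: power2_eq_square field_simps)
    finally show ?thesis by simp
  qed
  finally show ?thesis by (simp add: n_def field_simps)
qed

lemma avg_perms_event_mono:
  fixes S0 :: "'a set"
  assumes "\<And>xs. xs \<in> perms (A - S0) \<Longrightarrow> P xs \<Longrightarrow> Q xs"
    and "avg (perms (A - S0)) (\<lambda>xs. of_bool (Q xs) :: real) \<le> c"
  shows "avg (perms (A - S0)) (\<lambda>xs. of_bool (P xs) :: real) \<le> c"
  by (rule order_trans[OF avg_mono assms(2)]) (use assms(1) in auto)

text \<open>With \<open>R = n^(1/3)\<close>, the half parabola lies above its tangent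
  \<open>i / R - R / 2\<close> at \<open>i = R^2\<close>. An excess of \<open>x R\<close> thus
  forces \<open>zdev\<close> above a line of slope \<open>1 / R\<close> and intercept
  \<open>x R / 4\<close>.\<close>

lemma excess_tail:
  fixes R x \<Lambda> :: real
  assumes S0: "S0 \<subseteq> A" and half: "\<bar>2 * real (card S0) - real (card A)\<bar> \<le> 1" and n6: "6 \<le> card A"
    and \<Lambda>: "\<bar>dev S0\<bar> \<le> \<Lambda>" "1 \<le> \<Lambda>" and R: "0 < R" "R ^ 3 = card A" "72 * \<Lambda>\<^sup>2 / card A \<le> R / 8"
    and x: "1 \<le> x"
  shows "avg (perms (A - S0)) (\<lambda>xs. of_bool (x * R \<le> runs_excess S0 xs) :: real) \<le> 2 * exp (- x / 2)"
proof -
  have N: "2 \<le> card (A - S0)" using half n6 card_Diff_A[OF S0] by linarith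
  have "avg (perms (A - S0)) (\<lambda>xs. of_bool (\<exists>i\<le>length xs. x * R / 4 + 1 / R * i \<le> \<bar>zdev S0 (S0 \<union> set (take i xs))\<bar>) :: real)
     \<le> 2 * exp (- (2 * (x * R / 4) * (1 / R)))"
    by (rule linear_boundary_zdev[OF S0 N]) (use R in simp)
  also have "2 * (x * R / 4) * (1 / R) = x / 2" using R by simp
  finally have bound: "avg (perms (A - S0)) (\<lambda>xs. of_bool (\<exists>i\<le>length xs. x * R / 4 + 1 / R * i \<le> \<bar>zdev S0 (S0 \<union> set (take i xs))\<bar>) :: real)
     \<le> 2 * exp (- x / 2)" by simp
  show ?thesis
  proof (rule avg_perms_event_mono[OF _ bound])
    fix xs assume xs: "xs \<in> perms (A - S0)" and "x * R \<le> runs_excess S0 xs"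
    then obtain i where i: "i \<le> length xs" "x * R \<le> runs (S0 \<union> set (take i xs)) - runs S0"
      unfolding runs_excess_def by (subst (asm) Max_ge_iff) auto
    note c = card_fill[OF S0 xs i(1)]
    have "runs (S0 \<union> set (take i xs)) - runs S0 \<le> zdev S0 (S0 \<union> set (take i xs)) - (real i)\<^sup>2 / (2 * card A) + 72 * \<Lambda>\<^sup>2 / card A"
      by (rule runs_diff_upper[OF _ c(2) half n6 _ \<Lambda>]) (auto simp: c(1))
    moreover have "real i / R - R / 2 \<le> (real i)\<^sup>2 / (2 * card A)"
    proof -
      have "0 \<le> (real i - R\<^sup>2)\<^sup>2 / (2 * R ^ 3)" using R by simp
      also have "\<dots> = (real i)\<^sup>2 / (2 * R ^ 3) - real i / R + R / 2"
        using R(1) by (simp add: power2_eq_square power3_eq_cube field_simps)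
      finally show ?thesis using R(2) by simp
    qed
    moreover have "R \<le> x * R" using x R by simp
    moreover have "1 / R * i = real i / R" by simp
    ultimately have "x * R / 4 + 1 / R * i \<le> zdev S0 (S0 \<union> set (take i xs))" using i(2) R(1,3) by linarith
    then show "\<exists>i\<le>length xs. x * R / 4 + 1 / R * i \<le> \<bar>zdev S0 (S0 \<union> set (take i xs))\<bar>" using i(1) by force
  qed
qed

text \<open>Beyond \<open>K R^2\<close> steps the half parabola exceeds \<open>K i / (2 R)\<close>.
  One half of this is the slope of the boundary, the other is at least \<open>K^2 R / 4\<close>, of
  which at most half is lost to the error \<open>R / 8\<close>. Height times slope gives the cube of
  \<open>K\<close>.\<close>

lemma far_excess:
  fixes R K \<Lambda> :: real
  assumes S0: "S0 \<subseteq> A" and half: "\<bar>2 * real (card S0) - real (card A)\<bar> \<le> 1" and n6: "6 \<le> card A"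
    and \<Lambda>: "\<bar>dev S0\<bar> \<le> \<Lambda>" "1 \<le> \<Lambda>" and R: "0 < R" "R ^ 3 = card A" "72 * \<Lambda>\<^sup>2 / card A \<le> R / 8"
    and K: "1 \<le> K"
  shows "avg (perms (A - S0)) (\<lambda>xs. of_bool (\<exists>i\<le>length xs. K * R\<^sup>2 \<le> i \<and> 0 \<le> runs (S0 \<union> set (take i xs)) - runs S0) :: real)
    \<le> 2 * exp (- (K ^ 3 / 16))"
proof -
  have N: "2 \<le> card (A - S0)" using half n6 card_Diff_A[OF S0] by linarith
  have "avg (perms (A - S0)) (\<lambda>xs. of_bool (\<exists>i\<le>length xs. K\<^sup>2 * R / 8 + K / (4 * R) * i \<le> \<bar>zdev S0 (S0 \<union> set (take i xs))\<bar>) :: real)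
     \<le> 2 * exp (- (2 * (K\<^sup>2 * R / 8) * (K / (4 * R))))"
    by (rule linear_boundary_zdev[OF S0 N]) (use R K in simp)
  also have "2 * (K\<^sup>2 * R / 8) * (K / (4 * R)) = K ^ 3 / 16" using R by (simp add: power2_eq_square power3_eq_cube)
  finally have bound: "avg (perms (A - S0)) (\<lambda>xs. of_bool (\<exists>i\<le>length xs. K\<^sup>2 * R / 8 + K / (4 * R) * i \<le> \<bar>zdev S0 (S0 \<union> set (take i xs))\<bar>) :: real)
     \<le> 2 * exp (- (K ^ 3 / 16))" by simp
  show ?thesis
  proof (rule avg_perms_event_mono[OF _ bound])
    fix xs assume xs: "xs \<in> perms (A - S0)"
      and "\<exists>i\<le>length xs. K * R\<^sup>2 \<le> real i \<and> 0 \<le> runs (S0 \<union> set (take i xs)) - runs S0"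
    then obtain i where i: "i \<le> length xs" "K * R\<^sup>2 \<le> real i" "0 \<le> runs (S0 \<union> set (take i xs)) - runs S0" by blast
    note c = card_fill[OF S0 xs i(1)]
    have "runs (S0 \<union> set (take i xs)) - runs S0 \<le> zdev S0 (S0 \<union> set (take i xs)) - (real i)\<^sup>2 / (2 * card A) + 72 * \<Lambda>\<^sup>2 / card A"
      by (rule runs_diff_upper[OF _ c(2) half n6 _ \<Lambda>]) (auto simp: c(1))
    moreover have "K / (4 * R) * i + K\<^sup>2 * R / 4 \<le> (real i)\<^sup>2 / (2 * card A)"
    proof -
      have "K * R\<^sup>2 * i / (2 * R ^ 3) \<le> real i * i / (2 * R ^ 3)"
        using i(2) R by (intro divide_right_mono mult_right_mono) auto
      moreover have "K * R\<^sup>2 * i / (2 * R ^ 3) = K / (4 * R) * i + K / (4 * R) * i"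
        using R(1) by (simp add: power2_eq_square power3_eq_cube field_simps)
      moreover have "K / (4 * R) * (K * R\<^sup>2) \<le> K / (4 * R) * i" using i(2) R K by (intro mult_left_mono) auto
      moreover have "K / (4 * R) * (K * R\<^sup>2) = K\<^sup>2 * R / 4" using R(1) by (simp add: power2_eq_square)
      ultimately show ?thesis using R(2) by (simp add: power2_eq_square)
    qed
    moreover have "R / 8 \<le> K\<^sup>2 * R / 8" using K R by simp
    ultimately have "K\<^sup>2 * R / 8 + K / (4 * R) * i \<le> zdev S0 (S0 \<union> set (take i xs))" using i(3) R(3) by linarith
    then show "\<exists>i\<le>length xs. K\<^sup>2 * R / 8 + K / (4 * R) * i \<le> \<bar>zdev S0 (S0 \<union> set (take i xs))\<bar>" using i(1) by force
  qed
qed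

text \<open>The filling is restarted at time \<open>m\<close>, with a line that starts at
  \<open>\<epsilon> R\<close> and rises by another \<open>\<epsilon> R\<close> during the block, so
  it never exceeds \<open>2 \<epsilon> R\<close>.\<close>

lemma block_oscillation:
  fixes R \<epsilon> :: real
  assumes S0: "S0 \<subseteq> A" and m: "m + 2 \<le> card (A - S0)" and J: "0 < J" and \<epsilon>: "0 < \<epsilon>" and R: "0 < R"
  shows "avg (perms (A - S0)) (\<lambda>xs. of_bool (\<exists>l\<le>J. m + l \<le> length xs \<and>
       2 * \<epsilon> * R \<le> \<bar>zdev (S0 \<union> set (take m xs)) (S0 \<union> set (take (m + l) xs))\<bar>) :: real)
     \<le> 2 * exp (- 2 * \<epsilon>\<^sup>2 * (R\<^sup>2 / J))"
proof -
  have fin: "finite (A - S0)" using finite_A by auto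
  have "avg (perms (A - S0)) (\<lambda>xs. (\<lambda>T zs. of_bool (\<exists>l\<le>J. l \<le> length zs \<and> 2 * \<epsilon> * R \<le> \<bar>zdev (S0 \<union> T) (S0 \<union> T \<union> set (take l zs))\<bar>)) (set (take m xs)) (drop m xs))
    \<le> 2 * exp (- 2 * \<epsilon>\<^sup>2 * (R\<^sup>2 / J))"
  proof (rule avg_perms_take_drop_le[OF fin])
    show "m \<le> card (A - S0)" using m by simp
    fix T assume T: "T \<subseteq> A - S0" "card T = m"
    define S where "S = S0 \<union> T"
    have S: "S \<subseteq> A" "A - S0 - T = A - S" using S0 T by (auto simp: S_def)
    have "card (A - S) = card (A - S0) - m"
      using T fin finite_subset[OF T(1) fin] by (simp add: S(2)[symmetric] card_Diff_subset)
    then have N: "2 \<le> card (A - S)" using m by simp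
    define \<beta> where "\<beta> = \<epsilon> * R / J"
    have \<beta>: "0 \<le> \<beta>" using \<epsilon> R by (simp add: \<beta>_def)
    have "avg (perms (A - S)) (\<lambda>zs. of_bool (\<exists>l\<le>J. l \<le> length zs \<and> 2 * \<epsilon> * R \<le> \<bar>zdev S (S \<union> set (take l zs))\<bar>) :: real)
      \<le> 2 * exp (- (2 * (\<epsilon> * R) * \<beta>))"
    proof (rule avg_perms_event_mono[OF _ linear_boundary_zdev[OF S(1) N \<beta>]])
      fix zs assume "\<exists>l\<le>J. l \<le> length zs \<and> 2 * \<epsilon> * R \<le> \<bar>zdev S (S \<union> set (take l zs))\<bar>"
      then obtain l where l: "l \<le> J" "l \<le> length zs" "2 * \<epsilon> * R \<le> \<bar>zdev S (S \<union> set (take l zs))\<bar>" by blast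
      have "\<beta> * l \<le> \<beta> * J" using l \<beta> by (intro mult_left_mono) auto
      also have "\<beta> * J = \<epsilon> * R" using J by (simp add: \<beta>_def)
      finally show "\<exists>i\<le>length zs. \<epsilon> * R + \<beta> * i \<le> \<bar>zdev S (S \<union> set (take i zs))\<bar>" using l by (intro exI[of _ l]) auto
    qed
    also have "2 * (\<epsilon> * R) * \<beta> = 2 * \<epsilon>\<^sup>2 * (R\<^sup>2 / J)" by (simp add: \<beta>_def power2_eq_square)
    finally show "avg (perms (A - S0 - T)) (\<lambda>zs. of_bool (\<exists>l\<le>J. l \<le> length zs \<and> 2 * \<epsilon> * R \<le> \<bar>zdev (S0 \<union> T) (S0 \<union> T \<union> set (take l zs))\<bar>) :: real)
      \<le> 2 * exp (- 2 * \<epsilon>\<^sup>2 * (R\<^sup>2 / J))"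
      unfolding S(2) S_def[symmetric] by simp
  qed
  then show ?thesis
  proof (rule avg_perms_event_mono[rotated], goal_cases)
    case (1 xs)
    then show ?case by (auto simp: take_add Un_assoc)
  qed
qed

text \<open>A deterministic comparison on the good event described by \<open>far\<close>,
  \<open>size\<close> and \<open>osc\<close>. The \<open>4 \<epsilon>\<close> is the oscillation
  inside a block; the other three errors come from freezing the weight at \<open>S0\<close>, from
  \<open>runs_diff_decomp\<close>, and from rounding the block length.\<close>

lemma grid_compare:
  fixes \<tau> R K \<Lambda> a \<epsilon> :: real
  assumes ty: "typical \<tau> S0" and n: "100 \<le> card A" "1 \<le> \<tau> * card A" and \<tau>: "\<tau> \<le> 1 / 100"
    and \<Lambda>: "\<bar>dev S0\<bar> \<le> \<Lambda>" "1 \<le> \<Lambda>" and R: "0 < R" "R ^ 3 = card A"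
    and J: "0 < J" "real J \<le> R\<^sup>2 / (2 * 2 ^ p)" "R\<^sup>2 / (2 * 2 ^ p) - 1 \<le> real J"
    and L: "real (p * 2 ^ p * J) \<le> \<tau> * card A" and K: "K * R\<^sup>2 \<le> real (p * 2 ^ p * J)" and a: "0 < a" and \<epsilon>: "0 < \<epsilon>"
    and xs: "xs \<in> perms (A - S0)"
    and far: "\<And>i. i \<le> length xs \<Longrightarrow> K * R\<^sup>2 \<le> real i \<Longrightarrow> runs (S0 \<union> set (take i xs)) - runs S0 < 0"
    and size: "\<And>i. i \<le> length xs \<Longrightarrow> \<bar>zdev S0 (S0 \<union> set (take i xs))\<bar> < a * R + a / R * i"
    and osc: "\<And>i l. i < p * 2 ^ p \<Longrightarrow> l \<le> J \<Longrightarrow> i * J + l \<le> length xs \<Longrightarrow>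
        \<bar>zdev (S0 \<union> set (take (i * J) xs)) (S0 \<union> set (take (i * J + l) xs))\<bar> < 2 * \<epsilon> * R"
  defines "f \<equiv> \<lambda>S. (bw S0 * mart S - bw S0 * mart S0) / R"
  shows "\<bar>runs_excess S0 xs / R - grid_max J f (parabola_offsets p) 0 S0 xs\<bar>
    \<le> 4 * \<epsilon> + (5 * \<tau> * a * (1 + p) + 6 * \<Lambda> * p * R / card A + p * (p * 2 ^ p) / R\<^sup>2)"
proof -
  define G where "G = p * 2 ^ p"
  define n' where "n' = real (card A)"
  define g where "g = grid_max J f (parabola_offsets p) 0 S0 xs"
  define Si where "Si i = S0 \<union> set (take i xs)" for i
  define \<delta>1 \<delta>2 \<delta>3 where "\<delta>1 = 5 * \<tau> * a * (1 + p)" and "\<delta>2 = 6 * \<Lambda> * p * R / n'" and "\<delta>3 = p * G / R\<^sup>2"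
  have S0: "S0 \<subseteq> A" and half: "\<bar>2 * real (card S0) - real (card A)\<bar> \<le> 1" using ty by (auto simp: typical_def)
  have len: "length xs = card (A - S0)" by (rule length_perms[OF xs])
  have npos: "n' > 0" using n by (simp add: n'_def)
  have \<tau>0: "\<tau> \<ge> 0" using n by (smt (verit) mult_nonpos_nonneg of_nat_0_le_iff)
  have tn: "\<tau> * card A \<le> card A / 100" using mult_right_mono[OF \<tau>, of "real (card A)"] by simp
  have lenL: "G * J \<le> length xs"
  proof -
    have "real (G * J) \<le> card A / 100" using L tn by (simp add: G_def)
    also have "\<dots> \<le> real (length xs)" unfolding len using half card_Diff_A[OF S0] n by linarith
    finally show ?thesis by linarith
  qed
  have dnn: "\<delta>1 \<ge> 0" "\<delta>2 \<ge> 0" "\<delta>3 \<ge> 0" using \<tau>0 a \<Lambda> R npos by (auto simp: \<delta>1_def \<delta>2_def \<delta>3_def)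
  have Lp: "real (G * J) \<le> p * R\<^sup>2 / 2"
  proof -
    have "real G * real J \<le> real G * (R\<^sup>2 / (2 * 2 ^ p))" using J by (intro mult_left_mono) auto
    then show ?thesis by (simp add: G_def)
  qed
  have win: "S0 \<subseteq> Si i" "Si i \<subseteq> A" "card (Si i) = card S0 + i" "bw (Si i) > 0" "1 \<le> bw S0 / bw (Si i)" "bw S0 / bw (Si i) \<le> 1 + 5 * \<tau>"
    if "i \<le> G * J" for i
  proof -
    have i: "i \<le> length xs" using that lenL by simp
    show s: "S0 \<subseteq> Si i" "Si i \<subseteq> A" "card (Si i) = card S0 + i" using card_fill[OF S0 xs i] by (auto simp: Si_def)
    have "real i \<le> real (G * J)" using that by (simp only: of_nat_le_iff)
    then have "real i \<le> \<tau> * card A" using L unfolding G_def by (rule order_trans)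
    then have c: "real (card (Si i)) \<le> card S0 + \<tau> * card A" by (simp add: s(3))
    show "bw (Si i) > 0" "1 \<le> bw S0 / bw (Si i)" "bw S0 / bw (Si i) \<le> 1 + 5 * \<tau>"
      using weight_window[OF ty s(1,2) c n \<tau>] by auto
  qed
  have bw0: "bw S0 > 0" using win(4)[of 0] by (simp add: Si_def)
  have frac: "b0 * (d / b) - b0 * (d1 / b1) = (b0 / b) * (d - d1 / b1 * b)" if "b \<noteq> 0" for b0 b b1 d d1 :: real
    using that by (simp add: right_diff_distrib)
  have fz: "\<bar>f (Si i) - zdev S0 (Si i) / R\<bar> \<le> \<delta>1" if i: "i \<le> G * J" for i
  proof -
    note w = win[OF i]
    define W where "W = bw S0 / bw (Si i)"
    have "f (Si i) - zdev S0 (Si i) / R = (W - 1) * (zdev S0 (Si i) / R)"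
      unfolding left_diff_distrib
      unfolding f_def mart_def zdev_def W_def using w(4) by (subst frac) auto
    then have "\<bar>f (Si i) - zdev S0 (Si i) / R\<bar> = \<bar>(W - 1) * (zdev S0 (Si i) / R)\<bar>" by (rule arg_cong)
    also have "\<dots> = (W - 1) * (\<bar>zdev S0 (Si i)\<bar> / R)" using w(5) R by (simp add: abs_mult abs_divide W_def)
    also have "\<dots> \<le> (5 * \<tau>) * (a * (1 + p))"
    proof (rule mult_mono)
      have "\<bar>zdev S0 (Si i)\<bar> \<le> a * R + a / R * i" using size[of i] i lenL by (simp add: Si_def)
      also have "a / R * i \<le> a / R * (p * R\<^sup>2)"
      proof (rule mult_left_mono)
        have "real i \<le> real (G * J)" using i by (simp only: of_nat_le_iff)
        also have "\<dots> \<le> p * R\<^sup>2"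
        proof -
          have "0 \<le> real p * R\<^sup>2" by simp
          then show ?thesis using Lp by linarith
        qed
        finally show "real i \<le> p * R\<^sup>2" .
      qed (use a R in simp)
      also have "a * R + a / R * (p * R\<^sup>2) = a * (1 + p) * R" using R by (simp add: power2_eq_square field_simps)
      finally show "\<bar>zdev S0 (Si i)\<bar> / R \<le> a * (1 + p)" using R by (simp add: divide_le_eq)
    qed (use w(5,6) \<tau>0 R in \<open>auto simp: W_def\<close>)
    finally show ?thesis by (simp add: \<delta>1_def mult_ac)
  qed
  have rd: "\<bar>(runs (Si i) - runs S0) / R - (zdev S0 (Si i) / R - (i / R\<^sup>2)\<^sup>2)\<bar> \<le> \<delta>2" if i: "i \<le> G * J" for i
  proof -
    note w = win[OF i]
    have "\<bar>runs (Si i) - runs S0 - (zdev S0 (Si i) - (real i)\<^sup>2 / card A)\<bar> \<le> (4 + 8 * \<bar>dev S0\<bar>) * real i / card A"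
      by (rule runs_diff_decomp[OF w(1,2) half]) (use n w(3) in auto)
    also have "\<dots> \<le> (12 * \<Lambda>) * (p * R\<^sup>2 / 2) / card A"
    proof (intro divide_right_mono mult_mono)
      have "real i \<le> real (G * J)" using i by (simp only: of_nat_le_iff)
      then show "real i \<le> p * R\<^sup>2 / 2" using Lp by linarith
    qed (use \<Lambda> in auto)
    finally have "\<bar>runs (Si i) - runs S0 - (zdev S0 (Si i) - (real i)\<^sup>2 / card A)\<bar> / R \<le> (12 * \<Lambda>) * (p * R\<^sup>2 / 2) / card A / R"
      using R by (intro divide_right_mono) auto
    moreover have "(12 * \<Lambda>) * (p * R\<^sup>2 / 2) / card A / R = \<delta>2" using R by (simp add: \<delta>2_def n'_def power2_eq_square)
    moreover have "(real i)\<^sup>2 / card A / R = (i / R\<^sup>2)\<^sup>2"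
      unfolding R(2)[symmetric] by (simp add: power_divide power2_eq_square power3_eq_cube mult_ac)
    then have "(runs (Si i) - runs S0 - (zdev S0 (Si i) - (real i)\<^sup>2 / card A)) / R
       = (runs (Si i) - runs S0) / R - (zdev S0 (Si i) / R - (i / R\<^sup>2)\<^sup>2)"
      by (simp add: diff_divide_distrib)
    ultimately show ?thesis using R by (metis abs_divide abs_of_pos)
  qed
  have Sfi: "\<bar>(runs (Si i) - runs S0) / R - (f (Si i) - (i / R\<^sup>2)\<^sup>2)\<bar> \<le> \<delta>1 + \<delta>2" if "i \<le> G * J" for i
    using fz[OF that] rd[OF that] by linarith
  \<comment> \<open>In units of \<open>R^2\<close> steps the grid time \<open>t\<close> becomes
    \<open>t / 2\<close>, whence the \<open>t^2 / 4\<close>. Rounding \<open>J\<close> shifts a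
    block end by at most one step per block.\<close>
  have off: "\<bar>((real i + 1) / 2 ^ p)\<^sup>2 / 4 - (real (Suc i * J) / R\<^sup>2)\<^sup>2\<bar> \<le> \<delta>3" if i: "i < G" for i
  proof -
    define u v where "u = (real i + 1) / (2 * 2 ^ p)" and "v = real (Suc i * J) / R\<^sup>2"
    have R2: "R\<^sup>2 > 0" using R by simp
    have v: "v = (real i + 1) * real J / R\<^sup>2" by (simp add: v_def algebra_simps)
    have vu: "v \<le> u"
    proof -
      have "(real i + 1) * real J \<le> (real i + 1) * (R\<^sup>2 / (2 * 2 ^ p))" using J by (intro mult_left_mono) auto
      then have "(real i + 1) * real J / R\<^sup>2 \<le> (real i + 1) * (R\<^sup>2 / (2 * 2 ^ p)) / R\<^sup>2" by (rule divide_right_mono) simp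
      then show ?thesis using R2 by (simp add: u_def v)
    qed
    have uv: "u - v \<le> G / R\<^sup>2"
    proof -
      have "(real i + 1) * (R\<^sup>2 / (2 * 2 ^ p) - real J) \<le> real G * 1"
        using i J by (intro mult_mono) auto
      then have "(real i + 1) * (R\<^sup>2 / (2 * 2 ^ p) - real J) / R\<^sup>2 \<le> G / R\<^sup>2" by (intro divide_right_mono) auto
      moreover have "(real i + 1) * (R\<^sup>2 / (2 * 2 ^ p) - real J) / R\<^sup>2 = u - v"
        using R2 by (simp add: u_def v diff_divide_distrib right_diff_distrib)
      ultimately show ?thesis by simp
    qed
    have up: "u \<le> p / 2"
    proof -
      have "real (Suc i) \<le> real (p * 2 ^ p)" using i by (simp only: of_nat_le_iff G_def Suc_le_eq)
      then have "real i + 1 \<le> real p * 2 ^ p" by simp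
      then show ?thesis by (simp add: u_def divide_le_eq)
    qed
    have v0: "v \<ge> 0" by (simp add: v_def)
    have "\<bar>u\<^sup>2 - v\<^sup>2\<bar> = (u + v) * (u - v)" using vu v0 by (simp add: power2_eq_square algebra_simps abs_of_nonneg mult_mono)
    also have "\<dots> \<le> p * (G / R\<^sup>2)" using vu v0 uv up by (intro mult_mono) auto
    finally show ?thesis unfolding u_def v_def by (simp add: \<delta>3_def power_divide power_mult_distrib)
  qed
  have ds: "parabola_offsets p ! i = - (((real i + 1) / 2 ^ p)\<^sup>2 / 4)" if "i < G" for i
    using that by (simp add: parabola_offsets_def G_def)
  have dslen: "length (parabola_offsets p) = G" by (simp add: parabola_offsets_def G_def)
  have gub: "0 \<le> g" "\<And>i. i < G \<Longrightarrow> f (Si (Suc i * J)) - ((real i + 1) / 2 ^ p)\<^sup>2 / 4 \<le> g"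
    using grid_max_le_iff[of J f "parabola_offsets p" 0 S0 xs g] unfolding g_def[symmetric] dslen Si_def[symmetric]
    by (auto simp: ds)
  have ebound: "(runs (Si i) - runs S0) / R \<le> runs_excess S0 xs / R" if "i \<le> length xs" for i
    using runs_excess_le_iff[of S0 xs "runs_excess S0 xs"] that R by (auto simp: Si_def intro: divide_right_mono)
  have upper: "g \<le> runs_excess S0 xs / R + (\<delta>1 + \<delta>2 + \<delta>3)"
    unfolding g_def grid_max_le_iff dslen Si_def[symmetric]
  proof (intro conjI allI impI)
    show "0 \<le> runs_excess S0 xs / R + (\<delta>1 + \<delta>2 + \<delta>3)" using runs_excess_nonneg[of S0 xs] R dnn by simp
    fix i assume i: "i < G"
    then have iJ: "Suc i * J \<le> G * J" by (intro mult_le_mono) auto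
    show "f (Si (Suc i * J)) + parabola_offsets p ! i \<le> runs_excess S0 xs / R + (\<delta>1 + \<delta>2 + \<delta>3)"
      unfolding ds[OF i] using Sfi[OF iJ] off[OF i] ebound[of "Suc i * J"] iJ lenL by (simp add: abs_le_iff)
  qed
  have "runs_excess S0 xs \<le> (g + 4 * \<epsilon> + (\<delta>1 + \<delta>2 + \<delta>3)) * R"
    unfolding runs_excess_le_iff Si_def[symmetric]
  proof (intro allI impI)
    fix j assume j: "j \<le> length xs"
    show "runs (Si j) - runs S0 \<le> (g + 4 * \<epsilon> + (\<delta>1 + \<delta>2 + \<delta>3)) * R"
    proof (cases "j < G * J")
      case False
      then have "real (G * J) \<le> real j" by (simp only: of_nat_le_iff not_less)
      then have "runs (Si j) - runs S0 < 0" using far[OF j] K by (simp add: Si_def G_def)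
      moreover have "0 \<le> (g + 4 * \<epsilon> + (\<delta>1 + \<delta>2 + \<delta>3)) * R" using gub(1) \<epsilon> dnn R by (intro mult_nonneg_nonneg) auto
      ultimately show ?thesis by linarith
    next
      case True
      \<comment> \<open>\<open>j\<close> is compared with the block end on its left. The parabolic
        term only decreases from there to \<open>j\<close>, so just the oscillation of
        \<open>f\<close> has to be bounded.\<close>
      define i l where "i = j div J" and "l = j mod J"
      have jil: "j = i * J + l" "l \<le> J" using J(1) by (auto simp: i_def l_def less_imp_le)
      have iG: "i < G" using True J(1) by (simp add: i_def div_less_iff_less_mult)
      have iJ: "i * J \<le> G * J" using iG by simp
      have jG: "j \<le> G * J" using True by simp
      have fdiff: "f (Si j) - f (Si (i * J)) \<le> 4 * \<epsilon>"
      proof -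
        have "f (Si j) - f (Si (i * J)) = (bw S0 / bw (Si j)) * (zdev (Si (i * J)) (Si j) / R)"
          unfolding f_def mart_def zdev_def diff_divide_distrib[symmetric] using win(4)[OF jG] frac[of "bw (Si j)"] by simp
        also have "\<dots> \<le> 2 * (2 * \<epsilon>)"
        proof -
          have "zdev (Si (i * J)) (Si j) / R \<le> 2 * \<epsilon>"
            using osc[of i l] iG jil j R by (simp add: G_def Si_def divide_le_eq abs_less_iff less_imp_le)
          then have "(bw S0 / bw (Si j)) * (zdev (Si (i * J)) (Si j) / R) \<le> (bw S0 / bw (Si j)) * (2 * \<epsilon>)"
            using win(5)[OF jG] by (intro mult_left_mono) auto
          also have "\<dots> \<le> 2 * (2 * \<epsilon>)" using win(6)[OF jG] \<tau> \<epsilon> by (intro mult_right_mono) auto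
          finally show ?thesis .
        qed
        finally show ?thesis by simp
      qed
      have sq: "(real (i * J) / R\<^sup>2)\<^sup>2 \<le> (real j / R\<^sup>2)\<^sup>2"
        using jil R by (intro power_mono divide_right_mono) auto
      have base: "f (Si (i * J)) - (real (i * J) / R\<^sup>2)\<^sup>2 \<le> g + \<delta>3"
      proof (cases i)
        case 0
        then show ?thesis using gub(1) dnn by (simp add: Si_def f_def)
      next
        case (Suc i')
        then show ?thesis using gub(2)[of i'] off[of i'] iG by (simp add: abs_le_iff)
      qed
      have "(runs (Si j) - runs S0) / R \<le> g + 4 * \<epsilon> + (\<delta>1 + \<delta>2 + \<delta>3)"
        using Sfi[OF jG] fdiff sq base by linarith
      then show ?thesis using R by (simp add: divide_le_eq)
    qed
  qed
  then have "runs_excess S0 xs / R \<le> g + 4 * \<epsilon> + (\<delta>1 + \<delta>2 + \<delta>3)" using R by (simp add: divide_le_eq)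
  then have "\<bar>runs_excess S0 xs / R - g\<bar> \<le> 4 * \<epsilon> + (\<delta>1 + \<delta>2 + \<delta>3)" using upper \<epsilon> by linarith
  then show ?thesis unfolding g_def \<delta>1_def \<delta>2_def \<delta>3_def G_def n'_def by simp
qed

end

lemma avg_bounded_lipschitz_compare:
  fixes F :: "real \<Rightarrow> real" and X Y :: "'b \<Rightarrow> real"
  assumes F: "bounded_lipschitz F" and A: "finite \<Omega>" "\<Omega> \<noteq> {}"
    and close: "\<And>x. x \<in> \<Omega> \<Longrightarrow> \<not> P x \<Longrightarrow> \<bar>X x - Y x\<bar> \<le> d" and d: "0 \<le> d"
  shows "\<bar>avg \<Omega> (\<lambda>x. F (X x)) - avg \<Omega> (\<lambda>x. F (Y x))\<bar> \<le> d + 2 * avg \<Omega> (\<lambda>x. of_bool (P x))"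
proof -
  have "\<bar>avg \<Omega> (\<lambda>x. F (X x)) - avg \<Omega> (\<lambda>x. F (Y x))\<bar> = \<bar>avg \<Omega> (\<lambda>x. F (X x) - F (Y x))\<bar>"
    by (simp add: avg_diff)
  also have "\<dots> \<le> avg \<Omega> (\<lambda>x. \<bar>F (X x) - F (Y x)\<bar>)"
    using norm_avg_le[of \<Omega> "\<lambda>x. F (X x) - F (Y x)"] by simp
  also have "\<dots> \<le> avg \<Omega> (\<lambda>x. d + 2 * of_bool (P x))"
  proof (rule avg_mono)
    fix x assume x: "x \<in> \<Omega>"
    show "\<bar>F (X x) - F (Y x)\<bar> \<le> d + 2 * of_bool (P x)"
      using bounded_lipschitz_diff[OF F, of "X x" "Y x"] close[OF x] d by (cases "P x") auto
  qed
  also have "\<dots> = d + 2 * avg \<Omega> (\<lambda>x. of_bool (P x))"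
    unfolding avg_add avg_mult_left avg_const[OF A] ..
  finally show ?thesis .
qed

subsection \<open>The one-sided limit\<close>

text \<open>The exceptional probabilities as functions of the refinement \<open>p\<close>: a
  nonnegative gain beyond the window, with \<open>K = p / 4\<close>, and a large oscillation in one
  of the \<open>p * 2 ^ p\<close> blocks, whose number loses against an exponential of
  \<open>2 ^ p\<close>.\<close>

lemma exp_tail_eventually_small:
  assumes "0 < (\<epsilon>::real)"
  shows "\<forall>\<^sub>F p in sequentially. 4 * exp (- ((real p / 4) ^ 3 / 16)) \<le> \<epsilon>"
    and "\<forall>\<^sub>F p in sequentially. 4 * (real (p * 2 ^ p) * exp (- 4 * \<epsilon>\<^sup>2 * 2 ^ p)) \<le> \<epsilon>"
proof -
  have "(\<lambda>p. 4 * exp (- ((real p / 4) ^ 3 / 16))) \<longlonglongrightarrow> 0" by real_asymp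
  from order_tendstoD(2)[OF this assms] show "\<forall>\<^sub>F p in sequentially. 4 * exp (- ((real p / 4) ^ 3 / 16)) \<le> \<epsilon>"
    by eventually_elim simp
  have "(\<lambda>p. 4 * (real p * 2 ^ p * exp (- 4 * \<epsilon>\<^sup>2 * 2 ^ p))) \<longlonglongrightarrow> 0" using assms by real_asymp
  from order_tendstoD(2)[OF this assms] show "\<forall>\<^sub>F p in sequentially. 4 * (real (p * 2 ^ p) * exp (- 4 * \<epsilon>\<^sup>2 * 2 ^ p)) \<le> \<epsilon>"
    by eventually_elim simp
qed

lemma eventually_size_conditions:
  fixes \<tau> \<epsilon> :: real and p :: nat
  assumes "0 < \<tau>" "0 < \<epsilon>"
  shows "\<forall>\<^sub>F n in sequentially. 1 \<le> \<tau> * real n \<and> 4 * 2 ^ p \<le> (real n powr (1/3))\<^sup>2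
     \<and> real p * (real n powr (1/3))\<^sup>2 / 2 \<le> \<tau> * real n
     \<and> 72 * (real n powr (3/5))\<^sup>2 / real n \<le> real n powr (1/3) / 8
     \<and> 6 * real n powr (3/5) * real p * real n powr (1/3) / real n \<le> \<epsilon>
     \<and> real p * (real p * 2 ^ p) / (real n powr (1/3))\<^sup>2 \<le> \<epsilon>"
proof (intro eventually_conj)
  show "\<forall>\<^sub>F n in sequentially. 1 \<le> \<tau> * real n" using assms by real_asymp
  have "filterlim (\<lambda>n. (real n powr (1/3))\<^sup>2) at_top sequentially" by real_asymp
  then show "\<forall>\<^sub>F n in sequentially. 4 * 2 ^ p \<le> (real n powr (1/3))\<^sup>2" by (auto simp: filterlim_at_top)
  have "(\<lambda>n. (real n powr (1/3))\<^sup>2 / real n) \<longlonglongrightarrow> 0" by real_asymp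
  then have "(\<lambda>n. real p / 2 * ((real n powr (1/3))\<^sup>2 / real n)) \<longlonglongrightarrow> real p / 2 * 0" by (intro tendsto_intros)
  then have "\<forall>\<^sub>F n in sequentially. real p / 2 * ((real n powr (1/3))\<^sup>2 / real n) < \<tau>"
    using assms by (auto dest: order_tendstoD(2))
  then show "\<forall>\<^sub>F n in sequentially. real p * (real n powr (1/3))\<^sup>2 / 2 \<le> \<tau> * real n"
    using eventually_gt_at_top[of 0] by eventually_elim (simp add: field_simps)
  show "\<forall>\<^sub>F n in sequentially. 72 * (real n powr (3/5))\<^sup>2 / real n \<le> real n powr (1/3) / 8" by real_asymp
  have "(\<lambda>n. 6 * real n powr (3/5) * real n powr (1/3) / real n) \<longlonglongrightarrow> 0" by real_asymp
  then have "(\<lambda>n. real p * (6 * real n powr (3/5) * real n powr (1/3) / real n)) \<longlonglongrightarrow> real p * 0" by (intro tendsto_intros)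
  then have "\<forall>\<^sub>F n in sequentially. real p * (6 * real n powr (3/5) * real n powr (1/3) / real n) < \<epsilon>"
    using assms by (auto dest: order_tendstoD(2))
  then show "\<forall>\<^sub>F n in sequentially. 6 * real n powr (3/5) * real p * real n powr (1/3) / real n \<le> \<epsilon>"
    by eventually_elim (simp add: mult_ac)
  have "(\<lambda>n. 1 / (real n powr (1/3))\<^sup>2) \<longlonglongrightarrow> 0" by real_asymp
  then have "(\<lambda>n. real p * (real p * 2 ^ p) * (1 / (real n powr (1/3))\<^sup>2)) \<longlonglongrightarrow> real p * (real p * 2 ^ p) * 0" by (intro tendsto_intros)
  then have "\<forall>\<^sub>F n in sequentially. real p * (real p * 2 ^ p) * (1 / (real n powr (1/3))\<^sup>2) < \<epsilon>"
    using assms by (auto dest: order_tendstoD(2))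
  then show "\<forall>\<^sub>F n in sequentially. real p * (real p * 2 ^ p) / (real n powr (1/3))\<^sup>2 \<le> \<epsilon>"
    by eventually_elim simp
qed

text \<open>The order of choice is \<open>\<epsilon>\<close>, the size bound \<open>a\<close>, the
  grid \<open>p\<close>, the tolerance \<open>\<tau>\<close>, and \<open>n\<close> last. The
  exponent 3/5 lies above 1/2, the order of \<open>dev\<close>, and below 2/3, since
  \<open>72 \<Lambda>^2 / n\<close> has to be negligible against \<open>n^(1/3)\<close>.\<close>

lemma (in standard_brownian_motion) one_sided_limit:
  assumes e: "0 < e"
  shows "\<exists>\<tau>::real>0. \<exists>n0. \<forall>(A :: 'b set) s S F. cyclic_shift A s \<longrightarrow> n0 \<le> card A \<longrightarrow> cyclic_shift.typical A s \<tau> S \<longrightarrow>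
    \<bar>cyclic_shift.dev A s S\<bar> \<le> card A powr (3/5) \<longrightarrow> bounded_lipschitz F \<longrightarrow>
    \<bar>avg (perms (A - S)) (\<lambda>xs. F (cyclic_shift.runs_excess A s S xs / card A powr (1/3))) - expectation (\<lambda>\<omega>. F (half_sup \<omega> / 2))\<bar> \<le> e"
proof -
  \<comment> \<open>The errors will add up to \<open>12 \<epsilon>\<close>: 7 for the comparison
    with the grid, 3 for the exceptional events, 1 for the Gaussian blocks and 1 for the Brownian
    grid.\<close>
  define \<epsilon> where "\<epsilon> = e / 20"
  have \<epsilon>: "0 < \<epsilon>" using e by (simp add: \<epsilon>_def)
  obtain a :: nat where a: "4 * exp (- 2 * (real a)\<^sup>2) \<le> \<epsilon>" "0 < a"
  proof -
    have "(\<lambda>a. 4 * exp (- 2 * (real a)\<^sup>2)) \<longlonglongrightarrow> 0" by real_asymp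
    from order_tendstoD(2)[OF this \<epsilon>] have "\<forall>\<^sub>F a in sequentially. 4 * exp (- 2 * (real a)\<^sup>2) < \<epsilon>" .
    then have "\<forall>\<^sub>F a in sequentially. 4 * exp (- 2 * (real a)\<^sup>2) < \<epsilon> \<and> 0 < a"
      using eventually_gt_at_top[of 0] by eventually_elim auto
    then show ?thesis using that by (metis (no_types, lifting) eventually_sequentially less_imp_le order_refl)
  qed
  have "\<forall>\<^sub>F p in sequentially. (\<forall>F. bounded_lipschitz F \<longrightarrow>
      \<bar>gauss_max (sqrt (1 / 2 ^ p) / 2) F (parabola_offsets p) 0 0 - expectation (\<lambda>\<omega>. F (half_sup \<omega> / 2))\<bar> \<le> \<epsilon>)
    \<and> 4 * exp (- ((real p / 4) ^ 3 / 16)) \<le> \<epsilon> \<and> 4 * (real (p * 2 ^ p) * exp (- 4 * \<epsilon>\<^sup>2 * 2 ^ p)) \<le> \<epsilon> \<and> 4 \<le> p"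
    by (intro eventually_conj half_sup_grid_limit exp_tail_eventually_small eventually_ge_at_top \<epsilon>)
  then obtain p where grid: "\<And>F. bounded_lipschitz F \<Longrightarrow>
      \<bar>gauss_max (sqrt (1 / 2 ^ p) / 2) F (parabola_offsets p) 0 0 - expectation (\<lambda>\<omega>. F (half_sup \<omega> / 2))\<bar> \<le> \<epsilon>"
    and p1: "4 * exp (- ((real p / 4) ^ 3 / 16)) \<le> \<epsilon>" and p2: "4 * (real (p * 2 ^ p) * exp (- 4 * \<epsilon>\<^sup>2 * 2 ^ p)) \<le> \<epsilon>" and p4: "4 \<le> p"
    by (auto simp: eventually_sequentially)
  define G where "G = p * 2 ^ p"
  have G: "0 < G" using p4 by (simp add: G_def)
  define \<eta> where "\<eta> = 1 / (2::real) ^ p"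
  have "0 < \<eta>" "0 < \<epsilon> / G" using \<epsilon> G by (auto simp: \<eta>_def)
  from block_bounded_lipschitz[OF this] obtain \<tau>1 :: real and n1 :: nat where \<tau>1: "0 < \<tau>1"
    and block: "\<And>(A :: 'b set) s S0 S J F. cyclic_shift A s \<Longrightarrow> n1 \<le> card A \<Longrightarrow> cyclic_shift.typical A s \<tau>1 S0 \<Longrightarrow>
     S0 \<subseteq> S \<Longrightarrow> S \<subseteq> A \<Longrightarrow> real (card S + J) \<le> card S0 + \<tau>1 * card A \<Longrightarrow> \<bar>real J - \<eta> / 2 * card A powr (2/3)\<bar> \<le> 1 \<Longrightarrow>
     bounded_lipschitz F \<Longrightarrow>
     \<bar>avg (perms (A - S)) (\<lambda>xs. F (card A powr (-1/3) * (cyclic_shift.bw A S0 * cyclic_shift.mart A s (S \<union> set (take J xs))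
            - cyclic_shift.bw A S0 * cyclic_shift.mart A s S)))
        - (\<integral>z. F z \<partial>gauss (sqrt \<eta> / 2))\<bar> \<le> \<epsilon> / G"
    by blast
  define \<tau> where "\<tau> = min \<tau>1 (min (1 / 100) (\<epsilon> / (5 * real a * (1 + real p))))"
  have "0 < \<epsilon> / (5 * real a * (1 + real p))" using \<epsilon> a(2) by (intro divide_pos_pos mult_pos_pos) auto
  then have \<tau>: "0 < \<tau>" "\<tau> \<le> \<tau>1" "\<tau> \<le> 1 / 100" "\<tau> \<le> \<epsilon> / (5 * real a * (1 + real p))"
    using \<tau>1 unfolding \<tau>_def by linarith+
  from eventually_size_conditions[OF \<tau>(1) \<epsilon>, of p] obtain n2 where n2: "\<And>n. n2 \<le> n \<Longrightarrow> 1 \<le> \<tau> * real n \<and> 4 * 2 ^ p \<le> (real n powr (1/3))\<^sup>2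
     \<and> real p * (real n powr (1/3))\<^sup>2 / 2 \<le> \<tau> * real n
     \<and> 72 * (real n powr (3/5))\<^sup>2 / real n \<le> real n powr (1/3) / 8
     \<and> 6 * real n powr (3/5) * real p * real n powr (1/3) / real n \<le> \<epsilon>
     \<and> real p * (real p * 2 ^ p) / (real n powr (1/3))\<^sup>2 \<le> \<epsilon>"
    unfolding eventually_sequentially by blast
  have main: "\<bar>avg (perms (A - S)) (\<lambda>xs. F (cyclic_shift.runs_excess A s S xs / card A powr (1/3))) - expectation (\<lambda>\<omega>. F (half_sup \<omega> / 2))\<bar> \<le> e"
    if cs: "cyclic_shift A s" and n0: "n1 \<le> card A" "n2 \<le> card A" "100 \<le> card A" and ty: "cyclic_shift.typical A s \<tau> S"
      and dev: "\<bar>cyclic_shift.dev A s S\<bar> \<le> card A powr (3/5)" and F: "bounded_lipschitz F"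
    for A :: "'b set" and s S F
  proof -
    interpret cyclic_shift A s by (rule cs)
    define n where "n = real (card A)"
    define R where "R = n powr (1/3)"
    define \<Lambda> where "\<Lambda> = n powr (3/5)"
    have n100: "n \<ge> 100" using n0 by (simp add: n_def)
    have R0: "0 < R" using n100 by (simp add: R_def)
    have R3: "R ^ 3 = n" unfolding R_def using n100 by (simp add: powr_power)
    have R2: "R\<^sup>2 = n powr (2/3)" unfolding R_def using n100 by (simp add: powr_power)
    have Rm: "n powr (-1/3) = 1 / R" unfolding R_def by (simp add: powr_minus_divide)
    have \<Lambda>1: "1 \<le> \<Lambda>" unfolding \<Lambda>_def using n100 by (simp add: ge_one_powr_ge_zero)
    have cond: "1 \<le> \<tau> * n" "4 * 2 ^ p \<le> R\<^sup>2" "p * R\<^sup>2 / 2 \<le> \<tau> * n" "72 * \<Lambda>\<^sup>2 / n \<le> R / 8"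
      "6 * \<Lambda> * real p * R / n \<le> \<epsilon>" "real p * (real p * 2 ^ p) / R\<^sup>2 \<le> \<epsilon>"
      using n2[OF n0(2)] by (auto simp: n_def R_def \<Lambda>_def)
    \<comment> \<open>Brownian time \<open>1 / 2 ^ p\<close> corresponds to
      \<open>R^2 / (2 * 2 ^ p)\<close> steps of variance 1/2.\<close>
    define J where "J = nat \<lfloor>R\<^sup>2 / (2 * 2 ^ p)\<rfloor>"
    have J: "real J \<le> R\<^sup>2 / (2 * 2 ^ p)" "R\<^sup>2 / (2 * 2 ^ p) - 1 \<le> real J"
    proof -
      have nn: "0 \<le> R\<^sup>2 / (2 * 2 ^ p)" by simp
      then show "real J \<le> R\<^sup>2 / (2 * 2 ^ p)" unfolding J_def by (simp add: of_nat_floor)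
      show "R\<^sup>2 / (2 * 2 ^ p) - 1 \<le> real J" unfolding J_def using nn by linarith
    qed
    \<comment> \<open>Rounding down at most halves the block length, so the blocks still cover
      \<open>p / 4 * R^2\<close> steps; hence \<open>K = p / 4\<close> in
      \<open>far_excess\<close>.\<close>
    have J4: "R\<^sup>2 / (4 * 2 ^ p) \<le> real J"
    proof -
      have "1 \<le> R\<^sup>2 / (4 * 2 ^ p)" using cond(2) by (simp add: le_divide_eq)
      moreover have "R\<^sup>2 / (2 * 2 ^ p) = R\<^sup>2 / (4 * 2 ^ p) + R\<^sup>2 / (4 * 2 ^ p)" by simp
      ultimately show ?thesis using J(2) by linarith
    qed
    have "0 < R\<^sup>2 / (4 * 2 ^ p)" using R0 by simp
    then have J0: "0 < J" using J4 by linarith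
    have Lp: "real (G * J) \<le> p * R\<^sup>2 / 2"
    proof -
      have "real G * real J \<le> real G * (R\<^sup>2 / (2 * 2 ^ p))" using J by (intro mult_left_mono) auto
      then show ?thesis by (simp add: G_def)
    qed
    then have Lt: "real (G * J) \<le> \<tau> * n" using cond(3) by linarith
    have KL: "real p / 4 * R\<^sup>2 \<le> real (G * J)"
    proof -
      have "real G * (R\<^sup>2 / (4 * 2 ^ p)) \<le> real G * real J" using J4 by (intro mult_left_mono) auto
      then show ?thesis by (simp add: G_def)
    qed
    have SA: "S \<subseteq> A" and half: "\<bar>2 * real (card S) - real (card A)\<bar> \<le> 1" using ty by (auto simp: typical_def)
    have n6: "6 \<le> card A" using n0 by simp
    define \<Omega> where "\<Omega> = perms (A - S)"
    have \<Omega>: "finite \<Omega>" "\<Omega> \<noteq> {}" unfolding \<Omega>_def using finite_A by auto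
    define f where "f T = (bw S * mart T - bw S * mart S) / R" for T
    define Y where "Y xs = grid_max J f (parabola_offsets p) 0 S xs" for xs
    define B1 where "B1 xs \<longleftrightarrow> (\<exists>i\<le>length xs. real p / 4 * R\<^sup>2 \<le> i \<and> 0 \<le> runs (S \<union> set (take i xs)) - runs S)" for xs
    define B2 where "B2 xs \<longleftrightarrow> (\<exists>i\<le>length xs. real a * R + real a / R * i \<le> \<bar>zdev S (S \<union> set (take i xs))\<bar>)" for xs
    define B3 where "B3 k xs \<longleftrightarrow> (\<exists>l\<le>J. k * J + l \<le> length xs \<and>
       2 * \<epsilon> * R \<le> \<bar>zdev (S \<union> set (take (k * J) xs)) (S \<union> set (take (k * J + l) xs))\<bar>)" for k xs
    have N: "n / 2 - 1 \<le> real (card (A - S))" using half card_Diff_A[OF SA] unfolding n_def by linarith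
    have P1: "avg \<Omega> (\<lambda>xs. of_bool (B1 xs) :: real) \<le> 2 * exp (- ((real p / 4) ^ 3 / 16))"
      unfolding B1_def \<Omega>_def
      by (rule far_excess[OF SA half n6 _ \<Lambda>1 R0]) (use dev R3 cond(4) p4 in \<open>auto simp: n_def \<Lambda>_def\<close>)
    have P2: "avg \<Omega> (\<lambda>xs. of_bool (B2 xs) :: real) \<le> 2 * exp (- 2 * (real a)\<^sup>2)"
    proof -
      have N2: "2 \<le> card (A - S)" using N n100 by linarith
      have "avg \<Omega> (\<lambda>xs. of_bool (B2 xs) :: real) \<le> 2 * exp (- (2 * (real a * R) * (real a / R)))"
        unfolding B2_def \<Omega>_def by (rule linear_boundary_zdev[OF SA N2]) (use R0 in simp)
      then show ?thesis using R0 by (simp add: power2_eq_square)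
    qed
    have P3: "avg \<Omega> (\<lambda>xs. of_bool (B3 k xs) :: real) \<le> 2 * exp (- 4 * \<epsilon>\<^sup>2 * 2 ^ p)" if k: "k < G" for k
    proof -
      have "k * J \<le> G * J" using k by simp
      then have "real (k * J) \<le> real (G * J)" by (simp only: of_nat_le_iff)
      then have "real (k * J) \<le> n / 100" using Lt mult_right_mono[OF \<tau>(3), of n] n100 by linarith
      then have m: "k * J + 2 \<le> card (A - S)" using N n100 by linarith
      have "avg \<Omega> (\<lambda>xs. of_bool (B3 k xs) :: real) \<le> 2 * exp (- 2 * \<epsilon>\<^sup>2 * (R\<^sup>2 / J))"
        unfolding B3_def \<Omega>_def by (rule block_oscillation[OF SA m J0 \<epsilon> R0])
      also have "\<dots> \<le> 2 * exp (- 4 * \<epsilon>\<^sup>2 * 2 ^ p)"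
      proof -
        have "2 * 2 ^ p \<le> R\<^sup>2 / J" using J(1) J0 by (simp add: field_simps)
        then have "2 * \<epsilon>\<^sup>2 * (2 * 2 ^ p) \<le> 2 * \<epsilon>\<^sup>2 * (R\<^sup>2 / J)" by (intro mult_left_mono) auto
        then show ?thesis by simp
      qed
      finally show ?thesis .
    qed
    define B where "B xs \<longleftrightarrow> B1 xs \<or> B2 xs \<or> (\<exists>k<G. B3 k xs)" for xs
    have PB: "2 * avg \<Omega> (\<lambda>xs. of_bool (B xs) :: real) \<le> 3 * \<epsilon>"
    proof -
      have "avg \<Omega> (\<lambda>xs. of_bool (B xs) :: real) \<le> avg \<Omega> (\<lambda>xs. of_bool (B1 xs) + of_bool (B2 xs) + (\<Sum>k<G. of_bool (B3 k xs)))"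
      proof (rule avg_mono)
        fix xs
        have "of_bool (\<exists>k<G. B3 k xs) \<le> (\<Sum>k<G. of_bool (B3 k xs) :: real)"
        proof (cases "\<exists>k<G. B3 k xs")
          case True
          then obtain k where k: "k < G" "B3 k xs" by blast
          then have "of_bool (B3 k xs) \<le> (\<Sum>k<G. of_bool (B3 k xs) :: real)" by (intro member_le_sum) auto
          then show ?thesis using k by simp
        qed (simp add: sum_nonneg)
        then show "of_bool (B xs) \<le> (of_bool (B1 xs) + of_bool (B2 xs) + (\<Sum>k<G. of_bool (B3 k xs)) :: real)"
          unfolding B_def by (cases "B1 xs"; cases "B2 xs"; cases "\<exists>k<G. B3 k xs") (auto intro: order_trans add_nonneg_nonneg sum_nonneg)
      qed
      also have "\<dots> \<le> 2 * exp (- ((real p / 4) ^ 3 / 16)) + 2 * exp (- 2 * (real a)\<^sup>2) + (\<Sum>k<G. 2 * exp (- 4 * \<epsilon>\<^sup>2 * 2 ^ p))"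
        unfolding avg_add avg_sum by (intro add_mono P1 P2 sum_mono P3) auto
      finally have "avg \<Omega> (\<lambda>xs. of_bool (B xs) :: real) \<le> 2 * exp (- ((real p / 4) ^ 3 / 16)) + 2 * exp (- 2 * (real a)\<^sup>2)
          + real G * (2 * exp (- 4 * \<epsilon>\<^sup>2 * 2 ^ p))" by simp
      then show ?thesis using p1 p2 a(1) unfolding G_def by linarith
    qed
    have cmp: "\<bar>avg \<Omega> (\<lambda>xs. F (runs_excess S xs / R)) - avg \<Omega> (\<lambda>xs. F (Y xs))\<bar> \<le> 7 * \<epsilon> + 2 * avg \<Omega> (\<lambda>xs. of_bool (B xs))"
    proof (rule avg_bounded_lipschitz_compare[OF F \<Omega>])
      fix xs assume xs: "xs \<in> \<Omega>" and nB: "\<not> B xs"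
      have "\<bar>runs_excess S xs / R - Y xs\<bar> \<le> 4 * \<epsilon> + (5 * \<tau> * real a * (1 + real p) + 6 * \<Lambda> * real p * R / card A + real p * (real p * 2 ^ p) / R\<^sup>2)"
        unfolding Y_def f_def
      proof (rule grid_compare[OF ty n0(3) _ \<tau>(3) _ \<Lambda>1 R0 _ J0 J, of "real p / 4" "real a"])
        show "1 \<le> \<tau> * card A" using cond by (simp add: n_def)
        show "\<bar>dev S\<bar> \<le> \<Lambda>" using dev by (simp add: \<Lambda>_def n_def)
        show "R ^ 3 = card A" using R3 by (simp add: n_def)
        show "real (p * 2 ^ p * J) \<le> \<tau> * card A" using Lt by (simp add: G_def n_def)
        show "real p / 4 * R\<^sup>2 \<le> real (p * 2 ^ p * J)" using KL by (simp add: G_def)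
        show "0 < real a" "0 < \<epsilon>" using a \<epsilon> by auto
        show "xs \<in> perms (A - S)" using xs by (simp add: \<Omega>_def)
        show "runs (S \<union> set (take i xs)) - runs S < 0" if "i \<le> length xs" "real p / 4 * R\<^sup>2 \<le> real i" for i
          using nB that unfolding B_def B1_def by (meson not_le)
        show "\<bar>zdev S (S \<union> set (take i xs))\<bar> < real a * R + real a / R * real i" if "i \<le> length xs" for i
          using nB that unfolding B_def B2_def by (meson not_le)
        show "\<bar>zdev (S \<union> set (take (i * J) xs)) (S \<union> set (take (i * J + l) xs))\<bar> < 2 * \<epsilon> * R"
          if "i < p * 2 ^ p" "l \<le> J" "i * J + l \<le> length xs" for i l
          using nB that unfolding B_def B3_def G_def by (meson not_le)
      qed
      moreover have "5 * \<tau> * real a * (1 + real p) \<le> \<epsilon>" using \<tau>(4) a(2) by (simp add: le_divide_eq mult_ac)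
      ultimately show "\<bar>runs_excess S xs / R - Y xs\<bar> \<le> 7 * \<epsilon>" using cond(5,6) by (simp add: n_def)
    qed (use \<epsilon> in simp)
    have dl: "length (parabola_offsets p) = G" by (simp add: parabola_offsets_def G_def)
    have "\<bar>avg (perms (A - S)) (\<lambda>xs. F (grid_max J f (parabola_offsets p) 0 S xs)) - gauss_max (sqrt \<eta> / 2) F (parabola_offsets p) (f S) 0\<bar>
       \<le> length (parabola_offsets p) * (\<epsilon> / G)"
    proof (rule grid_max_approx[OF finite_A F, where ?S0.0 = S and m = "card S + G * J"])
      fix T H assume T: "S \<subseteq> T" "T \<subseteq> A" "card T + J \<le> card S + G * J" and H: "bounded_lipschitz H"
      have fT: "f (T \<union> set (take J xs)) - f T = card A powr (-1/3) * (bw S * mart (T \<union> set (take J xs)) - bw S * mart T)" for xs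
        unfolding f_def n_def[symmetric] Rm by (simp add: diff_divide_distrib)
      show "\<bar>avg (perms (A - T)) (\<lambda>xs. H (f (T \<union> set (take J xs)) - f T)) - (\<integral>z. H z \<partial>gauss (sqrt \<eta> / 2))\<bar> \<le> \<epsilon> / G"
        unfolding fT
      proof (rule block[OF cs n0(1) _ T(1,2) _ _ H])
        show "typical \<tau>1 S" by (rule typical_mono[OF ty \<tau>(2)])
        have "real (card T + J) \<le> real (card S) + real (G * J)" using T(3) by (simp only: of_nat_add[symmetric] of_nat_le_iff)
        also have "\<dots> \<le> real (card S) + \<tau>1 * card A"
          using Lt mult_right_mono[OF \<tau>(2), of n] n100 unfolding n_def by linarith
        finally show "real (card T + J) \<le> real (card S) + \<tau>1 * card A" .
        show "\<bar>real J - \<eta> / 2 * card A powr (2/3)\<bar> \<le> 1"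
          using J unfolding n_def[symmetric] R2[symmetric] \<eta>_def by (simp add: abs_le_iff)
      qed
    next
      have "real (G * J) \<le> n / 100" using Lt mult_right_mono[OF \<tau>(3), of n] n100 by linarith
      then have "real (card S + G * J) \<le> real (card A)" using half n100 unfolding n_def of_nat_add by linarith
      then show "card S + G * J \<le> card A" by (simp only: of_nat_le_iff)
    qed (use SA dl in auto)
    then have "\<bar>avg \<Omega> (\<lambda>xs. F (Y xs)) - gauss_max (sqrt \<eta> / 2) F (parabola_offsets p) 0 0\<bar> \<le> \<epsilon>"
      using G by (simp add: \<Omega>_def Y_def dl f_def)
    moreover have "\<bar>gauss_max (sqrt \<eta> / 2) F (parabola_offsets p) 0 0 - expectation (\<lambda>\<omega>. F (half_sup \<omega> / 2))\<bar> \<le> \<epsilon>"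
      using grid[OF F] by (simp add: \<eta>_def)
    ultimately have "\<bar>avg \<Omega> (\<lambda>xs. F (runs_excess S xs / R)) - expectation (\<lambda>\<omega>. F (half_sup \<omega> / 2))\<bar> \<le> 12 * \<epsilon>"
      using cmp PB by linarith
    then show ?thesis using e unfolding \<Omega>_def R_def n_def \<epsilon>_def by linarith
  qed
  show ?thesis
  proof (intro exI[of _ \<tau>] conjI \<tau>(1) exI[of _ "max n1 (max n2 100)"] allI impI, goal_cases)
    case (1 A s S F)
    then show ?case by (intro main) auto
  qed
qed

subsection \<open>Typical configurations\<close>

lemma avg_subset_pattern:
  assumes A: "finite A" and P: "P \<subseteq> A" "Q \<subseteq> A" "P \<inter> Q = {}" and h: "card P \<le> h"
  shows "avg (subsets_of_card A h) (\<lambda>T. of_bool (P \<subseteq> T \<and> Q \<inter> T = {}))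
     = real ((card A - card P - card Q) choose (h - card P)) / real (card A choose h)"
proof -
  have fin: "finite P" "finite Q" using finite_subset[OF P(1) A] finite_subset[OF P(2) A] by auto
  have "bij_betw (\<lambda>T. T - P) {T \<in> subsets_of_card A h. P \<subseteq> T \<and> Q \<inter> T = {}} (subsets_of_card (A - P - Q) (h - card P))"
  proof (rule bij_betw_byWitness[where f' = "\<lambda>U. U \<union> P"])
    show "(\<lambda>T. T - P) ` {T \<in> subsets_of_card A h. P \<subseteq> T \<and> Q \<inter> T = {}} \<subseteq> subsets_of_card (A - P - Q) (h - card P)"
      using fin by (auto simp: subsets_of_card_def card_Diff_subset)
    show "(\<lambda>U. U \<union> P) ` subsets_of_card (A - P - Q) (h - card P) \<subseteq> {T \<in> subsets_of_card A h. P \<subseteq> T \<and> Q \<inter> T = {}}"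
    proof clarify
      fix U assume U: "U \<in> subsets_of_card (A - P - Q) (h - card P)"
      then have "U \<subseteq> A - P - Q" "card U = h - card P" by (auto simp: subsets_of_card_def)
      moreover have "finite U" using calculation(1) A finite_subset by blast
      ultimately have "card (U \<union> P) = h" using fin h by (subst card_Un_disjoint) auto
      then show "U \<union> P \<in> subsets_of_card A h \<and> P \<subseteq> U \<union> P \<and> Q \<inter> (U \<union> P) = {}"
        using U P by (auto simp: subsets_of_card_def)
    qed
  qed (auto simp: subsets_of_card_def)
  then have "card {T \<in> subsets_of_card A h. P \<subseteq> T \<and> Q \<inter> T = {}} = card (A - P - Q) choose (h - card P)"
    using A by (simp add: bij_betw_same_card card_subsets_of_card)
  moreover have "card (A - P - Q) = card A - card P - card Q"
  proof -
    have "Q \<subseteq> A - P" using P by auto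
    then show ?thesis using P(1) fin by (simp add: card_Diff_subset)
  qed
  moreover have "(\<Sum>T\<in>subsets_of_card A h. of_bool (P \<subseteq> T \<and> Q \<inter> T = {})) = real (card {T \<in> subsets_of_card A h. P \<subseteq> T \<and> Q \<inter> T = {}})"
    using finite_subsets_of_card[OF A] by (simp add: Int_def)
  ultimately show ?thesis
    using A by (simp add: avg_def card_subsets_of_card divide_inverse mult.commute)
qed

text \<open>Probability that a uniform \<open>h\<close>-subset of \<open>n\<close> points contains
  \<open>a\<close> given points and avoids \<open>b\<close> others.\<close>

definition pattern_prob :: "nat \<Rightarrow> nat \<Rightarrow> nat \<Rightarrow> nat \<Rightarrow> real" where
  "pattern_prob n h a b = real ((n - a - b) choose (h - a)) / real (n choose h)"

lemma choose_in:
  assumes "1 \<le> h" "h \<le> n"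
  shows "real ((n - 1) choose (h - 1)) = real h / real n * real (n choose h)"
proof -
  have "h * (n choose h) = n * ((n - 1) choose (h - 1))" using assms by (intro times_binomial_minus1_eq) simp
  then have "real h * real (n choose h) = real n * real ((n - 1) choose (h - 1))" by (metis of_nat_mult)
  then show ?thesis using assms by (simp add: field_simps)
qed

lemma choose_out:
  assumes "h \<le> n" "1 \<le> n"
  shows "real ((n - 1) choose h) = (real n - real h) / real n * real (n choose h)"
proof -
  have "(n - h) * (n choose h) = n * ((n - 1) choose h)" by (rule binomial_absorb_comp)
  then have "real (n - h) * real (n choose h) = real n * real ((n - 1) choose h)" by (metis of_nat_mult)
  then show ?thesis using assms by (simp add: of_nat_diff field_simps)
qed

lemma pattern_prob_1_1:
  assumes "1 \<le> h" "h < n"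
  shows "pattern_prob n h 1 1 = real h * (real n - real h) / (real n * (real n - 1))"
proof -
  have "real ((n - 1 - 1) choose (h - 1)) = (real (n - 1) - real (h - 1)) / real (n - 1) * real ((n - 1) choose (h - 1))"
    using assms by (intro choose_out) auto
  also have "real ((n - 1) choose (h - 1)) = real h / real n * real (n choose h)"
    using assms by (intro choose_in) auto
  finally show ?thesis using assms unfolding pattern_prob_def by (simp add: of_nat_diff mult_ac)
qed

lemma pattern_prob_2_1:
  assumes "2 \<le> h" "h < n"
  shows "pattern_prob n h 2 1 = (real n - real h) / (real n - 2) * ((real h - 1) / (real n - 1)) * (real h / real n)"
proof -
  have "real ((n - 2 - 1) choose (h - 2)) = (real (n - 2) - real (h - 2)) / real (n - 2) * real ((n - 2) choose (h - 2))"
    using assms by (intro choose_out) auto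
  also have "real ((n - 2) choose (h - 2)) = real (h - 1) / real (n - 1) * real ((n - 1) choose (h - 1))"
    using assms choose_in[of "h - 1" "n - 1"] by (simp add: numeral_2_eq_2)
  also have "real ((n - 1) choose (h - 1)) = real h / real n * real (n choose h)"
    using assms by (intro choose_in) auto
  finally show ?thesis using assms unfolding pattern_prob_def by (simp add: of_nat_diff)
qed

text \<open>One factor per prescribed point: two exclusions by \<open>choose_out\<close>, then four
  inclusions by \<open>choose_in\<close>.\<close>

lemma pattern_prob_4_2:
  assumes "4 \<le> h" "h + 1 < n"
  shows "pattern_prob n h 4 2 = (real n - real h - 1) / (real n - 5) * ((real n - real h) / (real n - 4)) * ((real h - 3) / (real n - 3))
     * ((real h - 2) / (real n - 2)) * ((real h - 1) / (real n - 1)) * (real h / real n)"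
proof -
  have "real ((n - 4 - 2) choose (h - 4)) = (real (n - 5) - real (h - 4)) / real (n - 5) * real ((n - 5) choose (h - 4))"
    using assms choose_out[of "h - 4" "n - 5"] by (simp add: numeral_eq_Suc)
  also have "real ((n - 5) choose (h - 4)) = (real (n - 4) - real (h - 4)) / real (n - 4) * real ((n - 4) choose (h - 4))"
    using assms choose_out[of "h - 4" "n - 4"] by (simp add: numeral_eq_Suc)
  also have "real ((n - 4) choose (h - 4)) = real (h - 3) / real (n - 3) * real ((n - 3) choose (h - 3))"
    using assms choose_in[of "h - 3" "n - 3"] by (simp add: numeral_eq_Suc)
  also have "real ((n - 3) choose (h - 3)) = real (h - 2) / real (n - 2) * real ((n - 2) choose (h - 2))"
    using assms choose_in[of "h - 2" "n - 2"] by (simp add: numeral_eq_Suc)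
  also have "real ((n - 2) choose (h - 2)) = real (h - 1) / real (n - 1) * real ((n - 1) choose (h - 1))"
    using assms choose_in[of "h - 1" "n - 1"] by (simp add: numeral_eq_Suc)
  also have "real ((n - 1) choose (h - 1)) = real h / real n * real (n choose h)"
    using assms by (intro choose_in) auto
  finally show ?thesis using assms unfolding pattern_prob_def by (simp add: of_nat_diff mult_ac)
qed

lemma half_ratio_tendsto:
  fixes h :: "nat \<Rightarrow> nat"
  assumes "\<And>n. \<bar>2 * real (h n) - real n\<bar> \<le> 1"
  shows "(\<lambda>n. (real (h n) - i) / (real n - k)) \<longlonglongrightarrow> 1 / 2"
proof -
  have h: "(\<lambda>n. real (h n) / real n) \<longlonglongrightarrow> 1 / 2"
  proof (rule LIM_zero_cancel, rule Lim_null_comparison)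
    show "\<forall>\<^sub>F n in sequentially. norm (real (h n) / real n - 1 / 2) \<le> 1 / real n"
      using eventually_gt_at_top[of 0]
    proof eventually_elim
      case (elim n)
      have "real (h n) / real n - 1 / 2 = (2 * real (h n) - real n) / (2 * real n)" using elim by (simp add: field_simps)
      then have "norm (real (h n) / real n - 1 / 2) \<le> 1 / (2 * real n)"
        using assms[of n] elim by (simp add: abs_divide divide_right_mono)
      also have "\<dots> \<le> 1 / real n" using elim by (simp add: field_simps)
      finally show ?case .
    qed
    show "(\<lambda>n. 1 / real n) \<longlonglongrightarrow> 0" by (rule lim_1_over_n)
  qed
  have i: "(\<lambda>n. c / real n) \<longlonglongrightarrow> 0" for c :: real by real_asymp
  have "(\<lambda>n. (real (h n) / real n - i / real n) / (1 - k / real n)) \<longlonglongrightarrow> (1 / 2 - 0) / (1 - 0)"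
    by (intro tendsto_intros h i) auto
  moreover have "\<forall>\<^sub>F n in sequentially. (real (h n) / real n - i / real n) / (1 - k / real n) = (real (h n) - i) / (real n - k)"
    using eventually_gt_at_top[of 0]
  proof eventually_elim
    case (elim n)
    have "real (h n) / real n - i / real n = (real (h n) - i) / real n" "1 - k / real n = (real n - k) / real n"
      using elim by (simp_all add: diff_divide_distrib)
    then show ?case using elim by simp
  qed
  ultimately show ?thesis using tendsto_cong by fastforce
qed

text \<open>At half filling every prescribed point contributes a factor tending to 1/2. The second
  limit is the square of the first, so distant pits decorrelate.\<close>

lemma pattern_prob_tendsto:
  fixes h :: "nat \<Rightarrow> nat"
  assumes h: "\<And>n. \<bar>2 * real (h n) - real n\<bar> \<le> 1"
  shows "(\<lambda>n. pattern_prob n (h n) 2 1) \<longlonglongrightarrow> 1 / 8" and "(\<lambda>n. pattern_prob n (h n) 4 2) \<longlonglongrightarrow> 1 / 64"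
proof -
  have r: "(\<lambda>n. (real (h n) - i) / (real n - k)) \<longlonglongrightarrow> 1 / 2" for i k by (rule half_ratio_tendsto[OF h])
  have c: "(\<lambda>n. (real n - real (h n) - i) / (real n - k)) \<longlonglongrightarrow> 1 / 2" for i k
  proof -
    have one: "(\<lambda>n. (real n - i) / (real n - k)) \<longlonglongrightarrow> 1" by real_asymp
    have "(\<lambda>n. (real n - i) / (real n - k) - (real (h n) - 0) / (real n - k)) \<longlonglongrightarrow> 1 - 1 / 2"
      by (intro tendsto_intros one r)
    then show ?thesis by (simp add: diff_divide_distrib[symmetric] algebra_simps)
  qed
  have big: "\<forall>\<^sub>F n in sequentially. 4 \<le> h n \<and> h n + 1 < n"
    using eventually_ge_at_top[of 10]
  proof eventually_elim
    case (elim n)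
    then have "4 \<le> real (h n)" "real (h n) + 1 < real n" using h[of n] by linarith+
    then show ?case by linarith
  qed
  have "(\<lambda>n. (real n - real (h n) - 0) / (real n - 2) * ((real (h n) - 1) / (real n - 1)) * ((real (h n) - 0) / (real n - 0))) \<longlonglongrightarrow> 1 / 2 * (1 / 2) * (1 / 2)"
    by (intro tendsto_intros r c)
  moreover have "\<forall>\<^sub>F n in sequentially. (real n - real (h n) - 0) / (real n - 2) * ((real (h n) - 1) / (real n - 1)) * ((real (h n) - 0) / (real n - 0)) = pattern_prob n (h n) 2 1"
    using big
  proof eventually_elim
    case (elim n)
    then show ?case using pattern_prob_2_1[of "h n" n] by simp
  qed
  ultimately show "(\<lambda>n. pattern_prob n (h n) 2 1) \<longlonglongrightarrow> 1 / 8" using tendsto_cong by fastforce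
  have "(\<lambda>n. (real n - real (h n) - 1) / (real n - 5) * ((real n - real (h n) - 0) / (real n - 4)) * ((real (h n) - 3) / (real n - 3))
     * ((real (h n) - 2) / (real n - 2)) * ((real (h n) - 1) / (real n - 1)) * ((real (h n) - 0) / (real n - 0))) \<longlonglongrightarrow> 1 / 2 * (1 / 2) * (1 / 2) * (1 / 2) * (1 / 2) * (1 / 2)"
    by (intro tendsto_intros r c)
  moreover have "\<forall>\<^sub>F n in sequentially. (real n - real (h n) - 1) / (real n - 5) * ((real n - real (h n) - 0) / (real n - 4)) * ((real (h n) - 3) / (real n - 3))
     * ((real (h n) - 2) / (real n - 2)) * ((real (h n) - 1) / (real n - 1)) * ((real (h n) - 0) / (real n - 0)) = pattern_prob n (h n) 4 2"
    using big
  proof eventually_elim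
    case (elim n)
    then show ?case using pattern_prob_4_2[of "h n" n] by simp
  qed
  ultimately show "(\<lambda>n. pattern_prob n (h n) 4 2) \<longlonglongrightarrow> 1 / 64" using tendsto_cong by fastforce
qed

section \<open>Moments and tails of \<open>runs\<close> and \<open>pits\<close> for a uniform
  subset\<close>

context cyclic_shift
begin

lemma avg_runs:
  assumes h: "1 \<le> h" "h < card A"
  shows "avg (subsets_of_card A h) runs = run_mean h"
proof -
  have "avg (subsets_of_card A h) runs = (\<Sum>k\<in>A. avg (subsets_of_card A h) (\<lambda>T. of_bool ({s k} \<subseteq> T \<and> {k} \<inter> T = {})))"
    unfolding runs_def[abs_def] avg_sum by (intro sum.cong avg_cong) auto
  also have "\<dots> = (\<Sum>k\<in>A. pattern_prob (card A) h 1 1)"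
  proof (rule sum.cong)
    fix k assume k: "k \<in> A"
    show "avg (subsets_of_card A h) (\<lambda>T. of_bool ({s k} \<subseteq> T \<and> {k} \<inter> T = {})) = pattern_prob (card A) h 1 1"
      unfolding pattern_prob_def
      using avg_subset_pattern[OF finite_A, of "{s k}" "{k}" h] k s_in[OF k] s_neq[OF k] h by simp
  qed simp
  also have "\<dots> = run_mean h"
  proof -
    have "real (card A) * (real h * (real (card A) - real h) / (real (card A) * (real (card A) - 1))) = run_mean h"
      using h by (simp add: run_mean_def)
    then show ?thesis using pattern_prob_1_1[OF h] by simp
  qed
  finally show ?thesis .
qed

lemma avg_pits:
  assumes h: "2 \<le> h"
  shows "avg (subsets_of_card A h) pits = card A * pattern_prob (card A) h 2 1"
proof -
  have "avg (subsets_of_card A h) pits = (\<Sum>k\<in>A. avg (subsets_of_card A h) (\<lambda>T. of_bool ({k, s (s k)} \<subseteq> T \<and> {s k} \<inter> T = {})))"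
    unfolding pits_def[abs_def] avg_sum by (intro sum.cong avg_cong) auto
  also have "\<dots> = (\<Sum>k\<in>A. pattern_prob (card A) h 2 1)"
  proof (rule sum.cong)
    fix k assume k: "k \<in> A"
    have c: "card {k, s (s k)} = 2" using ss_neq[OF k] by auto
    have ne: "s k \<noteq> k" "s k \<noteq> s (s k)" using s_neq[OF k] s_neq[OF s_in[OF k]] by auto
    show "avg (subsets_of_card A h) (\<lambda>T. of_bool ({k, s (s k)} \<subseteq> T \<and> {s k} \<inter> T = {})) = pattern_prob (card A) h 2 1"
      unfolding pattern_prob_def
      using avg_subset_pattern[OF finite_A, of "{k, s (s k)}" "{s k}" h] k s_in[OF k] s_in[OF s_in[OF k]] ne c h by simp
  qed simp
  finally show ?thesis by simp
qed

text \<open>Two pits on disjoint triples prescribe 4 occupied and 2 free positions. Overlapping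
  triples, at most 9 for each \<open>k\<close>, are bounded trivially.\<close>

lemma avg_pits_sq:
  assumes h: "4 \<le> h" "h \<le> card A"
  shows "avg (subsets_of_card A h) (\<lambda>T. (pits T)\<^sup>2) \<le> 9 * card A + (real (card A))\<^sup>2 * pattern_prob (card A) h 4 2"
proof -
  define X where "X = subsets_of_card A h"
  have X: "finite X" "X \<noteq> {}" unfolding X_def using finite_A h by (auto simp: finite_subsets_of_card subsets_of_card_nonempty)
  define I where "I k T = (of_bool (k \<in> T \<and> s k \<notin> T \<and> s (s k) \<in> T) :: real)" for k T
  define near where "near k l \<longleftrightarrow> {k, s k, s (s k)} \<inter> {l, s l, s (s l)} \<noteq> {}" for k l
  define q where "q = pattern_prob (card A) h 4 2"
  have q0: "0 \<le> q" by (simp add: q_def pattern_prob_def)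
  have pair: "avg X (\<lambda>T. I k T * I l T) \<le> of_bool (near k l) + q" if k: "k \<in> A" and l: "l \<in> A" for k l
  proof (cases "near k l")
    case True
    have "avg X (\<lambda>T. I k T * I l T) \<le> 1" by (rule avg_le_const[OF X]) (simp add: I_def)
    then show ?thesis using True q0 by simp
  next
    case False
    have c: "card {k, s (s k), l, s (s l)} = 4" "card {s k, s l} = 2"
      using False ss_neq[OF k] ss_neq[OF l] by (auto simp: near_def card_insert_if)
    have d: "{k, s (s k), l, s (s l)} \<inter> {s k, s l} = {}"
      using False s_neq[OF k] s_neq[OF l] s_neq[OF s_in[OF k]] s_neq[OF s_in[OF l]] by (auto simp: near_def)
    have "avg X (\<lambda>T. I k T * I l T) = avg X (\<lambda>T. of_bool ({k, s (s k), l, s (s l)} \<subseteq> T \<and> {s k, s l} \<inter> T = {}))"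
      by (rule avg_cong) (auto simp: I_def)
    also have "\<dots> = real ((card A - 4 - 2) choose (h - 4)) / real (card A choose h)"
      using avg_subset_pattern[OF finite_A _ _ d, of h] c k l s_in h unfolding X_def by simp
    also have "\<dots> = q" by (simp add: q_def pattern_prob_def)
    finally show ?thesis using False by simp
  qed
  have cnt: "(\<Sum>l\<in>A. of_bool (near k l) :: real) \<le> 9" for k
  proof -
    have one: "(\<Sum>l\<in>A. of_bool (l = y) :: real) \<le> 1" for y using finite_A by (simp add: of_bool_def)
    have eq1: "(\<Sum>l\<in>A. of_bool (s l = y) :: real) = (\<Sum>l\<in>A. of_bool (l = y))" for y by (rule sum_shift)
    have eq2: "(\<Sum>l\<in>A. of_bool (s (s l) = y) :: real) = (\<Sum>l\<in>A. of_bool (s l = y))" for y by (rule sum_shift)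
    define c where "c y l = (of_bool (l = y) + of_bool (s l = y) + of_bool (s (s l) = y) :: real)" for y l
    have three: "(\<Sum>l\<in>A. c y l) \<le> 3" for y
      unfolding c_def sum.distrib eq2 eq1 using one[of y] by simp
    have c0: "0 \<le> c y l" for y l by (simp add: c_def)
    have c1: "1 \<le> c y l" if "y \<in> {l, s l, s (s l)}" for y l using that by (auto simp: c_def)
    have "of_bool (near k l) \<le> c k l + c (s k) l + c (s (s k)) l" for l
    proof (cases "near k l")
      case True
      then obtain y where "y \<in> {k, s k, s (s k)}" "y \<in> {l, s l, s (s l)}" by (auto simp: near_def)
      then show ?thesis using c1[of y l] c0[of k l] c0[of "s k" l] c0[of "s (s k)" l] by auto
    qed (simp add: c0)
    then have "(\<Sum>l\<in>A. of_bool (near k l)) \<le> (\<Sum>l\<in>A. c k l + c (s k) l + c (s (s k)) l)" by (rule sum_mono)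
    also have "\<dots> \<le> 3 + 3 + 3" unfolding sum.distrib by (intro add_mono three)
    finally show ?thesis by simp
  qed
  have "avg X (\<lambda>T. (pits T)\<^sup>2) = (\<Sum>k\<in>A. \<Sum>l\<in>A. avg X (\<lambda>T. I k T * I l T))"
    unfolding avg_sum[symmetric] by (rule avg_cong) (auto simp: pits_def I_def power2_eq_square sum_product)
  also have "\<dots> \<le> (\<Sum>k\<in>A. \<Sum>l\<in>A. of_bool (near k l) + q)" by (intro sum_mono pair)
  also have "\<dots> = (\<Sum>k\<in>A. (\<Sum>l\<in>A. of_bool (near k l)) + card A * q)" by (simp add: sum.distrib)
  also have "\<dots> \<le> (\<Sum>k\<in>A. 9 + card A * q)" by (intro sum_mono add_right_mono cnt)
  also have "\<dots> = 9 * card A + (real (card A))\<^sup>2 * q" by (simp add: power2_eq_square algebra_simps)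
  finally show ?thesis unfolding X_def q_def .
qed

text \<open>The second moment is taken around \<open>n / 8\<close> instead of the exact mean. By
  \<open>pattern_prob_tendsto\<close> the numerator tends to
  \<open>1 / 64 - 1 / 32 + 1 / 64 = 0\<close> at half filling.\<close>

lemma pits_chebyshev:
  fixes \<tau> :: real
  assumes h: "4 \<le> h" "h \<le> card A" and \<tau>: "0 < \<tau>"
  shows "avg (subsets_of_card A h) (\<lambda>T. of_bool (\<tau> * card A < \<bar>pits T - real (card A) / 8\<bar>) :: real)
     \<le> (9 / card A + pattern_prob (card A) h 4 2 - pattern_prob (card A) h 2 1 / 4 + 1 / 64) / \<tau>\<^sup>2"
proof -
  define n where "n = real (card A)"
  define X where "X = subsets_of_card A h"
  have X: "finite X" "X \<noteq> {}" unfolding X_def using finite_A h by (auto simp: finite_subsets_of_card subsets_of_card_nonempty)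
  have n: "n > 0" using h by (simp add: n_def)
  have "avg X (\<lambda>T. of_bool (\<tau> * n < \<bar>pits T - n / 8\<bar>) :: real) \<le> avg X (\<lambda>T. (pits T - n / 8)\<^sup>2 * (1 / (\<tau> * n)\<^sup>2))"
  proof (rule avg_mono)
    fix T
    show "of_bool (\<tau> * n < \<bar>pits T - n / 8\<bar>) \<le> (pits T - n / 8)\<^sup>2 * (1 / (\<tau> * n)\<^sup>2)"
    proof (cases "\<tau> * n < \<bar>pits T - n / 8\<bar>")
      case True
      have "(\<tau> * n)\<^sup>2 \<le> \<bar>pits T - n / 8\<bar>\<^sup>2" using True \<tau> n by (intro power_mono) auto
      then show ?thesis using True \<tau> n by (simp add: le_divide_eq)
    qed simp
  qed
  also have "\<dots> = avg X (\<lambda>T. (pits T - n / 8)\<^sup>2) * (1 / (\<tau> * n)\<^sup>2)" by (rule avg_mult_right)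
  finally have le: "avg X (\<lambda>T. of_bool (\<tau> * n < \<bar>pits T - n / 8\<bar>) :: real) \<le> avg X (\<lambda>T. (pits T - n / 8)\<^sup>2) * (1 / (\<tau> * n)\<^sup>2)" .
  have "avg X (\<lambda>T. (pits T - n / 8)\<^sup>2) = avg X (\<lambda>T. (pits T)\<^sup>2 - n / 4 * pits T + n\<^sup>2 / 64)"
    by (rule avg_cong) (auto simp: power2_eq_square algebra_simps)
  also have "\<dots> = avg X (\<lambda>T. (pits T)\<^sup>2) - n / 4 * avg X pits + n\<^sup>2 / 64"
    unfolding avg_add avg_diff avg_mult_left avg_const[OF X] ..
  also have "\<dots> \<le> (9 * n + n\<^sup>2 * pattern_prob (card A) h 4 2) - n / 4 * (n * pattern_prob (card A) h 2 1) + n\<^sup>2 / 64"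
    using avg_pits_sq[OF h] avg_pits[of h] h unfolding X_def n_def by simp
  finally have "avg X (\<lambda>T. (pits T - n / 8)\<^sup>2) * (1 / (\<tau> * n)\<^sup>2)
     \<le> ((9 * n + n\<^sup>2 * pattern_prob (card A) h 4 2) - n / 4 * (n * pattern_prob (card A) h 2 1) + n\<^sup>2 / 64) * (1 / (\<tau> * n)\<^sup>2)"
    by (rule mult_right_mono) simp
  also have "\<dots> = (9 / n + pattern_prob (card A) h 4 2 - pattern_prob (card A) h 2 1 / 4 + 1 / 64) / \<tau>\<^sup>2"
    using n \<tau> by (simp add: field_simps power2_eq_square)
  finally show ?thesis using le unfolding X_def n_def by linarith
qed

text \<open>The filling is started from the empty set, where \<open>dev\<close> is 0. A line with
  intercept \<open>n^(3/5) / 2\<close> and the same total rise reaches \<open>n^(3/5)\<close> at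
  time \<open>n\<close>, hence stays below it at time \<open>h\<close>.\<close>

lemma dev_tail:
  assumes h: "h \<le> card A" and A: "0 < card A"
  shows "avg (subsets_of_card A h) (\<lambda>T. of_bool (card A powr (3/5) \<le> \<bar>dev T\<bar>) :: real) \<le> 2 * exp (- (card A powr (1/5) / 2))"
proof -
  define n where "n = real (card A)"
  define \<alpha> \<beta> where "\<alpha> = n powr (3/5) / 2" and "\<beta> = n powr (-2/5) / 2"
  have n: "n > 0" using A by (simp add: n_def)
  have "dev {} = 0 * bw {}" by (simp add: dev_def run_mean_def runs_def)
  from linear_boundary[OF _ this, of \<beta> \<alpha>]
  have b: "avg (perms A) (\<lambda>xs. of_bool (\<exists>i\<le>length xs. \<alpha> + \<beta> * i \<le> \<bar>dev (set (take i xs))\<bar>) :: real) \<le> 2 * exp (- (2 * \<alpha> * \<beta>))"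
    by (simp add: \<beta>_def)
  have "2 * \<alpha> * \<beta> = n powr (3/5) * n powr (-2/5) / 2" by (simp add: \<alpha>_def \<beta>_def)
  also have "\<dots> = n powr (1/5) / 2" unfolding powr_add[symmetric] by simp
  finally have ab: "2 * \<alpha> * \<beta> = n powr (1/5) / 2" .
  have "avg (subsets_of_card A h) (\<lambda>T. of_bool (n powr (3/5) \<le> \<bar>dev T\<bar>) :: real)
     = avg (perms A) (\<lambda>xs. of_bool (n powr (3/5) \<le> \<bar>dev (set (take h xs))\<bar>))"
    by (rule avg_perms_take[OF finite_A h, symmetric])
  also have "\<dots> \<le> avg (perms A) (\<lambda>xs. of_bool (\<exists>i\<le>length xs. \<alpha> + \<beta> * i \<le> \<bar>dev (set (take i xs))\<bar>) :: real)"
  proof (rule avg_mono)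
    fix xs assume xs: "xs \<in> perms A"
    have "\<beta> * h \<le> \<beta> * n" using h by (intro mult_left_mono) (auto simp: \<beta>_def n_def)
    also have "\<beta> * n = n powr (-2/5) * n powr 1 / 2" using n by (simp add: \<beta>_def)
    also have "\<dots> = \<alpha>" unfolding powr_add[symmetric] by (simp add: \<alpha>_def)
    finally have "\<alpha> + \<beta> * h \<le> n powr (3/5)" by (simp add: \<alpha>_def)
    then show "of_bool (n powr (3/5) \<le> \<bar>dev (set (take h xs))\<bar>) \<le> (of_bool (\<exists>i\<le>length xs. \<alpha> + \<beta> * i \<le> \<bar>dev (set (take i xs))\<bar>) :: real)"
      using h length_perms[OF xs] by (auto intro!: exI[of _ h])
  qed
  finally show ?thesis using b unfolding ab n_def by linarith
qed

lemma dev_compl: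
  assumes "S \<subseteq> A" shows "dev (A - S) = dev S"
  unfolding dev_def runs_compl[OF assms] card_Diff_A[OF assms] by (simp add: run_mean_def mult.commute)

end

subsection \<open>The two-sided limit\<close>

context cyclic_shift
begin

definition excess :: "nat \<Rightarrow> 'a list \<Rightarrow> real" where
  "excess h zs = Max ((\<lambda>m. runs (set (take m zs)) - runs (set (take h zs))) ` {0..length zs})"

lemma excess_le_iff:
  "excess h zs \<le> c \<longleftrightarrow> (\<forall>m\<le>length zs. runs (set (take m zs)) - runs (set (take h zs)) \<le> c)"
  unfolding excess_def by (subst Max_le_iff) auto

text \<open>The part of the process before time \<open>h\<close> is read backwards: removing elements from \<open>T\<close> is adding
  elements to its complement, and both have the same number of cyclic runs.\<close>
lemma excess_append:
  assumes T: "T \<subseteq> A" and ys: "ys \<in> perms T" and ws: "ws \<in> perms (A - T)"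
  shows "excess (length ys) (ys @ ws) = max (runs_excess T ws) (runs_excess (A - T) (rev ys))"
proof -
  have sets: "set ys = T" "distinct ys" "set ws = A - T" using ys ws by (auto simp: permutations_of_set_def)
  \<comment> \<open>Adding the last \<open>i\<close> entries of \<open>ys\<close> to
    \<open>A - T\<close> leaves exactly the complement of the earlier entries, and complements have
    equally many runs.\<close>
  have rev_fill: "runs (A - T \<union> set (take i (rev ys))) = runs (set (take (length ys - i) ys))" if "i \<le> length ys" for i
  proof -
    define m where "m = length ys - i"
    have "set (take i (rev ys)) = set (drop m ys)" by (simp add: take_rev m_def)
    moreover have "set (take m ys) \<union> set (drop m ys) = T"
      using sets(1) by (metis append_take_drop_id set_append)
    moreover have "set (take m ys) \<inter> set (drop m ys) = {}"
      using sets(2) by (metis append_take_drop_id distinct_append)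
    ultimately have "A - T \<union> set (take i (rev ys)) = A - set (take m ys)" using T by blast
    moreover have "set (take m ys) \<subseteq> A" using set_take_subset[of m ys] sets(1) T by auto
    ultimately show ?thesis using runs_compl by (simp add: m_def)
  qed
  have "excess (length ys) (ys @ ws) \<le> c \<longleftrightarrow> max (runs_excess T ws) (runs_excess (A - T) (rev ys)) \<le> c" for c
  proof
    assume le: "excess (length ys) (ys @ ws) \<le> c"
    have le: "runs (set (take m (ys @ ws))) - runs T \<le> c" if "m \<le> length (ys @ ws)" for m
      using le that sets(1) unfolding excess_le_iff by auto
    have "runs_excess T ws \<le> c"
      unfolding runs_excess_le_iff using le[of "length ys + _"] sets(1) by auto
    moreover have "runs_excess (A - T) (rev ys) \<le> c"
      unfolding runs_excess_le_iff
    proof (intro allI impI)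
      fix i assume "i \<le> length (rev ys)"
      then show "runs (A - T \<union> set (take i (rev ys))) - runs (A - T) \<le> c"
        using le[of "length ys - i"] runs_compl[OF T] rev_fill[of i] by simp
    qed
    ultimately show "max (runs_excess T ws) (runs_excess (A - T) (rev ys)) \<le> c" by simp
  next
    assume "max (runs_excess T ws) (runs_excess (A - T) (rev ys)) \<le> c"
    then have le: "runs_excess T ws \<le> c" "runs_excess (A - T) (rev ys) \<le> c" by auto
    show "excess (length ys) (ys @ ws) \<le> c"
      unfolding excess_le_iff
    proof (intro allI impI)
      fix m assume m: "m \<le> length (ys @ ws)"
      show "runs (set (take m (ys @ ws))) - runs (set (take (length ys) (ys @ ws))) \<le> c"
      proof (cases "m \<le> length ys")
        case True
        then show ?thesis
          using le(2)[unfolded runs_excess_le_iff, rule_format, of "length ys - m"] rev_fill[of "length ys - m"] runs_compl[OF T] sets(1)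
          by simp
      next
        case False
        then show ?thesis
          using le(1)[unfolded runs_excess_le_iff, rule_format, of "m - length ys"] m sets(1) by simp
      qed
    qed
  qed
  then show ?thesis by (meson order_antisym order_refl)
qed

lemma avg_excess_split:
  assumes h: "h \<le> card A"
  shows "avg (perms A) (\<lambda>zs. G (excess h zs)) = avg (subsets_of_card A h) (\<lambda>T. avg (perms T) (\<lambda>ys. avg (perms (A - T))
      (\<lambda>ws. G (max (runs_excess T ws) (runs_excess (A - T) (rev ys))))))"
  unfolding avg_perms_split[OF finite_A h]
proof (intro avg_cong refl)
  fix T ys ws assume "T \<in> subsets_of_card A h" and ys: "ys \<in> perms T" and ws: "ws \<in> perms (A - T)"
  then have T: "T \<subseteq> A" "card T = h" by (auto simp: subsets_of_card_def)
  show "G (excess h (ys @ ws)) = G (max (runs_excess T ws) (runs_excess (A - T) (rev ys)))"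
    using excess_append[OF T(1) ys ws] length_perms[OF ys] T(2) by simp
qed

end

lemma bounded_lipschitz_max: "bounded_lipschitz F \<Longrightarrow> bounded_lipschitz (\<lambda>x. F (max x r))"
  unfolding bounded_lipschitz_def
proof (intro conjI allI)
  fix x y assume F: "(\<forall>x. \<bar>F x\<bar> \<le> 1) \<and> (\<forall>x y. \<bar>F x - F y\<bar> \<le> \<bar>x - y\<bar>)"
  show "\<bar>F (max x r)\<bar> \<le> 1" using F by blast
  have "\<bar>F (max x r) - F (max y r)\<bar> \<le> \<bar>max x r - max y r\<bar>" using F by blast
  also have "\<dots> \<le> \<bar>x - y\<bar>" by (auto simp: max_def)
  finally show "\<bar>F (max x r) - F (max y r)\<bar> \<le> \<bar>x - y\<bar>" .
qed

section \<open>The two-sided supremum and the joint limit of future and past\<close>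

context two_sided_brownian_motion
begin

sublocale fwd: standard_brownian_motion M B by (rule forward)

sublocale bwd: standard_brownian_motion M "\<lambda>t. B (- t)" by (rule backward)

lemma parabolic_max_eq_rational_sup:
  assumes \<omega>: "\<omega> \<in> space M"
  shows "parabolic_max B \<omega> = (SUP q\<in>\<rat>. B q \<omega> - q\<^sup>2 / 2)"
  unfolding parabolic_max_def
proof (rule Sup_eq_if_same_upper_bounds)
  fix c
  have c1: "continuous_on {0..} (\<lambda>t. B t \<omega> - t\<^sup>2 / 2)" and c2: "continuous_on {0..} (\<lambda>t. B (- t) \<omega> - t\<^sup>2 / 2)"
    by (intro continuous_intros fwd.continuous_paths bwd.continuous_paths \<omega>; simp)+
  have "B t \<omega> - t\<^sup>2 / 2 \<le> c" if le: "\<And>q. q \<in> \<rat> \<Longrightarrow> B q \<omega> - q\<^sup>2 / 2 \<le> c" for t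
  proof (cases "0 \<le> t")
    case True
    then show ?thesis using le_on_rationals_imp_le[OF c1, of c t] le by blast
  next
    case False
    have "B (- q) \<omega> - q\<^sup>2 / 2 \<le> c" if "q \<in> \<rat>" for q using le[of "- q"] that by simp
    then have "B (- (- t)) \<omega> - (- t)\<^sup>2 / 2 \<le> c" using le_on_rationals_imp_le[OF c2, of c "- t"] False by simp
    then show ?thesis by simp
  qed
  then show "(\<forall>x\<in>range (\<lambda>t. B t \<omega> - t\<^sup>2 / 2). x \<le> c) \<longleftrightarrow> (\<forall>y\<in>(\<lambda>q. B q \<omega> - q\<^sup>2 / 2) ` \<rat>. y \<le> c)" by auto
qed

lemma measurable_B: "B t \<in> borel_measurable M"
  using fwd.measurable_W[of t] bwd.measurable_W[of "- t"] by (cases "0 \<le> t") auto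

lemma parabolic_max_measurable [measurable]: "parabolic_max B \<in> borel_measurable M"
proof (subst measurable_cong[OF parabolic_max_eq_rational_sup])
  show "(\<lambda>\<omega>. SUP q\<in>\<rat>. B q \<omega> - q\<^sup>2 / 2) \<in> borel_measurable M"
    by (rule borel_measurable_SUP_real) (auto simp: countable_rat intro!: borel_measurable_diff measurable_B Rats_0)
qed

lemma AE_parabolic_max_attained:
  "AE \<omega> in M. parabolic_max B \<omega> = max (fwd.half_sup \<omega>) (bwd.half_sup \<omega>)
     \<and> (\<exists>t. parabolic_max B \<omega> = B t \<omega> - t\<^sup>2 / 2 \<and> (\<forall>s. B s \<omega> - s\<^sup>2 / 2 \<le> parabolic_max B \<omega>))"
  using fwd.AE_half_sup_attained bwd.AE_half_sup_attained
proof eventually_elim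
  case (elim \<omega>)
  obtain t1 where t1: "fwd.half_sup \<omega> = B t1 \<omega> - t1\<^sup>2 / 2" "\<And>s. s \<ge> 0 \<Longrightarrow> B s \<omega> - s\<^sup>2 / 2 \<le> fwd.half_sup \<omega>"
    using elim(1) by blast
  obtain t2 where t2: "bwd.half_sup \<omega> = B (- t2) \<omega> - t2\<^sup>2 / 2" "\<And>s. s \<ge> 0 \<Longrightarrow> B (- s) \<omega> - s\<^sup>2 / 2 \<le> bwd.half_sup \<omega>"
    using elim(2) by blast
  define v where "v = max (fwd.half_sup \<omega>) (bwd.half_sup \<omega>)"
  have le: "B s \<omega> - s\<^sup>2 / 2 \<le> v" for s
    using t1(2)[of s] t2(2)[of "- s"] by (cases "0 \<le> s") (auto simp: v_def)
  have "\<exists>t. v = B t \<omega> - t\<^sup>2 / 2"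
    using t1(1) t2(1) by (cases "fwd.half_sup \<omega> \<le> bwd.half_sup \<omega>") (auto simp: v_def max_def intro: exI[of _ "- t2"] exI[of _ t1])
  then obtain t where t: "v = B t \<omega> - t\<^sup>2 / 2" by blast
  have "parabolic_max B \<omega> = v"
    unfolding parabolic_max_def by (rule cSup_eq_maximum) (use t le in auto)
  then show ?case using t le unfolding v_def by auto
qed

text \<open>The inner average is over the backward half and the outer one over the forward half, matching
  the two averages in \<open>two_sided_limit\<close>.\<close>
lemma expectation_parabolic_max_split:
  assumes F: "bounded_lipschitz F"
  defines "\<Psi> \<equiv> \<lambda>r. expectation (\<lambda>\<omega>. F (max (bwd.half_sup \<omega> / 2) r))"
  shows "expectation (\<lambda>\<omega>. F (parabolic_max B \<omega> / 2)) = expectation (\<lambda>\<omega>. \<Psi> (fwd.half_sup \<omega> / 2))"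
proof -
  define P1 where "P1 \<omega> = (\<lambda>t\<in>{0..}. B t \<omega>)" for \<omega>
  define P2 where "P2 \<omega> = (\<lambda>t\<in>{0..}. B (- t) \<omega>)" for \<omega>
  \<comment> \<open>Independence is given on path space, so the two suprema are first written as
    \<open>rat_sup\<close> of the two half paths.\<close>
  define X where "X = rat_sup \<circ> P1"
  define Y where "Y = rat_sup \<circ> P2"
  have X: "X \<omega> = fwd.half_sup \<omega>" and Y: "Y \<omega> = bwd.half_sup \<omega>" if "\<omega> \<in> space M" for \<omega>
    using fwd.half_sup_eq_rat_sup[OF that] bwd.half_sup_eq_rat_sup[OF that] by (simp_all add: X_def Y_def P1_def P2_def)
  have "indep_var borel X borel Y"
    unfolding X_def Y_def
    by (rule indep_var_compose[OF _ rat_sup_measurable rat_sup_measurable]) (use independent_halves in \<open>simp add: P1_def[abs_def] P2_def[abs_def]\<close>)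
  then have [measurable]: "X \<in> borel_measurable M" "Y \<in> borel_measurable M"
    and joint: "distr M borel X \<Otimes>\<^sub>M distr M borel Y = distr M (borel \<Otimes>\<^sub>M borel) (\<lambda>\<omega>. (X \<omega>, Y \<omega>))"
    unfolding indep_var_distribution_eq by blast+
  note [measurable] = bounded_lipschitz_measurable[OF F]
  interpret X: prob_space "distr M borel X" by (rule prob_space_distr) measurable
  interpret Y: prob_space "distr M borel Y" by (rule prob_space_distr) measurable
  interpret XY: pair_prob_space "distr M borel X" "distr M borel Y" ..
  have "expectation (\<lambda>\<omega>. F (parabolic_max B \<omega> / 2)) = expectation (\<lambda>\<omega>. F (max (snd (X \<omega>, Y \<omega>) / 2) (fst (X \<omega>, Y \<omega>) / 2)))"
  proof (rule integral_cong_AE)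
    show "AE \<omega> in M. F (parabolic_max B \<omega> / 2) = F (max (snd (X \<omega>, Y \<omega>) / 2) (fst (X \<omega>, Y \<omega>) / 2))"
      using AE_parabolic_max_attained AE_space
    proof eventually_elim
      case (elim \<omega>)
      then have "parabolic_max B \<omega> / 2 = max (Y \<omega> / 2) (X \<omega> / 2)" by (simp add: X Y max_def)
      then show ?case by simp
    qed
  qed measurable
  also have "\<dots> = (\<integral>p. F (max (snd p / 2) (fst p / 2)) \<partial>(distr M borel X \<Otimes>\<^sub>M distr M borel Y))"
    unfolding joint by (rule integral_distr[symmetric]) measurable
  also have "\<dots> = (\<integral>x. (\<integral>y. F (max (snd (x, y) / 2) (fst (x, y) / 2)) \<partial>distr M borel Y) \<partial>distr M borel X)"
  proof (rule XY.integral_fst'[symmetric])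
    show "integrable (distr M borel X \<Otimes>\<^sub>M distr M borel Y) (\<lambda>p. F (max (snd p / 2) (fst p / 2)))"
      by (intro XY.integrable_const_bound[of _ 1]) (auto simp: bounded_lipschitzD[OF F])
  qed
  also have "\<dots> = (\<integral>x. \<Psi> (x / 2) \<partial>distr M borel X)"
  proof (rule Bochner_Integration.integral_cong[OF refl])
    fix x
    have "(\<integral>y. F (max (snd (x, y) / 2) (fst (x, y) / 2)) \<partial>distr M borel Y) = expectation (\<lambda>\<omega>. F (max (Y \<omega> / 2) (x / 2)))"
      by (subst integral_distr) auto
    also have "\<dots> = \<Psi> (x / 2)" unfolding \<Psi>_def by (rule Bochner_Integration.integral_cong) (auto simp: Y)
    finally show "(\<integral>y. F (max (snd (x, y) / 2) (fst (x, y) / 2)) \<partial>distr M borel Y) = \<Psi> (x / 2)" .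
  qed
  also have "\<dots> = expectation (\<lambda>\<omega>. \<Psi> (X \<omega> / 2))"
  proof (rule integral_distr)
    have "(\<lambda>(x, y). F (max (y / 2) (x / 2))) \<in> borel_measurable (distr M borel X \<Otimes>\<^sub>M distr M borel Y)" by measurable
    then have "(\<lambda>x. \<integral>y. F (max (y / 2) (x / 2)) \<partial>distr M borel Y) \<in> borel_measurable (distr M borel X)"
      by (rule Y.borel_measurable_lebesgue_integral)
    moreover have "(\<integral>y. F (max (y / 2) (x / 2)) \<partial>distr M borel Y) = \<Psi> (x / 2)" for x
      unfolding \<Psi>_def by (subst integral_distr) (auto intro!: Bochner_Integration.integral_cong simp: Y)
    ultimately show "(\<lambda>x. \<Psi> (x / 2)) \<in> borel_measurable borel" by simp
  qed measurable
  also have "\<dots> = expectation (\<lambda>\<omega>. \<Psi> (fwd.half_sup \<omega> / 2))"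
    by (rule Bochner_Integration.integral_cong) (auto simp: X)
  finally show ?thesis .
qed

text \<open>For a fixed past, \<open>F (max _ r)\<close> is again a test function, so the one-sided
  limit handles the future; the resulting \<open>\<Psi>\<close> is a test function for the past. Two
  applications replace an argument about joint convergence. \<open>A - S\<close> has to be typical
  too, because the reversed past is a filling started from it.\<close>

lemma two_sided_limit:
  assumes e: "0 < e"
  shows "\<exists>\<tau>::real>0. \<exists>n0. \<forall>(A :: 'b set) s S F. cyclic_shift A s \<longrightarrow> n0 \<le> card A \<longrightarrow> cyclic_shift.typical A s \<tau> S \<longrightarrow>
    cyclic_shift.typical A s \<tau> (A - S) \<longrightarrow> \<bar>cyclic_shift.dev A s S\<bar> \<le> card A powr (3/5) \<longrightarrow> bounded_lipschitz F \<longrightarrow>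
    \<bar>avg (perms S) (\<lambda>ys. avg (perms (A - S)) (\<lambda>ws. F (max (cyclic_shift.runs_excess A s S ws) (cyclic_shift.runs_excess A s (A - S) (rev ys))
       / card A powr (1/3)))) - expectation (\<lambda>\<omega>. F (parabolic_max B \<omega> / 2))\<bar> \<le> e"
proof -
  have e2: "0 < e / 2" using e by simp
  obtain \<tau>1 :: real and n1 where \<tau>1: "0 < \<tau>1" and fwd: "\<And>(A :: 'b set) s S F. cyclic_shift A s \<Longrightarrow> n1 \<le> card A \<Longrightarrow> cyclic_shift.typical A s \<tau>1 S \<Longrightarrow>
    \<bar>cyclic_shift.dev A s S\<bar> \<le> card A powr (3/5) \<Longrightarrow> bounded_lipschitz F \<Longrightarrow>
    \<bar>avg (perms (A - S)) (\<lambda>xs. F (cyclic_shift.runs_excess A s S xs / card A powr (1/3))) - expectation (\<lambda>\<omega>. F (fwd.half_sup \<omega> / 2))\<bar> \<le> e / 2"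
    using fwd.one_sided_limit[OF e2] by blast
  obtain \<tau>2 :: real and n2 where \<tau>2: "0 < \<tau>2" and bwd: "\<And>(A :: 'b set) s S F. cyclic_shift A s \<Longrightarrow> n2 \<le> card A \<Longrightarrow> cyclic_shift.typical A s \<tau>2 S \<Longrightarrow>
    \<bar>cyclic_shift.dev A s S\<bar> \<le> card A powr (3/5) \<Longrightarrow> bounded_lipschitz F \<Longrightarrow>
    \<bar>avg (perms (A - S)) (\<lambda>xs. F (cyclic_shift.runs_excess A s S xs / card A powr (1/3))) - expectation (\<lambda>\<omega>. F (bwd.half_sup \<omega> / 2))\<bar> \<le> e / 2"
    using bwd.one_sided_limit[OF e2] by blast
  define \<tau> where "\<tau> = min \<tau>1 \<tau>2"
  have main: "\<bar>avg (perms S) (\<lambda>ys. avg (perms (A - S)) (\<lambda>ws. F (max (cyclic_shift.runs_excess A s S ws) (cyclic_shift.runs_excess A s (A - S) (rev ys))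
       / card A powr (1/3)))) - expectation (\<lambda>\<omega>. F (parabolic_max B \<omega> / 2))\<bar> \<le> e"
    if cs: "cyclic_shift A s" and n: "n1 \<le> card A" "n2 \<le> card A" and ty: "cyclic_shift.typical A s \<tau> S" "cyclic_shift.typical A s \<tau> (A - S)"
      and dev: "\<bar>cyclic_shift.dev A s S\<bar> \<le> card A powr (3/5)" and F: "bounded_lipschitz F"
    for A :: "'b set" and s S F
  proof -
    interpret cyclic_shift A s by (rule cs)
    define R where "R = real (card A) powr (1/3)"
    have R: "0 \<le> R" by (simp add: R_def)
    have S: "S \<subseteq> A" using ty by (simp add: typical_def)
    have AAS: "A - (A - S) = S" using S by auto
    have finS: "finite (perms S)" "perms S \<noteq> {}" using S finite_A finite_subset by auto
    define \<Psi> where "\<Psi> r = expectation (\<lambda>\<omega>. F (max (bwd.half_sup \<omega> / 2) r))" for r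
    have intF: "integrable M (\<lambda>\<omega>. F (max (bwd.half_sup \<omega> / 2) r))" for r
      by (rule integrable_bounded_lipschitz[OF F]) measurable
    have \<Psi>: "bounded_lipschitz \<Psi>"
      unfolding bounded_lipschitz_def
    proof (intro conjI allI)
      fix r r'
      have "\<bar>\<Psi> r\<bar> \<le> expectation (\<lambda>\<omega>. \<bar>F (max (bwd.half_sup \<omega> / 2) r)\<bar>)" unfolding \<Psi>_def by (rule integral_abs_bound)
      also have "\<dots> \<le> expectation (\<lambda>\<omega>. 1)" by (rule integral_mono) (auto intro!: integrable_abs intF bounded_lipschitzD[OF F])
      finally show "\<bar>\<Psi> r\<bar> \<le> 1" by (simp add: prob_space)
      have "\<bar>\<Psi> r - \<Psi> r'\<bar> \<le> expectation (\<lambda>\<omega>. \<bar>F (max (bwd.half_sup \<omega> / 2) r) - F (max (bwd.half_sup \<omega> / 2) r')\<bar>)"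
        unfolding \<Psi>_def Bochner_Integration.integral_diff[OF intF intF, symmetric] by (rule integral_abs_bound)
      also have "\<dots> \<le> expectation (\<lambda>\<omega>. \<bar>r - r'\<bar>)"
      proof (rule integral_mono)
        fix \<omega>
        show "\<bar>F (max (bwd.half_sup \<omega> / 2) r) - F (max (bwd.half_sup \<omega> / 2) r')\<bar> \<le> \<bar>r - r'\<bar>"
          by (rule order_trans[OF bounded_lipschitzD(2)[OF F]]) (auto simp: max_def)
      qed (auto intro!: integrable_abs Bochner_Integration.integrable_diff intF)
      finally show "\<bar>\<Psi> r - \<Psi> r'\<bar> \<le> \<bar>r - r'\<bar>" by (simp add: prob_space)
    qed
    have inner: "\<bar>avg (perms (A - S)) (\<lambda>ws. F (max (runs_excess S ws) r / R)) - \<Psi> (r / R)\<bar> \<le> e / 2" for r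
    proof -
      have "\<bar>avg (perms (A - S)) (\<lambda>ws. F (max (runs_excess S ws / R) (r / R))) - \<Psi> (r / R)\<bar> \<le> e / 2"
        unfolding \<Psi>_def R_def
        by (rule bwd[OF cs n(2) typical_mono[OF ty(1)] dev bounded_lipschitz_max[OF F]]) (simp add: \<tau>_def)
      moreover have "max (runs_excess S ws) r / R = max (runs_excess S ws / R) (r / R)" for ws
        using R by (cases "R = 0") (auto simp: max_def divide_le_cancel)
      ultimately show ?thesis by simp
    qed
    have "norm (avg (perms S) (\<lambda>ys. avg (perms (A - S)) (\<lambda>ws. F (max (runs_excess S ws) (runs_excess (A - S) (rev ys)) / R)))
        - avg (perms S) (\<lambda>ys. \<Psi> (runs_excess (A - S) (rev ys) / R))) \<le> e / 2"
      by (rule norm_avg_diff_le[OF finS]) (use inner in simp)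
    moreover have "avg (perms S) (\<lambda>ys. \<Psi> (runs_excess (A - S) (rev ys) / R)) = avg (perms S) (\<lambda>ys. \<Psi> (runs_excess (A - S) ys / R))"
      by (rule avg_perms_rev)
    moreover have "\<bar>avg (perms (A - (A - S))) (\<lambda>ys. \<Psi> (runs_excess (A - S) ys / R)) - expectation (\<lambda>\<omega>. \<Psi> (fwd.half_sup \<omega> / 2))\<bar> \<le> e / 2"
      unfolding R_def
      by (rule fwd[OF cs n(1) typical_mono[OF ty(2)] _ \<Psi>]) (use dev dev_compl[OF S] in \<open>simp_all add: \<tau>_def\<close>)
    moreover have "expectation (\<lambda>\<omega>. F (parabolic_max B \<omega> / 2)) = expectation (\<lambda>\<omega>. \<Psi> (fwd.half_sup \<omega> / 2))"
      unfolding \<Psi>_def by (rule expectation_parabolic_max_split[OF F])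
    ultimately show ?thesis unfolding AAS R_def[symmetric] real_norm_def by linarith
  qed
  show ?thesis
  proof (intro exI[of _ \<tau>] conjI exI[of _ "max n1 n2"] allI impI, goal_cases)
    case 1
    show ?case using \<tau>1 \<tau>2 by (simp add: \<tau>_def)
  next
    case (2 A s S F)
    then show ?case by (intro main) auto
  qed
qed

end

section \<open>The cycle of \<open>n\<close> positions and its configuration at half filling\<close>

definition half :: "nat \<Rightarrow> nat" where "half n = nat \<lceil>real n / 2\<rceil>"

abbreviation next_pos :: "nat \<Rightarrow> nat \<Rightarrow> nat" where "next_pos n \<equiv> (\<lambda>k. k mod n + 1)"

lemma half_bound: "\<bar>2 * real (half n) - real n\<bar> \<le> 1"
proof -
  have c: "0 \<le> \<lceil>real n / 2\<rceil>" by simp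
  have "real_of_int \<lceil>real n / 2\<rceil> < real n / 2 + 1" by linarith
  then have "real_of_int (2 * \<lceil>real n / 2\<rceil>) < real_of_int (int n + 2)" by simp
  then have "2 * \<lceil>real n / 2\<rceil> \<le> int n + 1" by linarith
  then have "real_of_int (2 * \<lceil>real n / 2\<rceil>) \<le> real_of_int (int n + 1)" by (simp only: of_int_le_iff)
  then have "2 * real_of_int \<lceil>real n / 2\<rceil> \<le> real n + 1" by simp
  moreover have "real n / 2 \<le> real_of_int \<lceil>real n / 2\<rceil>" by linarith
  moreover have "real (half n) = real_of_int \<lceil>real n / 2\<rceil>" using c by (simp add: half_def)
  ultimately show ?thesis by linarith
qed

lemma half_le: "half n \<le> n" and half_less: "3 \<le> n \<Longrightarrow> half n < n" and half_ge: "9 \<le> n \<Longrightarrow> 4 \<le> half n \<and> 4 \<le> n - half n"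
  using half_bound[of n] by linarith+

lemma compl_half_bound: "\<bar>2 * real (n - half n) - real n\<bar> \<le> 1"
  using half_bound[of n] half_le[of n] by (simp add: of_nat_diff abs_le_iff)

lemma next_pos_eq: "k \<in> {1..n} \<Longrightarrow> next_pos n k = (if k = n then 1 else k + 1)"
  by auto

lemma cyclic_shift_next_pos:
  assumes "3 \<le> n" shows "cyclic_shift {1..n} (next_pos n)"
proof
  show "bij_betw (next_pos n) {1..n} {1..n}"
  proof (rule bij_betw_byWitness[where f' = "\<lambda>k. if k = 1 then n else k - 1"])
    show "\<forall>k\<in>{1..n}. (if next_pos n k = 1 then n else next_pos n k - 1) = k" using next_pos_eq assms by auto
    show "\<forall>k\<in>{1..n}. next_pos n (if k = 1 then n else k - 1) = k" using assms by auto
    show "next_pos n ` {1..n} \<subseteq> {1..n}" using next_pos_eq assms by auto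
  qed (use assms in auto)
  show "next_pos n k \<noteq> k" if "k \<in> {1..n}" for k using next_pos_eq[OF that] assms by auto
  show "next_pos n (next_pos n k) \<noteq> k" if k: "k \<in> {1..n}" for k
  proof -
    have "next_pos n k \<in> {1..n}" using next_pos_eq[OF k] k assms by auto
    then show ?thesis using next_pos_eq[OF k] next_pos_eq[of "next_pos n k" n] k assms by (auto split: if_splits)
  qed
qed simp

lemma chebyshev_bound_tendsto:
  fixes h :: "nat \<Rightarrow> nat"
  assumes "\<And>n. \<bar>2 * real (h n) - real n\<bar> \<le> 1"
  shows "(\<lambda>n. (9 / real n + pattern_prob n (h n) 4 2 - pattern_prob n (h n) 2 1 / 4 + 1 / 64) / \<tau>\<^sup>2) \<longlonglongrightarrow> 0"
proof -
  have 9: "(\<lambda>n. 9 / real n) \<longlonglongrightarrow> 0" by real_asymp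
  have "(\<lambda>n. (9 / real n + pattern_prob n (h n) 4 2 - pattern_prob n (h n) 2 1 / 4 + 1 / 64) * (1 / \<tau>\<^sup>2)) \<longlonglongrightarrow> (0 + 1 / 64 - (1 / 8) / 4 + 1 / 64) * (1 / \<tau>\<^sup>2)"
    by (intro tendsto_intros 9 pattern_prob_tendsto assms) auto
  then show ?thesis by simp
qed

text \<open>Typicality of the complement is asked separately: \<open>runs\<close> is invariant under
  complementation, \<open>pits\<close> is not.\<close>

definition nontypical :: "real \<Rightarrow> nat \<Rightarrow> nat set \<Rightarrow> bool" where
  "nontypical \<tau> n S \<longleftrightarrow> \<not> (cyclic_shift.typical {1..n} (next_pos n) \<tau> S \<and> cyclic_shift.typical {1..n} (next_pos n) \<tau> ({1..n} - S)
     \<and> \<bar>cyclic_shift.dev {1..n} (next_pos n) S\<bar> \<le> real n powr (3/5))"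

lemma nontypical_tendsto:
  assumes \<tau>: "0 < \<tau>"
  shows "(\<lambda>n. avg (subsets_of_card {1..n} (half n)) (\<lambda>S. of_bool (nontypical \<tau> n S)) :: real) \<longlonglongrightarrow> 0"
proof (rule Lim_null_comparison)
  define c where "c h n = (9 / real n + pattern_prob n h 4 2 - pattern_prob n h 2 1 / 4 + 1 / 64) / \<tau>\<^sup>2" for h n
  have "(\<lambda>n. real n powr (3/5) / real n) \<longlonglongrightarrow> 0" by real_asymp
  from order_tendstoD(2)[OF this \<tau>] have ev: "\<forall>\<^sub>F n in sequentially. real n powr (3/5) / real n < \<tau>" .
  show "\<forall>\<^sub>F n in sequentially. norm (avg (subsets_of_card {1..n} (half n)) (\<lambda>S. of_bool (nontypical \<tau> n S)) :: real)
     \<le> 2 * exp (- (real n powr (1/5) / 2)) + (c (half n) n + c (n - half n) n)"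
    using eventually_ge_at_top[of 9] ev
  proof eventually_elim
    case (elim n)
    interpret cyclic_shift "{1..n}" "next_pos n" by (rule cyclic_shift_next_pos) (use elim in simp)
    define X where "X = subsets_of_card {1..n} (half n)"
    \<comment> \<open>Once \<open>n^(3/5)\<close> is below \<open>\<tau> n\<close>, the bound on
      \<open>dev\<close> implies the corresponding clause of \<open>typical\<close> for the set and
      for its complement.\<close>
    have small: "real n powr (3/5) \<le> \<tau> * real n" using elim by (simp add: divide_less_eq)
    have h: "4 \<le> half n" "half n \<le> n" "4 \<le> n - half n" using half_ge[of n] half_le[of n] elim by auto
    have "avg X (\<lambda>S. of_bool (nontypical \<tau> n S) :: real) \<le> avg X (\<lambda>S. of_bool (real (card {1..n}) powr (3/5) \<le> \<bar>dev S\<bar>)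
       + (of_bool (\<tau> * card {1..n} < \<bar>pits S - real (card {1..n}) / 8\<bar>) + of_bool (\<tau> * card {1..n} < \<bar>pits ({1..n} - S) - real (card {1..n}) / 8\<bar>)))"
    proof (rule avg_mono)
      fix S assume "S \<in> X"
      then have S: "S \<subseteq> {1..n}" "card S = half n" by (auto simp: X_def subsets_of_card_def)
      have d: "dev ({1..n} - S) = dev S" by (rule dev_compl[OF S(1)])
      have c': "card ({1..n} - S) = n - half n" using S finite_subset[OF S(1)] by (simp add: card_Diff_subset)
      have "nontypical \<tau> n S \<longrightarrow> real n powr (3/5) \<le> \<bar>dev S\<bar> \<or> \<tau> * n < \<bar>pits S - real n / 8\<bar> \<or> \<tau> * n < \<bar>pits ({1..n} - S) - real n / 8\<bar>"
        unfolding nontypical_def typical_def d c' S(2) card_atLeastAtMost diff_Suc_1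
        using S(1) half_bound[of n] compl_half_bound[of n] small by (auto simp del: One_nat_def)
      then show "of_bool (nontypical \<tau> n S) \<le> (of_bool (real (card {1..n}) powr (3/5) \<le> \<bar>dev S\<bar>)
       + (of_bool (\<tau> * card {1..n} < \<bar>pits S - real (card {1..n}) / 8\<bar>) + of_bool (\<tau> * card {1..n} < \<bar>pits ({1..n} - S) - real (card {1..n}) / 8\<bar>)) :: real)"
        by auto
    qed
    also have "\<dots> = avg X (\<lambda>S. of_bool (real (card {1..n}) powr (3/5) \<le> \<bar>dev S\<bar>))
       + (avg X (\<lambda>S. of_bool (\<tau> * card {1..n} < \<bar>pits S - real (card {1..n}) / 8\<bar>))
       + avg (subsets_of_card {1..n} (card {1..n} - half n)) (\<lambda>S. of_bool (\<tau> * card {1..n} < \<bar>pits S - real (card {1..n}) / 8\<bar>)))"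
      unfolding avg_add X_def
      using avg_subsets_of_card_compl[of "{1..n}" "half n" "\<lambda>S. of_bool (\<tau> * card {1..n} < \<bar>pits S - real (card {1..n}) / 8\<bar>) :: real"] h by simp
    also have "\<dots> \<le> 2 * exp (- (real (card {1..n}) powr (1/5) / 2)) + (c (half n) n + c (n - half n) n)"
      unfolding X_def
    proof (intro add_mono)
      show "avg (subsets_of_card {1..n} (half n)) (\<lambda>S. of_bool (real (card {1..n}) powr (3/5) \<le> \<bar>dev S\<bar>) :: real) \<le> 2 * exp (- (real (card {1..n}) powr (1/5) / 2))"
        by (rule dev_tail) (use h in auto)
      show "avg (subsets_of_card {1..n} (half n)) (\<lambda>S. of_bool (\<tau> * card {1..n} < \<bar>pits S - real (card {1..n}) / 8\<bar>) :: real) \<le> c (half n) n"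
        using pits_chebyshev[of "half n" \<tau>] h \<tau> by (simp add: c_def)
      show "avg (subsets_of_card {1..n} (card {1..n} - half n)) (\<lambda>S. of_bool (\<tau> * card {1..n} < \<bar>pits S - real (card {1..n}) / 8\<bar>) :: real) \<le> c (n - half n) n"
        using pits_chebyshev[of "n - half n" \<tau>] h \<tau> by (simp add: c_def)
    qed
    finally have "avg X (\<lambda>S. of_bool (nontypical \<tau> n S) :: real) \<le> 2 * exp (- (real n powr (1/5) / 2)) + (c (half n) n + c (n - half n) n)" by simp
    moreover have "0 \<le> avg X (\<lambda>S. of_bool (nontypical \<tau> n S) :: real)" by (rule avg_nonneg) simp
    ultimately show ?case by (simp add: X_def)
  qed
  have "(\<lambda>n. 2 * exp (- (real n powr (1/5) / 2))) \<longlonglongrightarrow> 0" by real_asymp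
  then have "(\<lambda>n. 2 * exp (- (real n powr (1/5) / 2)) + (c (half n) n + c (n - half n) n)) \<longlonglongrightarrow> 0 + (0 + 0)"
    unfolding c_def by (intro tendsto_add chebyshev_bound_tendsto half_bound compl_half_bound)
  then show "(\<lambda>n. 2 * exp (- (real n powr (1/5) / 2)) + (c (half n) n + c (n - half n) n)) \<longlonglongrightarrow> 0" by simp
qed

definition scaled_excess :: "nat \<Rightarrow> nat list \<Rightarrow> real" where
  "scaled_excess n zs = cyclic_shift.excess {1..n} (next_pos n) (half n) zs / real n powr (1/3)"

text \<open>Averaging over the configuration at half filling: a nontypical one costs at most 2,
  since test functions take values in \<open>[-1, 1]\<close>.\<close>

lemma (in two_sided_brownian_motion) scaled_excess_limit:
  assumes e: "0 < e"
  shows "\<forall>\<^sub>F n in sequentially. \<forall>F. bounded_lipschitz F \<longrightarrow>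
    \<bar>avg (perms {1..n}) (\<lambda>zs. F (scaled_excess n zs)) - expectation (\<lambda>\<omega>. F (parabolic_max B \<omega> / 2))\<bar> \<le> e"
proof -
  have "0 < e / 2" using e by simp
  from two_sided_limit[OF this] obtain \<tau> :: real and n0 where \<tau>: "0 < \<tau>" and lim: "\<And>(A :: nat set) s S F. cyclic_shift A s \<Longrightarrow> n0 \<le> card A \<Longrightarrow> cyclic_shift.typical A s \<tau> S \<Longrightarrow>
    cyclic_shift.typical A s \<tau> (A - S) \<Longrightarrow> \<bar>cyclic_shift.dev A s S\<bar> \<le> card A powr (3/5) \<Longrightarrow> bounded_lipschitz F \<Longrightarrow>
    \<bar>avg (perms S) (\<lambda>ys. avg (perms (A - S)) (\<lambda>ws. F (max (cyclic_shift.runs_excess A s S ws) (cyclic_shift.runs_excess A s (A - S) (rev ys))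
       / card A powr (1/3)))) - expectation (\<lambda>\<omega>. F (parabolic_max B \<omega> / 2))\<bar> \<le> e / 2"
    by blast
  have "0 < e / 4" using e by simp
  from order_tendstoD(2)[OF nontypical_tendsto[OF \<tau>] this]
  have "\<forall>\<^sub>F n in sequentially. avg (subsets_of_card {1..n} (half n)) (\<lambda>S. of_bool (nontypical \<tau> n S)) < e / 4" .
  then show ?thesis using eventually_ge_at_top[of n0] eventually_ge_at_top[of 3]
  proof eventually_elim
    case (elim n)
    interpret cyclic_shift "{1..n}" "next_pos n" by (rule cyclic_shift_next_pos) (use elim in simp)
    define X where "X = subsets_of_card {1..n} (half n)"
    have X: "finite X" "X \<noteq> {}" unfolding X_def using half_le[of n] by (auto simp: finite_subsets_of_card subsets_of_card_nonempty)
    show ?case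
    proof (intro allI impI)
      fix F assume F: "bounded_lipschitz F"
      define E where "E = expectation (\<lambda>\<omega>. F (parabolic_max B \<omega> / 2))"
      define I where "I S = avg (perms S) (\<lambda>ys. avg (perms ({1..n} - S)) (\<lambda>ws. F (max (runs_excess S ws) (runs_excess ({1..n} - S) (rev ys))
       / real n powr (1/3))))" for S
      have E1: "\<bar>E\<bar> \<le> 1"
      proof -
        have "\<bar>E\<bar> \<le> expectation (\<lambda>\<omega>. \<bar>F (parabolic_max B \<omega> / 2)\<bar>)" unfolding E_def by (rule integral_abs_bound)
        also have "\<dots> \<le> expectation (\<lambda>\<omega>. 1)"
          by (rule integral_mono) (auto intro!: integrable_abs integrable_bounded_lipschitz[OF F] bounded_lipschitzD[OF F])
        finally show ?thesis by (simp add: prob_space)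
      qed
      have "avg (perms {1..n}) (\<lambda>zs. F (scaled_excess n zs)) = avg X I"
        unfolding scaled_excess_def X_def I_def
        using avg_excess_split[of "half n" "\<lambda>x. F (x / real n powr (1/3))"] half_le[of n] by simp
      moreover have "\<bar>avg X I - E\<bar> \<le> e"
      proof -
        have "\<bar>avg X I - E\<bar> = \<bar>avg X (\<lambda>S. I S - E)\<bar>" unfolding avg_diff avg_const[OF X] ..
        also have "\<dots> \<le> avg X (\<lambda>S. \<bar>I S - E\<bar>)" using norm_avg_le[of X "\<lambda>S. I S - E"] by simp
        also have "\<dots> \<le> avg X (\<lambda>S. e / 2 + 2 * of_bool (nontypical \<tau> n S))"
        proof (rule avg_mono)
          fix S assume "S \<in> X"
          then have S: "S \<subseteq> {1..n}" by (auto simp: X_def subsets_of_card_def)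
          show "\<bar>I S - E\<bar> \<le> e / 2 + 2 * of_bool (nontypical \<tau> n S)"
          proof (cases "nontypical \<tau> n S")
            case False
            then have "typical \<tau> S" "typical \<tau> ({1..n} - S)" "\<bar>dev S\<bar> \<le> real (card {1..n}) powr (3/5)"
              by (simp_all only: nontypical_def not_not card_atLeastAtMost diff_Suc_1)
            from lim[OF cyclic_shift_axioms _ this F] have "\<bar>I S - E\<bar> \<le> e / 2"
              unfolding I_def E_def card_atLeastAtMost diff_Suc_1 using elim(2) by blast
            then show ?thesis using False by simp
          next
            case True
            have "I S \<le> 1" "- I S \<le> 1"
            proof -
              have fin: "finite (perms S)" "perms S \<noteq> {}" "finite (perms ({1..n} - S))" "perms ({1..n} - S) \<noteq> {}"
                using finite_subset[OF S] by auto
              have "\<bar>I S\<bar> \<le> 1"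
                unfolding I_def by (intro abs_avg_le fin bounded_lipschitzD(1)[OF F])
              then show "I S \<le> 1" "- I S \<le> 1" by auto
            qed
            then show ?thesis using True E1 e by (simp add: abs_le_iff)
          qed
        qed
        also have "\<dots> = e / 2 + 2 * avg X (\<lambda>S. of_bool (nontypical \<tau> n S))"
          unfolding avg_add avg_mult_left avg_const[OF X] ..
        also have "\<dots> \<le> e" using elim(1) unfolding X_def by linarith
        finally show ?thesis .
      qed
      ultimately show "\<bar>avg (perms {1..n}) (\<lambda>zs. F (scaled_excess n zs)) - expectation (\<lambda>\<omega>. F (parabolic_max B \<omega> / 2))\<bar> \<le> e"
        by (simp add: E_def)
    qed
  qed
qed

subsection \<open>Uniform integrability\<close>

text \<open>A discrete layer-cake formula, to convert tail bounds at integer levels into a bound on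
  a truncated mean.\<close>

lemma pos_part_le_sum:
  assumes "u \<le> real n"
  shows "max 0 (u - real T) \<le> (\<Sum>k\<in>{T..<n}. of_bool (real k \<le> u))"
proof (cases "u \<le> real T")
  case True
  then show ?thesis by (simp add: sum_nonneg)
next
  case False
  define m where "m = min (nat \<lfloor>u\<rfloor> + 1) n"
  have u: "u \<le> real m" "0 \<le> u" using assms False by (auto simp: m_def min_def) linarith+
  have "(\<Sum>k\<in>{T..<m}. 1) \<le> (\<Sum>k\<in>{T..<n}. of_bool (real k \<le> u) :: real)"
  proof (rule sum_le_included[where i = "\<lambda>k. k"])
    show "\<forall>k\<in>{T..<m}. \<exists>l\<in>{T..<n}. l = k \<and> (1::real) \<le> of_bool (real l \<le> u)"
    proof
      fix k assume k: "k \<in> {T..<m}"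
      then have "k \<le> nat \<lfloor>u\<rfloor>" by (auto simp: m_def)
      moreover have "0 \<le> \<lfloor>u\<rfloor>" using u(2) by simp
      ultimately have "int k \<le> \<lfloor>u\<rfloor>" by linarith
      then have "real k \<le> u" by linarith
      then show "\<exists>l\<in>{T..<n}. l = k \<and> (1::real) \<le> of_bool (real l \<le> u)" using k by (intro bexI[of _ k]) (auto simp: m_def)
    qed
  qed auto
  then show ?thesis using u False by simp
qed

lemma geometric_tail_le:
  fixes q :: real
  assumes "0 < q" "q < 1" shows "(\<Sum>k\<in>{T..<n}. q ^ k) \<le> q ^ T / (1 - q)"
proof (cases "T \<le> n")
  case True
  have "(1 - q) * (\<Sum>k\<in>{T..<T + d}. q ^ k) = q ^ T - q ^ (T + d)" for d
  proof (induction d)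
    case (Suc d)
    have "(1 - q) * (\<Sum>k\<in>{T..<T + Suc d}. q ^ k) = (1 - q) * (\<Sum>k\<in>{T..<T + d}. q ^ k) + (1 - q) * q ^ (T + d)"
      by (simp add: distrib_left)
    also have "\<dots> = q ^ T - q ^ (T + Suc d)" unfolding Suc.IH by (simp add: left_diff_distrib)
    finally show ?case .
  qed simp
  then have "(\<Sum>k\<in>{T..<T + d}. q ^ k) = (q ^ T - q ^ (T + d)) / (1 - q)" for d
    using assms by (simp add: eq_divide_eq mult.commute)
  from this[of "n - T"] True have "(\<Sum>k\<in>{T..<n}. q ^ k) = (q ^ T - q ^ n) / (1 - q)" by simp
  also have "\<dots> \<le> q ^ T / (1 - q)" using assms by (intro divide_right_mono) auto
  finally show ?thesis .
qed (use assms in simp)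

text \<open>The tails from \<open>excess_tail\<close> are summed over integer levels. The sum stops
  at \<open>n\<close> because the excess never exceeds \<open>n\<close> and
  \<open>R \<ge> 1\<close>.\<close>

lemma (in cyclic_shift) excess_pos_part:
  fixes R \<Lambda> :: real
  assumes S0: "S0 \<subseteq> A" and half: "\<bar>2 * real (card S0) - real (card A)\<bar> \<le> 1" and n6: "6 \<le> card A"
    and \<Lambda>: "\<bar>dev S0\<bar> \<le> \<Lambda>" "1 \<le> \<Lambda>" and R: "1 \<le> R" "R ^ 3 = card A" "72 * \<Lambda>\<^sup>2 / card A \<le> R / 8"
    and T: "1 \<le> T"
  shows "avg (perms (A - S0)) (\<lambda>xs. max 0 (runs_excess S0 xs / R - real T)) \<le> 2 * (exp (- 1 / 2) ^ T / (1 - exp (- 1 / 2)))"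
proof -
  have R0: "0 < R" using R by simp
  have "avg (perms (A - S0)) (\<lambda>xs. max 0 (runs_excess S0 xs / R - real T))
     \<le> avg (perms (A - S0)) (\<lambda>xs. \<Sum>k\<in>{T..<card A}. of_bool (real k * R \<le> runs_excess S0 xs))"
  proof (rule avg_mono)
    fix xs
    have "runs_excess S0 xs \<le> card A" by (rule runs_excess_le_card)
    also have "\<dots> \<le> card A * R" using mult_left_mono[OF R(1), of "real (card A)"] by simp
    finally have "runs_excess S0 xs / R \<le> card A" using R0 by (simp add: divide_le_eq)
    from pos_part_le_sum[OF this, of T]
    show "max 0 (runs_excess S0 xs / R - real T) \<le> (\<Sum>k\<in>{T..<card A}. of_bool (real k * R \<le> runs_excess S0 xs))"
      using R0 by (simp add: le_divide_eq)
  qed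
  also have "\<dots> = (\<Sum>k\<in>{T..<card A}. avg (perms (A - S0)) (\<lambda>xs. of_bool (real k * R \<le> runs_excess S0 xs)))"
    by (rule avg_sum)
  also have "\<dots> \<le> (\<Sum>k\<in>{T..<card A}. 2 * exp (- 1 / 2) ^ k)"
  proof (rule sum_mono)
    fix k assume "k \<in> {T..<card A}"
    then have "1 \<le> real k" using T by simp
    from excess_tail[OF S0 half n6 \<Lambda> R0 R(2,3) this]
    show "avg (perms (A - S0)) (\<lambda>xs. of_bool (real k * R \<le> runs_excess S0 xs) :: real) \<le> 2 * exp (- 1 / 2) ^ k"
      by (simp add: exp_of_nat_mult[symmetric])
  qed
  also have "\<dots> = 2 * (\<Sum>k\<in>{T..<card A}. exp (- 1 / 2) ^ k)" by (simp add: sum_distrib_left)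
  also have "\<dots> \<le> 2 * (exp (- 1 / 2) ^ T / (1 - exp (- 1 / 2)))" by (intro mult_left_mono geometric_tail_le) auto
  finally show ?thesis .
qed

text \<open>When \<open>dev\<close> is within \<open>n^(3/5)\<close>, both directions have geometric
  tails. Otherwise the excess is still at most \<open>n\<close>, against a probability of at most
  \<open>2 exp (- n^(1/5) / 2)\<close>, and the product tends to 0.\<close>

lemma scaled_excess_uniformly_integrable:
  assumes e: "0 < e"
  shows "\<exists>T. 1 \<le> T \<and> (\<forall>\<^sub>F n in sequentially. avg (perms {1..n}) (\<lambda>zs. max 0 (scaled_excess n zs - real T)) \<le> e)"
proof -
  define q where "q = exp (- 1 / 2 :: real)"
  have q: "0 < q" "q < 1" by (auto simp: q_def)
  have "(\<lambda>T. 4 * (q ^ T / (1 - q))) \<longlonglongrightarrow> 4 * (0 / (1 - q))" using q by (intro tendsto_intros LIMSEQ_realpow_zero) auto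
  then have "(\<lambda>T. 4 * (q ^ T / (1 - q))) \<longlonglongrightarrow> 0" by simp
  moreover have "0 < e / 2" using e by simp
  ultimately have "\<forall>\<^sub>F T in sequentially. 4 * (q ^ T / (1 - q)) < e / 2" by (rule order_tendstoD(2))
  then have "\<forall>\<^sub>F T in sequentially. 4 * (q ^ T / (1 - q)) < e / 2 \<and> 1 \<le> T"
    using eventually_ge_at_top[of 1] by eventually_elim auto
  then obtain T where T: "4 * (q ^ T / (1 - q)) < e / 2" "1 \<le> T" by (auto simp: eventually_sequentially)
  have "(\<lambda>n. real n * (2 * exp (- (real n powr (1/5) / 2)))) \<longlonglongrightarrow> 0" by real_asymp
  from order_tendstoD(2)[OF this \<open>0 < e / 2\<close>]
  have "\<forall>\<^sub>F n in sequentially. real n * (2 * exp (- (real n powr (1/5) / 2))) < e / 2" .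
  moreover have "\<forall>\<^sub>F n in sequentially. 72 * (real n powr (3/5))\<^sup>2 / real n \<le> real n powr (1/3) / 8" by real_asymp
  ultimately have "\<forall>\<^sub>F n in sequentially. avg (perms {1..n}) (\<lambda>zs. max 0 (scaled_excess n zs - real T)) \<le> e"
    using eventually_ge_at_top[of 9]
  proof eventually_elim
    case (elim n)
    interpret cyclic_shift "{1..n}" "next_pos n" by (rule cyclic_shift_next_pos) (use elim in simp)
    define X where "X = subsets_of_card {1..n} (half n)"
    define R where "R = real n powr (1/3)"
    define \<Lambda> where "\<Lambda> = real n powr (3/5)"
    define Q where "Q = 2 * (q ^ T / (1 - q))"
    have X: "finite X" "X \<noteq> {}" unfolding X_def using half_le[of n] by (auto simp: finite_subsets_of_card subsets_of_card_nonempty)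
    have R: "1 \<le> R" "R ^ 3 = card {1..n}" using elim(3) by (simp_all add: R_def powr_power ge_one_powr_ge_zero)
    have \<Lambda>: "1 \<le> \<Lambda>" using elim(3) by (simp add: \<Lambda>_def ge_one_powr_ge_zero)
    have Q0: "0 \<le> Q" using q by (simp add: Q_def)
    have inner: "avg (perms S) (\<lambda>ys. avg (perms ({1..n} - S)) (\<lambda>ws. max 0 (max (runs_excess S ws) (runs_excess ({1..n} - S) (rev ys)) / R - real T)))
       \<le> 2 * Q + real n * of_bool (real (card {1..n}) powr (3/5) \<le> \<bar>dev S\<bar>)" if "S \<in> X" for S
    proof -
      have S: "S \<subseteq> {1..n}" "card S = half n" using that by (auto simp: X_def subsets_of_card_def)
      have fin: "finite (perms S)" "perms S \<noteq> {}" "finite (perms ({1..n} - S))" "perms ({1..n} - S) \<noteq> {}"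
        using finite_subset[OF S(1)] by auto
      show ?thesis
      proof (cases "\<bar>dev S\<bar> \<le> \<Lambda>")
        case True
        have AAS: "{1..n} - ({1..n} - S) = S" using S by auto
        have c': "card ({1..n} - S) = n - half n" using S finite_subset[OF S(1)] by (simp add: card_Diff_subset)
        have a: "avg (perms ({1..n} - S)) (\<lambda>ws. max 0 (runs_excess S ws / R - real T)) \<le> Q"
          unfolding Q_def q_def
          by (rule excess_pos_part[OF S(1) _ _ True \<Lambda> R _ T(2)]) (use elim S half_bound[of n] in \<open>auto simp: R_def \<Lambda>_def\<close>)
        have "avg (perms ({1..n} - ({1..n} - S))) (\<lambda>ws. max 0 (runs_excess ({1..n} - S) ws / R - real T)) \<le> Q"
          unfolding Q_def q_def
          by (rule excess_pos_part[OF _ _ _ _ \<Lambda> R _ T(2)]) (use elim S compl_half_bound[of n] True dev_compl[OF S(1)] c' in \<open>auto simp: R_def \<Lambda>_def\<close>)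
        then have b: "avg (perms S) (\<lambda>ys. max 0 (runs_excess ({1..n} - S) (rev ys) / R - real T)) \<le> Q"
          unfolding AAS using avg_perms_rev[of S "\<lambda>ys. max 0 (runs_excess ({1..n} - S) ys / R - real T)"] by simp
        have "avg (perms S) (\<lambda>ys. avg (perms ({1..n} - S)) (\<lambda>ws. max 0 (max (runs_excess S ws) (runs_excess ({1..n} - S) (rev ys)) / R - real T)))
          \<le> avg (perms S) (\<lambda>ys. avg (perms ({1..n} - S)) (\<lambda>ws. max 0 (runs_excess S ws / R - real T) + max 0 (runs_excess ({1..n} - S) (rev ys) / R - real T)))"
          by (intro avg_mono) (auto simp: max_def)
        also have "\<dots> = avg (perms ({1..n} - S)) (\<lambda>ws. max 0 (runs_excess S ws / R - real T)) + avg (perms S) (\<lambda>ys. max 0 (runs_excess ({1..n} - S) (rev ys) / R - real T))"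
          unfolding avg_add avg_const[OF fin(3,4)] avg_const[OF fin(1,2)] ..
        also have "\<dots> \<le> 2 * Q" using a b by simp
        finally show ?thesis by (rule order_trans) simp
      next
        case False
        have "avg (perms S) (\<lambda>ys. avg (perms ({1..n} - S)) (\<lambda>ws. max 0 (max (runs_excess S ws) (runs_excess ({1..n} - S) (rev ys)) / R - real T))) \<le> real n"
        proof (rule avg_le_const[OF fin(1,2)], rule avg_le_const[OF fin(3,4)])
          fix ys ws
          have le: "runs_excess U vs \<le> real n" for U vs using runs_excess_le_card[of U vs] by simp
          have "max (runs_excess S ws) (runs_excess ({1..n} - S) (rev ys)) \<le> real n * R"
            using le[of S ws] le[of "{1..n} - S" "rev ys"] mult_left_mono[OF R(1), of "real n"] by simp
          then have "max (runs_excess S ws) (runs_excess ({1..n} - S) (rev ys)) / R \<le> real n" using R by (simp add: divide_le_eq)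
          then show "max 0 (max (runs_excess S ws) (runs_excess ({1..n} - S) (rev ys)) / R - real T) \<le> real n" by simp
        qed
        then show ?thesis using False Q0 by (simp add: \<Lambda>_def)
      qed
    qed
    have "avg (perms {1..n}) (\<lambda>zs. max 0 (scaled_excess n zs - real T))
      = avg X (\<lambda>S. avg (perms S) (\<lambda>ys. avg (perms ({1..n} - S)) (\<lambda>ws. max 0 (max (runs_excess S ws) (runs_excess ({1..n} - S) (rev ys)) / R - real T))))"
      unfolding scaled_excess_def X_def R_def
      using avg_excess_split[of "half n" "\<lambda>x. max 0 (x / real n powr (1/3) - real T)"] half_le[of n] by simp
    also have "\<dots> \<le> avg X (\<lambda>S. 2 * Q + real n * of_bool (real (card {1..n}) powr (3/5) \<le> \<bar>dev S\<bar>))"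
      by (rule avg_mono[OF inner])
    also have "\<dots> = 2 * Q + real n * avg X (\<lambda>S. of_bool (real (card {1..n}) powr (3/5) \<le> \<bar>dev S\<bar>))"
      unfolding avg_add avg_mult_left avg_const[OF X] ..
    also have "\<dots> \<le> 2 * Q + real n * (2 * exp (- (real (card {1..n}) powr (1/5) / 2)))"
      unfolding X_def by (intro add_left_mono mult_left_mono dev_tail) (use half_le[of n] elim in auto)
    also have "\<dots> \<le> e" using elim(1) T(1) by (simp add: Q_def)
    finally show ?case .
  qed
  then show ?thesis using T(2) by blast
qed

subsection \<open>Runs of a random permutation\<close>

lemma run_indicator_image:
  assumes \<sigma>: "\<sigma> permutes {1..n}" and k: "k \<in> {1..n}"
  shows "run_indicator m \<sigma> k = of_bool (k \<in> \<sigma> ` {1..m})"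
proof -
  have "inv \<sigma> k \<in> {1..n}" using permutes_inv[OF \<sigma>] k permutes_in_image by metis
  moreover have "\<sigma> (inv \<sigma> k) = k" "\<And>i. inv \<sigma> (\<sigma> i) = i" using permutes_inverses[OF \<sigma>] by auto
  ultimately have "inv \<sigma> k \<le> m \<longleftrightarrow> k \<in> \<sigma> ` {1..m}" by (metis atLeastAtMost_iff image_iff)
  then show ?thesis by (simp add: run_indicator_def)
qed

lemma num_runs_eq_runs:
  assumes n: "3 \<le> n" and \<sigma>: "\<sigma> permutes {1..n}"
  shows "num_runs n m \<sigma> = cyclic_shift.runs {1..n} (next_pos n) (\<sigma> ` {1..m}) + of_bool (1 \<in> \<sigma> ` {1..m} \<and> n \<in> \<sigma> ` {1..m})"
proof -
  interpret cyclic_shift "{1..n}" "next_pos n" by (rule cyclic_shift_next_pos[OF n])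
  define S where "S = \<sigma> ` {1..m}"
  have ind: "run_indicator m \<sigma> k = of_bool (k \<in> S)" if "k \<in> {1..n}" for k
    unfolding S_def by (rule run_indicator_image[OF \<sigma> that])
  have "num_runs n m \<sigma> = of_bool (1 \<in> S) + (\<Sum>k = 1..n - 1. of_bool (k \<notin> S \<and> k + 1 \<in> S))"
    unfolding num_runs_def using n
    by (intro arg_cong2[where f = "(+)"] sum.cong) (auto simp: ind simp del: One_nat_def)
  moreover have "runs S = (\<Sum>k = 1..n - 1. of_bool (k \<notin> S \<and> k + 1 \<in> S)) + of_bool (n \<notin> S \<and> 1 \<in> S)"
  proof -
    have "{1..n} = insert n {1..n - 1}" "n \<notin> {1..n - 1}" using n by auto
    then have "runs S = of_bool (n \<notin> S \<and> next_pos n n \<in> S) + (\<Sum>k = 1..n - 1. of_bool (k \<notin> S \<and> next_pos n k \<in> S))"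
      unfolding runs_def by simp
    moreover have "(\<Sum>k = 1..n - 1. of_bool (k \<notin> S \<and> next_pos n k \<in> S) :: real) = (\<Sum>k = 1..n - 1. of_bool (k \<notin> S \<and> k + 1 \<in> S))"
      using n by (intro sum.cong) auto
    ultimately show ?thesis by simp
  qed
  ultimately show ?thesis unfolding S_def[symmetric] by auto
qed

lemma set_take_map_upt:
  assumes "m \<le> n" shows "set (take m (map \<sigma> [1..<Suc n])) = \<sigma> ` {1..m}"
proof -
  have "take m [1..<Suc n] = [1..<Suc m]" using assms by (simp add: take_upt del: upt_Suc)
  then show ?thesis by (simp add: take_map atLeastLessThanSuc_atLeastAtMost del: upt_Suc)
qed

lemma bij_betw_map_upt: "bij_betw (\<lambda>\<sigma>. map \<sigma> [1..<Suc n]) {\<sigma>. \<sigma> permutes {1..n}} (perms {1..n})"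
proof -
  let ?f = "\<lambda>\<sigma> :: nat \<Rightarrow> nat. map \<sigma> [1..<Suc n]"
  have inj: "inj_on ?f {\<sigma>. \<sigma> permutes {1..n}}"
  proof (rule inj_onI, rule ext)
    fix \<sigma> \<tau> k assume a: "\<sigma> \<in> {\<sigma>. \<sigma> permutes {1..n}}" "\<tau> \<in> {\<sigma>. \<sigma> permutes {1..n}}" "?f \<sigma> = ?f \<tau>"
    show "\<sigma> k = \<tau> k"
    proof (cases "k \<in> {1..n}")
      case True
      then show ?thesis using a(3) by (auto simp: map_eq_conv simp del: upt_Suc)
    next
      case False
      then show ?thesis using a(1,2) by (auto simp: permutes_def)
    qed
  qed
  have sub: "?f ` {\<sigma>. \<sigma> permutes {1..n}} \<subseteq> perms {1..n}"
  proof clarify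
    fix \<sigma> assume \<sigma>: "\<sigma> permutes {1..n}"
    have "set (?f \<sigma>) = {1..n}" using permutes_image[OF \<sigma>] by (simp add: atLeastLessThanSuc_atLeastAtMost del: upt_Suc)
    moreover have "distinct (?f \<sigma>)" using permutes_inj_on[OF \<sigma>] by (simp add: distinct_map del: upt_Suc)
    ultimately show "?f \<sigma> \<in> perms {1..n}" by (simp add: permutations_of_set_def del: upt_Suc)
  qed
  have "card (?f ` {\<sigma>. \<sigma> permutes {1..n}}) = card (perms {1..n})"
    using card_image[OF inj] card_permutations[of "{1..n}" n] by simp
  then have "?f ` {\<sigma>. \<sigma> permutes {1..n}} = perms {1..n}" using sub by (intro card_subset_eq) auto
  then show ?thesis using inj by (simp add: bij_betw_def)
qed

text \<open>Linear counts \<open>x\<close> and cyclic counts \<open>c\<close> satisfy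
  \<open>c \<le> x \<le> c + 1\<close>, so a difference between two times is off by at most 1, not
  2.\<close>

lemma max_runs_vs_excess:
  assumes n: "3 \<le> n" and \<sigma>: "\<sigma> permutes {1..n}"
  shows "\<bar>max_num_runs n \<sigma> - num_runs n (half n) \<sigma> - cyclic_shift.excess {1..n} (next_pos n) (half n) (map \<sigma> [1..<Suc n])\<bar> \<le> 1"
proof -
  interpret cyclic_shift "{1..n}" "next_pos n" by (rule cyclic_shift_next_pos[OF n])
  define zs where "zs = map \<sigma> [1..<Suc n]"
  have len: "length zs = n" by (simp add: zs_def)
  define h where "h = half n"
  have h: "h \<le> n" using half_le by (simp add: h_def)
  define x where "x m = num_runs n m \<sigma>" for m
  define c where "c m = runs (set (take m zs))" for m
  have xc: "c m \<le> x m" "x m \<le> c m + 1" if "m \<le> n" for m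
    unfolding x_def c_def zs_def set_take_map_upt[OF that] num_runs_eq_runs[OF n \<sigma>] by auto
  have M: "max_num_runs n \<sigma> = Max (x ` {0..n})" by (simp add: max_num_runs_def x_def)
  have E: "excess h zs \<le> u \<longleftrightarrow> (\<forall>m\<le>n. c m - c h \<le> u)" for u
    unfolding excess_le_iff len c_def ..
  have "Max (x ` {0..n}) \<le> x h + excess h zs + 1"
  proof (rule Max.boundedI)
    fix y assume "y \<in> x ` {0..n}"
    then obtain m where m: "m \<le> n" "y = x m" by auto
    then show "y \<le> x h + excess h zs + 1" using E[of "excess h zs"] xc(2)[OF m(1)] xc(1)[OF h] by fastforce
  qed auto
  moreover have "excess h zs \<le> Max (x ` {0..n}) - x h + 1"
    unfolding E
  proof (intro allI impI)
    fix m assume m: "m \<le> n"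
    then have "x m \<le> Max (x ` {0..n})" by (intro Max_ge) auto
    then show "c m - c h \<le> Max (x ` {0..n}) - x h + 1" using xc(1)[OF m] xc(2)[OF h] by simp
  qed
  ultimately show ?thesis unfolding M h_def x_def zs_def by linarith
qed

lemma expectation_random_perm:
  "measure_pmf.expectation (random_perm n) f = avg {\<sigma>. \<sigma> permutes {1..n}} (f :: _ \<Rightarrow> real)"
  unfolding random_perm_def
  by (rule integral_pmf_of_set_avg) (auto simp: finite_permutations intro: permutes_id)

text \<open>The factor \<open>min 1 (y - x)\<close> brings both the height 1 and the slope
  \<open>1 / (y - x)\<close> of the ramp to at most 1.\<close>

lemma cts_step_bounded_lipschitz:
  assumes "x < y" shows "bounded_lipschitz (\<lambda>t. min 1 (y - x) * cts_step x y t)"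
proof -
  define d where "d = min 1 (y - x)"
  have d: "0 < d" "d \<le> 1" "d \<le> y - x" using assms by (auto simp: d_def)
  have range: "0 \<le> cts_step x y t" "cts_step x y t \<le> 1" for t
    using assms by (auto simp: cts_step_def divide_simps)
  have step: "cts_step x y t = min 1 (max 0 ((y - t) / (y - x)))" for t
    using assms by (auto simp: cts_step_def min_def max_def divide_simps)
  have lip: "\<bar>cts_step x y s - cts_step x y t\<bar> \<le> \<bar>s - t\<bar> / (y - x)" for s t
  proof -
    have "\<bar>cts_step x y s - cts_step x y t\<bar> \<le> \<bar>(y - s) / (y - x) - (y - t) / (y - x)\<bar>"
      unfolding step by (auto simp: min_def max_def abs_if)
    also have "\<dots> = \<bar>s - t\<bar> / (y - x)"
      using assms by (simp add: diff_divide_distrib[symmetric] abs_divide abs_minus_commute)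
    finally show ?thesis .
  qed
  show ?thesis
    unfolding bounded_lipschitz_def d_def[symmetric]
  proof (intro conjI allI)
    fix s t
    show "\<bar>d * cts_step x y t\<bar> \<le> 1" using range[of t] d by (simp add: abs_mult mult_le_one)
    have "\<bar>d * cts_step x y s - d * cts_step x y t\<bar> = d * \<bar>cts_step x y s - cts_step x y t\<bar>"
      unfolding right_diff_distrib[symmetric] abs_mult using d by simp
    also have "\<dots> \<le> d * (\<bar>s - t\<bar> / (y - x))" using lip d by (intro mult_left_mono) auto
    also have "\<dots> = (d / (y - x)) * \<bar>s - t\<bar>" by simp
    also have "\<dots> \<le> 1 * \<bar>s - t\<bar>" using d by (intro mult_right_mono) auto
    finally show "\<bar>d * cts_step x y s - d * cts_step x y t\<bar> \<le> \<bar>s - t\<bar>" by simp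
  qed
qed

definition scaled_gap :: "nat \<Rightarrow> (nat \<Rightarrow> nat) \<Rightarrow> real" where
  "scaled_gap n \<sigma> = real n powr (-1/3) * (max_num_runs n \<sigma> - num_runs n (half n) \<sigma>)"

lemma scaled_gap_vs_excess:
  assumes n: "3 \<le> n" and \<sigma>: "\<sigma> permutes {1..n}"
  shows "\<bar>scaled_gap n \<sigma> - scaled_excess n (map \<sigma> [1..<Suc n])\<bar> \<le> real n powr (-1/3)"
proof -
  define d where "d = max_num_runs n \<sigma> - num_runs n (half n) \<sigma> - cyclic_shift.excess {1..n} (next_pos n) (half n) (map \<sigma> [1..<Suc n])"
  have "scaled_gap n \<sigma> - scaled_excess n (map \<sigma> [1..<Suc n]) = real n powr (-1/3) * d"
    unfolding scaled_gap_def scaled_excess_def d_def by (simp add: powr_minus_divide algebra_simps diff_divide_distrib)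
  moreover have "\<bar>d\<bar> \<le> 1" unfolding d_def by (rule max_runs_vs_excess[OF n \<sigma>])
  ultimately show ?thesis by (simp add: abs_mult mult_left_le)
qed

lemma permutes_finite_nonempty: "finite {\<sigma>. \<sigma> permutes {1..n::nat}}" "{\<sigma>. \<sigma> permutes {1..n::nat}} \<noteq> {}"
  by (auto simp: finite_permutations intro: permutes_id)

text \<open>One unit of error comes from the seam of the cycle, the other from
  \<open>run_mean\<close> at half filling.\<close>

lemma half_mean_bound:
  assumes n: "4 \<le> n"
  shows "\<bar>avg {\<sigma>. \<sigma> permutes {1..n}} (num_runs n (half n)) - real n / 4\<bar> \<le> 2"
proof -
  interpret cyclic_shift "{1..n}" "next_pos n" by (rule cyclic_shift_next_pos) (use n in simp)
  define P where "P = {\<sigma>. \<sigma> permutes {1..n}}"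
  have h: "1 \<le> half n" "half n < card {1..n}" "half n \<le> n" using half_bound[of n] n half_less[of n] half_le[of n] by auto
  have "avg P (\<lambda>\<sigma>. runs (\<sigma> ` {1..half n})) = avg P (\<lambda>\<sigma>. runs (set (take (half n) (map \<sigma> [1..<Suc n]))))"
    unfolding set_take_map_upt[OF h(3)] ..
  also have "\<dots> = avg (perms {1..n}) (\<lambda>zs. runs (set (take (half n) zs)))"
    unfolding P_def by (rule avg_reindex[OF bij_betw_map_upt])
  also have "\<dots> = avg (subsets_of_card {1..n} (half n)) runs"
    by (rule avg_perms_take) (use h in auto)
  also have "\<dots> = run_mean (half n)" by (rule avg_runs[OF h(1,2)])
  finally have runs: "avg P (\<lambda>\<sigma>. runs (\<sigma> ` {1..half n})) = run_mean (half n)" .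
  have "norm (avg P (num_runs n (half n)) - avg P (\<lambda>\<sigma>. runs (\<sigma> ` {1..half n}))) \<le> 1"
  proof (rule norm_avg_diff_le)
    fix \<sigma> assume "\<sigma> \<in> P"
    then have "\<sigma> permutes {1..n}" by (simp add: P_def)
    then show "norm (num_runs n (half n) \<sigma> - runs (\<sigma> ` {1..half n})) \<le> 1"
      using num_runs_eq_runs[of n \<sigma> "half n"] n by simp
  qed (use permutes_finite_nonempty in \<open>auto simp: P_def\<close>)
  moreover have "\<bar>run_mean (half n) - real (card {1..n}) / 4\<bar> \<le> 1"
    by (rule run_mean_half) (use half_bound[of n] n in auto)
  ultimately show ?thesis unfolding runs unfolding P_def real_norm_def card_atLeastAtMost diff_Suc_1 by linarith
qed

section \<open>Limit law and limit of the means\<close>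

context two_sided_brownian_motion
begin

lemma scaled_gap_limit:
  assumes F: "bounded_lipschitz F"
  shows "(\<lambda>n. avg {\<sigma>. \<sigma> permutes {1..n}} (\<lambda>\<sigma>. F (scaled_gap n \<sigma>))) \<longlonglongrightarrow> expectation (\<lambda>\<omega>. F (parabolic_max B \<omega> / 2))"
proof -
  have "(\<lambda>n. avg (perms {1..n}) (\<lambda>zs. F (scaled_excess n zs))) \<longlonglongrightarrow> expectation (\<lambda>\<omega>. F (parabolic_max B \<omega> / 2))"
    unfolding tendsto_iff dist_real_def
  proof (intro allI impI)
    fix e :: real assume "0 < e"
    then have "0 < e / 2" by simp
    from scaled_excess_limit[OF this] show "\<forall>\<^sub>F n in sequentially. \<bar>avg (perms {1..n}) (\<lambda>zs. F (scaled_excess n zs)) - expectation (\<lambda>\<omega>. F (parabolic_max B \<omega> / 2))\<bar> < e"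
      by eventually_elim (use F \<open>0 < e\<close> in fastforce)
  qed
  moreover have "(\<lambda>n. avg {\<sigma>. \<sigma> permutes {1..n}} (\<lambda>\<sigma>. F (scaled_gap n \<sigma>)) - avg (perms {1..n}) (\<lambda>zs. F (scaled_excess n zs))) \<longlonglongrightarrow> 0"
  proof (rule Lim_null_comparison)
    show "\<forall>\<^sub>F n in sequentially. norm (avg {\<sigma>. \<sigma> permutes {1..n}} (\<lambda>\<sigma>. F (scaled_gap n \<sigma>)) - avg (perms {1..n}) (\<lambda>zs. F (scaled_excess n zs))) \<le> real n powr (-1/3)"
      using eventually_ge_at_top[of 3]
    proof eventually_elim
      case (elim n)
      show ?case
        unfolding avg_reindex[OF bij_betw_map_upt, symmetric]
      proof (rule norm_avg_diff_le[OF permutes_finite_nonempty])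
        fix \<sigma> assume "\<sigma> \<in> {\<sigma>. \<sigma> permutes {1..n}}"
        then have "\<bar>scaled_gap n \<sigma> - scaled_excess n (map \<sigma> [1..<Suc n])\<bar> \<le> real n powr (-1/3)"
          using scaled_gap_vs_excess[OF elim] by blast
        then show "norm (F (scaled_gap n \<sigma>) - F (scaled_excess n (map \<sigma> [1..<Suc n]))) \<le> real n powr (-1/3)"
          using bounded_lipschitzD(2)[OF F, of "scaled_gap n \<sigma>" "scaled_excess n (map \<sigma> [1..<Suc n])"] by (simp del: upt_Suc)
      qed
    qed
    show "(\<lambda>n. real n powr (-1/3)) \<longlonglongrightarrow> 0" by real_asymp
  qed
  ultimately show ?thesis using tendsto_add by fastforce
qed

text \<open>Convergence for the ramps \<open>cts_step\<close> already implies weak convergence;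
  their normalisation to a test function is undone by dividing by \<open>d\<close>.\<close>

lemma scaled_gap_weak_conv:
  "weak_conv_m (\<lambda>n. distr (measure_pmf (random_perm n)) borel (scaled_gap n)) (distr M borel (\<lambda>\<omega>. parabolic_max B \<omega> / 2))"
proof (rule integral_cts_step_conv_imp_weak_conv)
  show "real_distribution (distr (measure_pmf (random_perm n)) borel (scaled_gap n))" for n
    by (rule prob_space.real_distribution_distr) (auto simp: measure_pmf.prob_space_axioms)
  show "real_distribution (distr M borel (\<lambda>\<omega>. parabolic_max B \<omega> / 2))" by (rule real_distribution_distr) measurable
  fix x y :: real assume xy: "x < y"
  define d where "d = min 1 (y - x)"
  have d: "d > 0" using xy by (simp add: d_def)
  have BL: "bounded_lipschitz (\<lambda>t. d * cts_step x y t)" unfolding d_def by (rule cts_step_bounded_lipschitz[OF xy])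
  have meas [measurable]: "cts_step x y \<in> borel_measurable borel"
    by (intro borel_measurable_continuous_onI uniformly_continuous_imp_continuous cts_step_uniformly_continuous xy)
  have "(\<lambda>n. avg {\<sigma>. \<sigma> permutes {1..n}} (\<lambda>\<sigma>. d * cts_step x y (scaled_gap n \<sigma>))) \<longlonglongrightarrow> expectation (\<lambda>\<omega>. d * cts_step x y (parabolic_max B \<omega> / 2))"
    by (rule scaled_gap_limit[OF BL])
  then have "(\<lambda>n. (1 / d) * avg {\<sigma>. \<sigma> permutes {1..n}} (\<lambda>\<sigma>. d * cts_step x y (scaled_gap n \<sigma>))) \<longlonglongrightarrow> (1 / d) * expectation (\<lambda>\<omega>. d * cts_step x y (parabolic_max B \<omega> / 2))"
    by (intro tendsto_intros)
  then have "(\<lambda>n. avg {\<sigma>. \<sigma> permutes {1..n}} (\<lambda>\<sigma>. cts_step x y (scaled_gap n \<sigma>))) \<longlonglongrightarrow> expectation (\<lambda>\<omega>. cts_step x y (parabolic_max B \<omega> / 2))"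
    using d by (simp add: avg_mult_left)
  moreover have "integral\<^sup>L (distr (measure_pmf (random_perm n)) borel (scaled_gap n)) (cts_step x y) = avg {\<sigma>. \<sigma> permutes {1..n}} (\<lambda>\<sigma>. cts_step x y (scaled_gap n \<sigma>))" for n
    by (subst integral_distr) (auto simp: expectation_random_perm)
  moreover have "integral\<^sup>L (distr M borel (\<lambda>\<omega>. parabolic_max B \<omega> / 2)) (cts_step x y) = expectation (\<lambda>\<omega>. cts_step x y (parabolic_max B \<omega> / 2))"
    by (rule integral_distr) measurable
  ultimately show "(\<lambda>n. integral\<^sup>L (distr (measure_pmf (random_perm n)) borel (scaled_gap n)) (cts_step x y)) \<longlonglongrightarrow> integral\<^sup>L (distr M borel (\<lambda>\<omega>. parabolic_max B \<omega> / 2)) (cts_step x y)"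
    by simp
qed

lemma AE_parabolic_max_nonneg: "AE \<omega> in M. 0 \<le> parabolic_max B \<omega>"
  using AE_parabolic_max_attained AE_space
proof eventually_elim
  case (elim \<omega>)
  then have "B 0 \<omega> - 0\<^sup>2 / 2 \<le> parabolic_max B \<omega>" by blast
  then show ?case using fwd.starts_at_0 elim by simp
qed

text \<open>No tail of the Brownian maximum is estimated. Truncated means of the discrete excess
  converge, uniform integrability bounds them, and monotone convergence then yields both the
  integrability and the value of the limit.\<close>

lemma scaled_excess_mean_limit:
  "integrable M (parabolic_max B)"
  "(\<lambda>n. avg (perms {1..n}) (scaled_excess n)) \<longlonglongrightarrow> expectation (parabolic_max B) / 2"
proof -
  define V where "V \<omega> = parabolic_max B \<omega> / 2" for \<omega>
  have Vm [measurable]: "V \<in> borel_measurable M" unfolding V_def[abs_def] by measurable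
  define U where "U n = avg (perms {1..n}) (scaled_excess n)" for n
  define cut where "cut T x = min (real T) (max 0 x)" for T :: nat and x :: real
  define m where "m T = expectation (\<lambda>\<omega>. cut T (V \<omega>))" for T
  define Uc where "Uc T n = avg (perms {1..n}) (\<lambda>zs. cut T (scaled_excess n zs))" for T n
  have fin: "finite (perms {1..n::nat})" "perms {1..n::nat} \<noteq> {}" for n by auto
  have nn: "0 \<le> scaled_excess n zs" if "3 \<le> n" "zs \<in> perms {1..n}" for n zs
  proof -
    interpret cyclic_shift "{1..n}" "next_pos n" by (rule cyclic_shift_next_pos[OF that(1)])
    have "length zs = n" using length_perms[OF that(2)] by simp
    then have "0 \<le> excess (half n) zs"
      using excess_le_iff[of "half n" zs "excess (half n) zs"] half_le[of n] by (auto dest: spec[of _ "half n"])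
    then show ?thesis by (simp add: scaled_excess_def)
  qed
  have cut_meas [measurable]: "cut T \<in> borel_measurable borel" for T unfolding cut_def[abs_def] by measurable
  have cut_int: "integrable M (\<lambda>\<omega>. cut T (V \<omega>))" for T
    by (intro integrable_const_bound[of _ "real T"]) (auto simp: cut_def)
  have Uc_lim: "Uc T \<longlonglongrightarrow> m T" if T: "1 \<le> T" for T
  proof -
    \<comment> \<open>Truncation at a level \<open>T \<ge> 1\<close> becomes a test function after
      division by \<open>T\<close>.\<close>
    have BL: "bounded_lipschitz (\<lambda>x. cut T x / real T)"
      unfolding bounded_lipschitz_def
    proof (intro conjI allI)
      fix x y
      show "\<bar>cut T x / real T\<bar> \<le> 1" using T by (auto simp: cut_def min_def max_def)
      have "\<bar>cut T x - cut T y\<bar> \<le> \<bar>x - y\<bar>" by (auto simp: cut_def min_def max_def)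
      also have "\<dots> \<le> \<bar>x - y\<bar> * real T" using mult_left_mono[of 1 "real T" "\<bar>x - y\<bar>"] T by simp
      finally show "\<bar>cut T x / real T - cut T y / real T\<bar> \<le> \<bar>x - y\<bar>"
        unfolding diff_divide_distrib[symmetric] abs_divide using T by (simp add: divide_le_eq)
    qed
    have "(\<lambda>n. avg (perms {1..n}) (\<lambda>zs. cut T (scaled_excess n zs) / real T)) \<longlonglongrightarrow> expectation (\<lambda>\<omega>. cut T (V \<omega>) / real T)"
      unfolding tendsto_iff dist_real_def
    proof (intro allI impI)
      fix e :: real assume e: "0 < e"
      then have "0 < e / 2" by simp
      from scaled_excess_limit[OF this]
      show "\<forall>\<^sub>F n in sequentially. \<bar>avg (perms {1..n}) (\<lambda>zs. cut T (scaled_excess n zs) / real T) - expectation (\<lambda>\<omega>. cut T (V \<omega>) / real T)\<bar> < e"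
      proof eventually_elim
        case (elim n)
        from elim[rule_format, OF BL] show ?case using e by (simp add: V_def)
      qed
    qed
    then have "(\<lambda>n. avg (perms {1..n}) (\<lambda>zs. cut T (scaled_excess n zs) * (1 / real T)) * real T) \<longlonglongrightarrow> expectation (\<lambda>\<omega>. cut T (V \<omega>) / real T) * real T"
      by (intro tendsto_mult tendsto_const) simp
    then show ?thesis using T unfolding Uc_def[abs_def] m_def avg_mult_right by simp
  qed
  have gap: "Uc T n \<le> U n" "U n - Uc T n \<le> avg (perms {1..n}) (\<lambda>zs. max 0 (scaled_excess n zs - real T))" if n: "3 \<le> n" for T n
  proof -
    show "Uc T n \<le> U n" unfolding Uc_def U_def using nn[OF n] by (intro avg_mono) (auto simp: cut_def)
    show "U n - Uc T n \<le> avg (perms {1..n}) (\<lambda>zs. max 0 (scaled_excess n zs - real T))"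
      unfolding Uc_def U_def avg_diff[symmetric] using nn[OF n] by (intro avg_mono) (auto simp: cut_def)
  qed
  have UI: "\<exists>T0. 1 \<le> T0 \<and> (\<forall>T\<ge>T0. \<forall>\<^sub>F n in sequentially. U n - Uc T n \<le> e)" if "0 < e" for e
  proof -
    from scaled_excess_uniformly_integrable[OF that] obtain T0 where T0: "1 \<le> T0"
      and ev: "\<forall>\<^sub>F n in sequentially. avg (perms {1..n}) (\<lambda>zs. max 0 (scaled_excess n zs - real T0)) \<le> e" by blast
    have "\<forall>\<^sub>F n in sequentially. U n - Uc T n \<le> e" if "T0 \<le> T" for T
      using ev eventually_ge_at_top[of 3]
    proof eventually_elim
      case (elim n)
      have "avg (perms {1..n}) (\<lambda>zs. max 0 (scaled_excess n zs - real T)) \<le> avg (perms {1..n}) (\<lambda>zs. max 0 (scaled_excess n zs - real T0))"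
        using that by (intro avg_mono) auto
      then show ?case using gap(2)[OF elim(2), of T] elim(1) by linarith
    qed
    then show ?thesis using T0 by blast
  qed
  \<comment> \<open>At level \<open>T1\<close> truncation loses at most 1. Eventually
    \<open>Uc T n \<le> U n \<le> Uc T1 n + 1\<close>, which bounds every truncated mean by
    \<open>T1 + 1\<close>.\<close>
  obtain T1 where T1: "1 \<le> T1" and ev1: "\<And>T. T1 \<le> T \<Longrightarrow> \<forall>\<^sub>F n in sequentially. U n - Uc T n \<le> 1" using UI[of 1] by auto
  have m_bound: "m T \<le> real T1 + 1" if T: "1 \<le> T" for T
  proof (rule tendsto_upperbound[OF Uc_lim[OF T]])
    show "\<forall>\<^sub>F n in sequentially. Uc T n \<le> real T1 + 1"
      using ev1[OF order_refl] eventually_ge_at_top[of 3]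
    proof eventually_elim
      case (elim n)
      have "Uc T1 n \<le> real T1" unfolding Uc_def by (rule avg_le_const[OF fin]) (simp add: cut_def)
      then show ?case using elim(1) gap(1)[OF elim(2), of T] by linarith
    qed
  qed simp
  have mono: "incseq m"
    unfolding incseq_def m_def by (intro allI impI integral_mono cut_int) (auto simp: cut_def)
  have "m T \<le> real T1 + 1" for T
    using m_bound[of "max 1 T"] mono by (metis incseq_def max.cobounded1 max.cobounded2 order_trans)
  then obtain L where L: "m \<longlonglongrightarrow> L" using incseq_convergent[OF mono, of "real T1 + 1"] by blast
  have cut_mono: "AE \<omega> in M. mono (\<lambda>T. cut T (V \<omega>))" by (auto simp: mono_def cut_def)
  have cut_lim: "AE \<omega> in M. (\<lambda>T. cut T (V \<omega>)) \<longlonglongrightarrow> V \<omega>"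
    using AE_parabolic_max_nonneg
  proof eventually_elim
    case (elim \<omega>)
    obtain k :: nat where k: "V \<omega> \<le> real k" using real_arch_simple by blast
    have "\<forall>\<^sub>F T in sequentially. cut T (V \<omega>) = V \<omega>"
      using eventually_ge_at_top[of k] by eventually_elim (use elim k in \<open>auto simp: cut_def V_def min_def max_def\<close>)
    then show ?case by (rule tendsto_eventually)
  qed
  have intV: "integrable M V"
    by (rule integrable_monotone_convergence[OF cut_int cut_mono cut_lim L[unfolded m_def[abs_def]] Vm])
  have LV: "L = expectation V"
    by (rule integral_monotone_convergence[OF cut_int cut_mono cut_lim L[unfolded m_def[abs_def]] Vm, symmetric])
  have eqV: "parabolic_max B = (\<lambda>\<omega>. 2 * V \<omega>)" by (simp add: V_def)
  show "integrable M (parabolic_max B)" unfolding eqV using intV by simp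
  have "U \<longlonglongrightarrow> L"
    unfolding tendsto_iff dist_real_def
  proof (intro allI impI)
    fix e :: real assume e: "0 < e"
    then have e3: "0 < e / 4" by simp
    from UI[OF e3] obtain T0 where T0: "1 \<le> T0" "\<And>T. T0 \<le> T \<Longrightarrow> \<forall>\<^sub>F n in sequentially. U n - Uc T n \<le> e / 4" by blast
    have "\<forall>\<^sub>F T in sequentially. \<bar>m T - L\<bar> < e / 4" using L e3 unfolding tendsto_iff dist_real_def by blast
    then have "\<forall>\<^sub>F T in sequentially. \<bar>m T - L\<bar> < e / 4 \<and> T0 \<le> T" using eventually_ge_at_top[of T0] by eventually_elim auto
    then obtain T where T: "\<bar>m T - L\<bar> < e / 4" "T0 \<le> T" by (auto simp: eventually_sequentially)
    have "1 \<le> T" using T0 T by simp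
    from Uc_lim[OF this] e3 have "\<forall>\<^sub>F n in sequentially. \<bar>Uc T n - m T\<bar> < e / 4" unfolding tendsto_iff dist_real_def by blast
    then show "\<forall>\<^sub>F n in sequentially. \<bar>U n - L\<bar> < e"
      using T0(2)[OF T(2)] eventually_ge_at_top[of 3]
    proof eventually_elim
      case (elim n)
      then show ?case using gap(1)[OF elim(3), of T] T(1) e by linarith
    qed
  qed
  then show "(\<lambda>n. avg (perms {1..n}) (scaled_excess n)) \<longlonglongrightarrow> expectation (parabolic_max B) / 2"
    unfolding LV U_def[abs_def] V_def[abs_def] by simp
qed

lemma scaled_gap_mean_limit:
  "(\<lambda>n. avg {\<sigma>. \<sigma> permutes {1..n}} (scaled_gap n)) \<longlonglongrightarrow> expectation (parabolic_max B) / 2"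
proof -
  have "(\<lambda>n. avg {\<sigma>. \<sigma> permutes {1..n}} (scaled_gap n) - avg (perms {1..n}) (scaled_excess n)) \<longlonglongrightarrow> 0"
  proof (rule Lim_null_comparison)
    show "\<forall>\<^sub>F n in sequentially. norm (avg {\<sigma>. \<sigma> permutes {1..n}} (scaled_gap n) - avg (perms {1..n}) (scaled_excess n)) \<le> real n powr (-1/3)"
      using eventually_ge_at_top[of 3]
    proof eventually_elim
      case (elim n)
      show ?case
        unfolding avg_reindex[OF bij_betw_map_upt, symmetric]
      proof (rule norm_avg_diff_le[OF permutes_finite_nonempty])
        fix \<sigma> assume "\<sigma> \<in> {\<sigma>. \<sigma> permutes {1..n}}"
        then show "norm (scaled_gap n \<sigma> - scaled_excess n (map \<sigma> [1..<Suc n])) \<le> real n powr (-1/3)"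
          using scaled_gap_vs_excess[OF elim] by (simp del: upt_Suc)
      qed
    qed
    show "(\<lambda>n. real n powr (-1/3)) \<longlonglongrightarrow> 0" by real_asymp
  qed
  then show ?thesis using scaled_excess_mean_limit(2) tendsto_add by fastforce
qed

end

theorem theorem1p3:
  fixes M :: "'a measure" and B :: "real \<Rightarrow> 'a \<Rightarrow> real"
  assumes "two_sided_brownian_motion M B"
  defines "V \<equiv> parabolic_max B"
    and "EX_star \<equiv> \<lambda>n. measure_pmf.expectation (random_perm n) (max_num_runs n)"
    and "EX_half \<equiv> \<lambda>n. measure_pmf.expectation (random_perm n) (num_runs n (nat \<lceil>real n / 2\<rceil>))"
    and "EV \<equiv> integral\<^sup>L M (parabolic_max B)"
  shows "(AE \<omega> in M. \<exists>t. V \<omega> = B t \<omega> - t\<^sup>2 / 2 \<and> (\<forall>s. B s \<omega> - s\<^sup>2 / 2 \<le> V \<omega>))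
    \<and> weak_conv_m
        (\<lambda>n. distr (measure_pmf (random_perm n)) borel
          (\<lambda>\<sigma>. real n powr (-1/3) * (max_num_runs n \<sigma> - num_runs n (nat \<lceil>real n / 2\<rceil>) \<sigma>)))
        (distr M borel (\<lambda>\<omega>. 1/2 * V \<omega>))
    \<and> integrable M V
    \<and> (\<lambda>n. EX_star n - (EX_half n + 1/2 * EV * real n powr (1/3))) \<in> o(\<lambda>n. real n powr (1/3))
    \<and> (\<lambda>n. EX_star n - (1/4 * real n + 1/2 * EV * real n powr (1/3))) \<in> o(\<lambda>n. real n powr (1/3))"
proof -
  interpret two_sided_brownian_motion M B by (rule assms(1))
  have max: "AE \<omega> in M. \<exists>t. V \<omega> = B t \<omega> - t\<^sup>2 / 2 \<and> (\<forall>s. B s \<omega> - s\<^sup>2 / 2 \<le> V \<omega>)"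
    using AE_parabolic_max_attained unfolding V_def by eventually_elim blast
  have weak: "weak_conv_m
        (\<lambda>n. distr (measure_pmf (random_perm n)) borel
          (\<lambda>\<sigma>. real n powr (-1/3) * (max_num_runs n \<sigma> - num_runs n (nat \<lceil>real n / 2\<rceil>) \<sigma>)))
        (distr M borel (\<lambda>\<omega>. 1/2 * V \<omega>))"
    using scaled_gap_weak_conv unfolding scaled_gap_def[abs_def] half_def V_def by simp
  have int: "integrable M V" unfolding V_def by (rule scaled_excess_mean_limit(1))
  define P where "P n = {\<sigma>. \<sigma> permutes {1..n::nat}}" for n
  have gap: "EX_star n - EX_half n = real n powr (1/3) * avg (P n) (scaled_gap n)" if "0 < n" for n
  proof -
    have "real n powr (1/3) * avg (P n) (scaled_gap n) = avg (P n) (\<lambda>\<sigma>. max_num_runs n \<sigma> - num_runs n (half n) \<sigma>)"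
      unfolding avg_mult_left[symmetric] scaled_gap_def using that
      by (intro avg_cong) (simp_all add: mult.assoc[symmetric] powr_add[symmetric])
    then show ?thesis
      unfolding EX_star_def EX_half_def expectation_random_perm P_def half_def avg_diff by simp
  qed
  have lim: "(\<lambda>n. avg (P n) (scaled_gap n) - 1/2 * EV) \<longlonglongrightarrow> 0"
    using tendsto_diff[OF scaled_gap_mean_limit tendsto_const[of "1/2 * EV"]] by (simp add: P_def EV_def)
  have first: "(\<lambda>n. EX_star n - (EX_half n + 1/2 * EV * real n powr (1/3))) \<in> o(\<lambda>n. real n powr (1/3))"
  proof (rule smalloI_tendsto)
    show "(\<lambda>n. (EX_star n - (EX_half n + 1/2 * EV * real n powr (1/3))) / real n powr (1/3)) \<longlonglongrightarrow> 0"
    proof (rule Lim_transform_eventually[OF lim])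
      show "\<forall>\<^sub>F n in sequentially. avg (P n) (scaled_gap n) - 1/2 * EV = (EX_star n - (EX_half n + 1/2 * EV * real n powr (1/3))) / real n powr (1/3)"
        using eventually_gt_at_top[of 0]
      proof eventually_elim
        case (elim n)
        have "EX_star n - (EX_half n + 1/2 * EV * real n powr (1/3)) = real n powr (1/3) * (avg (P n) (scaled_gap n) - 1/2 * EV)"
          using gap[OF elim] by (simp add: algebra_simps)
        then show ?case using elim by simp
      qed
    qed
    show "\<forall>\<^sub>F n in sequentially. real n powr (1/3) \<noteq> 0" using eventually_gt_at_top[of 0] by eventually_elim simp
  qed
  \<comment> \<open>The mean at half filling differs from \<open>n / 4\<close> by at most 2, which
    is negligible at the scale \<open>n^(1/3)\<close>.\<close>
  have "(\<lambda>n. EX_half n - 1/4 * real n) \<in> O(\<lambda>_. 1)"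
  proof (rule bigoI)
    show "\<forall>\<^sub>F n in sequentially. norm (EX_half n - 1/4 * real n) \<le> 2 * norm (1 :: real)"
      using eventually_ge_at_top[of 4]
    proof eventually_elim
      case (elim n)
      then show ?case using half_mean_bound[of n] by (simp add: EX_half_def expectation_random_perm half_def)
    qed
  qed
  moreover have "(\<lambda>n. 1 :: real) \<in> o(\<lambda>n. real n powr (1/3))" by real_asymp
  ultimately have second: "(\<lambda>n. EX_half n - 1/4 * real n) \<in> o(\<lambda>n. real n powr (1/3))" by (rule landau_o.big_small_trans)
  have "(\<lambda>n. EX_star n - (1/4 * real n + 1/2 * EV * real n powr (1/3))) \<in> o(\<lambda>n. real n powr (1/3))"
    using sum_in_smallo(1)[OF first second] by (simp add: algebra_simps)
  then show ?thesis using max weak int first by blast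
qed

end
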